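(* Let $\mathcal{G}=(G^0,\mathcal{G}^1,r,s)$ be an ultragraph and let $R$ be a nonzero unital commutative ring. Equip $L_R(\mathcal{G})$ with its $\mathbb{Z}$-grading $\{L_R(\mathcal{G})_n\}_{n\in\mathbb{Z}}$. (1) If $L_R(\mathcal{G})$ is epsilon-strongly $\mathbb{Z}$-graded, then $\mathcal{G}^1$ is a finite set and $G^0\in\mathcal{G}^0$. (2) If $\mathcal{G}^1$ is a finite set, $G^0\in\mathcal{G}^0$, and for each edge $e_1\in\mathcal{G}^1$ there exists an edge $e_2\in\mathcal{G}^1$ such that $s(e_1)\in r(e_2)$, then $L_R(\mathcal{G})$ is epsilon-strongly $\mathbb{Z}$-graded.
   Context: An ultragraph $\mathcal{G}=(G^0,\mathcal{G}^1,r,s)$ consists of two countable sets $G^0$ (vertices) and $\mathcal{G}^1$ (edges), a map $s:\mathcal{G}^1\to G^0$ and a map $r:\mathcal{G}^1\to P(G^0)\setminus\{\emptyset\}$, where $P(G^0)$ is the power set of $G^0$. $\mathcal{G}^0$ (the set of generalized vertices) is the smallest subset of $P(G^0)$ that contains $\{v\}$ for all $v\in G^0$, contains $r(e)$ for all $e\in\mathcal{G}^1$, and is closed under finite unions and non-empty finite intersections. For a unital commutative ring $R$, $L_R(\mathcal{G})$ is the universal $R$-algebra with generators $\{s_e,s_e^*:e\in\mathcal{G}^1\}\cup\{p_A:A\in\mathcal{G}^0\}$ and relations: (1) $p_\emptyset=0$, $p_Ap_B=p_{A\cap B}$, $p_{A\cup B}=p_A+p_B-p_{A\cap B}$ for all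 $A,B\in\mathcal{G}^0$; (2) $p_{s(e)}s_e=s_ep_{r(e)}=s_e$ and $p_{r(e)}s_e^*=s_e^*p_{s(e)}=s_e^*$ for all $e\in\mathcal{G}^1$; (3) $s_e^*s_f=\delta_{e,f}p_{r(e)}$ for all $e,f\in\mathcal{G}^1$; (4) $p_v=\sum_{s(e)=v}s_es_e^*$ whenever $0<|s^{-1}(v)|<\infty$. Here $p_v$ means $p_{\{v\}}$. A finite path is either an element of $\mathcal{G}^0$ (of length $0$) or a sequence of edges $e_1\cdots e_n$ (of length $n$) with $s(e_{i+1})\in r(e_i)$ for $1\le i<n$; $\mathcal{G}^*$ is the set of finite paths. For $\alpha=e_1\cdots e_n$, $s_\alpha=s_{e_1}\cdots s_{e_n}$ and $s_\alpha^*=s_{e_n}^*\cdots s_{e_1}^*$; for $A\in\mathcal{G}^0$, $s_A=s_A^*=p_A$. The $\mathbb{Z}$-grading: $L_R(\mathcal{G})_m$ is the set of finite sums $\sum_i\lambda_is_{\alpha_i}p_{A_i}s_{\beta_i}^*$ with $\lambda_i\in R$, $\alpha_i,\beta_i\in\mathcal{G}^*$, $A_i\in\mathcal{G}^0$, $|\alpha_i|-|\beta_i|=m$. A grading $\{T_g\}_{g\in\Gamma}$ of a ring $T$ by a group $\Gamma$ is epsilon-strong if for each $g\in\Gamma$ the $(T_gT_{g^{-1}},T_{g^{-1}}T_g)$-bimodule $T_g$ is unital; equivalently, for each $g\in\Gamma$ there is $\epsilon_g\in T_gT_{g^{-1}}$ such that $\epsilon_gs=s=s\epsilon_{g^{-1}}$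 for all $s\in T_g$. Here $T_gT_h$ denotes the set of finite sums of products. *)

theory Defs
  imports "HOL-Algebra.Module" "HOL-Algebra.AbelCoset" "HOL-Library.Countable_Set"
begin

section \<open>Rings without unit and epsilon-strong gradings\<close>

text \<open>Rings and algebras need not be unital here. They are still represented by the records of
  HOL-Algebra; the field \<open>one\<close> of such a record is ignored.\<close>

locale nonunital_ring = abelian_group T for T (structure) +
  assumes mult_closed [simp, intro]:
      "\<lbrakk>x \<in> carrier T; y \<in> carrier T\<rbrakk> \<Longrightarrow> x \<otimes> y \<in> carrier T"
    and mult_assoc:
      "\<lbrakk>x \<in> carrier T; y \<in> carrier T; z \<in> carrier T\<rbrakk> \<Longrightarrow> (x \<otimes> y) \<otimes> z = x \<otimes> (y \<otimes> z)"
    and l_distrib: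
      "\<lbrakk>x \<in> carrier T; y \<in> carrier T; z \<in> carrier T\<rbrakk> \<Longrightarrow> (x \<oplus> y) \<otimes> z = x \<otimes> z \<oplus> y \<otimes> z"
    and r_distrib:
      "\<lbrakk>x \<in> carrier T; y \<in> carrier T; z \<in> carrier T\<rbrakk> \<Longrightarrow> z \<otimes> (x \<oplus> y) = z \<otimes> x \<oplus> z \<otimes> y"

locale nonunital_algebra = module R A + nonunital_ring A for R (structure) and A (structure) +
  assumes smult_mult_left:
      "\<lbrakk>a \<in> carrier R; x \<in> carrier A; y \<in> carrier A\<rbrakk>
        \<Longrightarrow> (a \<odot>\<^bsub>A\<^esub> x) \<otimes>\<^bsub>A\<^esub> y = a \<odot>\<^bsub>A\<^esub> (x \<otimes>\<^bsub>A\<^esub> y)"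
    and smult_mult_right:
      "\<lbrakk>a \<in> carrier R; x \<in> carrier A; y \<in> carrier A\<rbrakk>
        \<Longrightarrow> x \<otimes>\<^bsub>A\<^esub> (a \<odot>\<^bsub>A\<^esub> y) = a \<odot>\<^bsub>A\<^esub> (x \<otimes>\<^bsub>A\<^esub> y)"

definition sums_of_products :: "('a, 'm) ring_scheme \<Rightarrow> 'a set \<Rightarrow> 'a set \<Rightarrow> 'a set" where
  "sums_of_products T A B =
     {(\<Oplus>\<^bsub>T\<^esub>i\<in>{..<n}. a i \<otimes>\<^bsub>T\<^esub> b i) | (n :: nat) a b. a \<in> {..<n} \<rightarrow> A \<and> b \<in> {..<n} \<rightarrow> B}"

definition graded_ring :: "('a, 'm) ring_scheme \<Rightarrow> ('g :: group_add \<Rightarrow> 'a set) \<Rightarrow> bool" where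
  "graded_ring T C \<longleftrightarrow>
     nonunital_ring T \<and>
     (\<forall>g. additive_subgroup (C g) T) \<and>
     (\<forall>x\<in>carrier T. \<exists>!f. (\<forall>g. f g \<in> C g) \<and> finite {g. f g \<noteq> \<zero>\<^bsub>T\<^esub>} \<and>
        x = (\<Oplus>\<^bsub>T\<^esub>g\<in>{g. f g \<noteq> \<zero>\<^bsub>T\<^esub>}. f g)) \<and>
     (\<forall>g h. \<forall>x\<in>C g. \<forall>y\<in>C h. x \<otimes>\<^bsub>T\<^esub> y \<in> C (g + h))"

text \<open>Unitality of an \<open>(A, B)\<close>-bimodule \<open>M\<close>, where \<open>A\<close>, \<open>B\<close> and \<open>M\<close> all lie in the ring \<open>T\<close>:
  \<open>A\<close> and \<open>B\<close> have an identity element, and these act as the identity on \<open>M\<close>.\<close>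

definition unital_bimodule :: "('a, 'm) ring_scheme \<Rightarrow> 'a set \<Rightarrow> 'a set \<Rightarrow> 'a set \<Rightarrow> bool" where
  "unital_bimodule T A B M \<longleftrightarrow>
     (\<exists>u\<in>A. (\<forall>a\<in>A. u \<otimes>\<^bsub>T\<^esub> a = a \<and> a \<otimes>\<^bsub>T\<^esub> u = a) \<and> (\<forall>x\<in>M. u \<otimes>\<^bsub>T\<^esub> x = x)) \<and>
     (\<exists>v\<in>B. (\<forall>b\<in>B. v \<otimes>\<^bsub>T\<^esub> b = b \<and> b \<otimes>\<^bsub>T\<^esub> v = b) \<and> (\<forall>x\<in>M. x \<otimes>\<^bsub>T\<^esub> v = x))"

definition epsilon_strongly_graded ::
    "('a, 'm) ring_scheme \<Rightarrow> ('g :: group_add \<Rightarrow> 'a set) \<Rightarrow> bool" where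
  "epsilon_strongly_graded T C \<longleftrightarrow>
     graded_ring T C \<and>
     (\<forall>g. unital_bimodule T (sums_of_products T (C g) (C (- g)))
            (sums_of_products T (C (- g)) (C g)) (C g))"

lemma (in nonunital_ring) null_left [simp]:
  assumes "x \<in> carrier T"
  shows "\<zero> \<otimes> x = \<zero>"
proof -
  have "\<zero> \<otimes> x \<oplus> \<zero> \<otimes> x = \<zero> \<otimes> x \<oplus> \<zero>"
    using l_distrib[of \<zero> \<zero> x] assms by simp
  then show ?thesis
    using assms by simp
qed

lemma (in nonunital_ring) null_right [simp]:
  assumes "x \<in> carrier T"
  shows "x \<otimes> \<zero> = \<zero>"
proof -
  have "x \<otimes> \<zero> \<oplus> x \<otimes> \<zero> = x \<otimes> \<zero> \<oplus> \<zero>"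
    using r_distrib[of \<zero> \<zero> x] assms by simp
  then show ?thesis
    using assms by simp
qed

lemma (in nonunital_ring) sum_mult_right:
  assumes "finite I" "y \<in> carrier T" "f \<in> I \<rightarrow> carrier T"
  shows "(\<Oplus>i\<in>I. f i) \<otimes> y = (\<Oplus>i\<in>I. f i \<otimes> y)"
  using assms by (induction I rule: finite_induct) (simp_all add: Pi_def l_distrib)

lemma (in nonunital_ring) sum_mult_left:
  assumes "finite I" "y \<in> carrier T" "f \<in> I \<rightarrow> carrier T"
  shows "y \<otimes> (\<Oplus>i\<in>I. f i) = (\<Oplus>i\<in>I. y \<otimes> f i)"
  using assms by (induction I rule: finite_induct) (simp_all add: Pi_def r_distrib)

lemma (in nonunital_ring) sums_of_products_identity_left:
  assumes "A \<subseteq> carrier T" "B \<subseteq> carrier T" "u \<in> carrier T" "\<And>a. a \<in> A \<Longrightarrow> u \<otimes> a = a"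
    and "x \<in> sums_of_products T A B"
  shows "u \<otimes> x = x"
proof -
  obtain n :: nat and a b where x: "x = (\<Oplus>i\<in>{..<n}. a i \<otimes> b i)"
    and ab: "a \<in> {..<n} \<rightarrow> A" "b \<in> {..<n} \<rightarrow> B"
    using assms(5) by (auto simp: sums_of_products_def)
  have c: "a i \<in> carrier T" "b i \<in> carrier T" "u \<otimes> a i = a i" if "i < n" for i
    using ab that assms(1,2,4) by (auto simp: Pi_def)
  have "u \<otimes> x = (\<Oplus>i\<in>{..<n}. u \<otimes> (a i \<otimes> b i))"
    unfolding x using c assms(3) by (intro sum_mult_left) auto
  also have "\<dots> = x"
    unfolding x by (rule finsum_cong') (use c assms(3) in \<open>auto simp flip: mult_assoc\<close>)
  finally show ?thesis .
qed

lemma (in nonunital_ring) sums_of_products_identity_right: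
  assumes "A \<subseteq> carrier T" "B \<subseteq> carrier T" "u \<in> carrier T" "\<And>b. b \<in> B \<Longrightarrow> b \<otimes> u = b"
    and "x \<in> sums_of_products T A B"
  shows "x \<otimes> u = x"
proof -
  obtain n :: nat and a b where x: "x = (\<Oplus>i\<in>{..<n}. a i \<otimes> b i)"
    and ab: "a \<in> {..<n} \<rightarrow> A" "b \<in> {..<n} \<rightarrow> B"
    using assms(5) by (auto simp: sums_of_products_def)
  have c: "a i \<in> carrier T" "b i \<in> carrier T" "b i \<otimes> u = b i" if "i < n" for i
    using ab that assms(1,2,4) by (auto simp: Pi_def)
  have "x \<otimes> u = (\<Oplus>i\<in>{..<n}. (a i \<otimes> b i) \<otimes> u)"
    unfolding x using c assms(3) by (intro sum_mult_right) auto
  also have "\<dots> = x"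
    unfolding x by (rule finsum_cong') (use c assms(3) in \<open>auto simp: mult_assoc\<close>)
  finally show ?thesis .
qed

lemma (in nonunital_ring) sums_of_products_subset:
  assumes "A \<subseteq> carrier T" "B \<subseteq> carrier T"
  shows "sums_of_products T A B \<subseteq> carrier T"
  using assms by (auto simp: sums_of_products_def Pi_def subset_iff intro!: finsum_closed)

text \<open>The usual reformulation of the definition with elements \<open>\<epsilon> g\<close>.\<close>

lemma epsilon_strongly_graded_iff:
  "epsilon_strongly_graded T C \<longleftrightarrow>
     graded_ring T C \<and>
     (\<exists>\<epsilon>. \<forall>g. \<epsilon> g \<in> sums_of_products T (C g) (C (- g)) \<and>
        (\<forall>x\<in>C g. \<epsilon> g \<otimes>\<^bsub>T\<^esub> x = x \<and> x \<otimes>\<^bsub>T\<^esub> \<epsilon> (- g) = x))"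
proof (cases "graded_ring T C")
  case True
  then interpret nonunital_ring T
    by (simp add: graded_ring_def)
  have C: "C g \<subseteq> carrier T" for g
    using True additive_subgroup.a_subset unfolding graded_ring_def by blast
  let ?P = "\<lambda>g. sums_of_products T (C g) (C (- g))"
  have P: "?P g \<subseteq> carrier T" for g
    by (rule sums_of_products_subset[OF C C])
  have "(\<forall>g. unital_bimodule T (?P g) (?P (- g)) (C g)) \<longleftrightarrow>
    (\<exists>\<epsilon>. \<forall>g. \<epsilon> g \<in> ?P g \<and> (\<forall>x\<in>C g. \<epsilon> g \<otimes>\<^bsub>T\<^esub> x = x \<and> x \<otimes>\<^bsub>T\<^esub> \<epsilon> (- g) = x))"
  proof
    assume "\<forall>g. unital_bimodule T (?P g) (?P (- g)) (C g)"
    then have U: "unital_bimodule T (?P g) (?P (- g)) (C g)" for g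
      by blast
    have "\<exists>u. u \<in> ?P g \<and> (\<forall>a\<in>?P g. u \<otimes>\<^bsub>T\<^esub> a = a \<and> a \<otimes>\<^bsub>T\<^esub> u = a) \<and> (\<forall>x\<in>C g. u \<otimes>\<^bsub>T\<^esub> x = x)"
      for g using U[of g] unfolding unital_bimodule_def by blast
    then obtain \<epsilon> where \<epsilon>: "\<And>g. \<epsilon> g \<in> ?P g"
        "\<And>g. \<forall>a\<in>?P g. \<epsilon> g \<otimes>\<^bsub>T\<^esub> a = a \<and> a \<otimes>\<^bsub>T\<^esub> \<epsilon> g = a" "\<And>g. \<forall>x\<in>C g. \<epsilon> g \<otimes>\<^bsub>T\<^esub> x = x"
      by metis
    have "x \<otimes>\<^bsub>T\<^esub> \<epsilon> (- g) = x" if "x \<in> C g" for g x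
    proof -
      obtain v where v: "v \<in> ?P (- g)" "\<forall>b\<in>?P (- g). v \<otimes>\<^bsub>T\<^esub> b = b \<and> b \<otimes>\<^bsub>T\<^esub> v = b"
          "\<forall>x\<in>C g. x \<otimes>\<^bsub>T\<^esub> v = x"
        using U[of g] unfolding unital_bimodule_def by blast
      have "v = \<epsilon> (- g)"
        using v(1,2) \<epsilon>(1,2)[of "- g"] by metis
      then show ?thesis
        using v(3) that by blast
    qed
    then show "\<exists>\<epsilon>. \<forall>g. \<epsilon> g \<in> ?P g \<and> (\<forall>x\<in>C g. \<epsilon> g \<otimes>\<^bsub>T\<^esub> x = x \<and> x \<otimes>\<^bsub>T\<^esub> \<epsilon> (- g) = x)"
      using \<epsilon> by blast
  next
    assume "\<exists>\<epsilon>. \<forall>g. \<epsilon> g \<in> ?P g \<and> (\<forall>x\<in>C g. \<epsilon> g \<otimes>\<^bsub>T\<^esub> x = x \<and> x \<otimes>\<^bsub>T\<^esub> \<epsilon> (- g) = x)"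
    then obtain \<epsilon> where \<epsilon>: "\<And>g. \<epsilon> g \<in> ?P g" "\<And>g x. x \<in> C g \<Longrightarrow> \<epsilon> g \<otimes>\<^bsub>T\<^esub> x = x"
        "\<And>g x. x \<in> C g \<Longrightarrow> x \<otimes>\<^bsub>T\<^esub> \<epsilon> (- g) = x"
      by blast
    have \<epsilon>c: "\<epsilon> g \<in> carrier T" for g
      using \<epsilon>(1) P by blast
    have R: "x \<otimes>\<^bsub>T\<^esub> \<epsilon> g = x" if "x \<in> C (- g)" for g x
      using \<epsilon>(3)[OF that] by simp
    have id: "\<epsilon> g \<otimes>\<^bsub>T\<^esub> a = a \<and> a \<otimes>\<^bsub>T\<^esub> \<epsilon> g = a" if "a \<in> ?P g" for g a
      using sums_of_products_identity_left[OF C C \<epsilon>c \<epsilon>(2) that]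
        sums_of_products_identity_right[OF C C \<epsilon>c R that] by blast
    show "\<forall>g. unital_bimodule T (?P g) (?P (- g)) (C g)"
      unfolding unital_bimodule_def using \<epsilon> id by blast
  qed
  then show ?thesis
    using True by (simp add: epsilon_strongly_graded_def)
qed (simp add: epsilon_strongly_graded_def)


section \<open>Algebras given by generators and relations\<close>

datatype (gens: 'x, scalars: 'r) alg_expr =
    Gen 'x
  | Zero
  | Add "('x, 'r) alg_expr" "('x, 'r) alg_expr"
  | Neg "('x, 'r) alg_expr"
  | Mult "('x, 'r) alg_expr" "('x, 'r) alg_expr"
  | Smult 'r "('x, 'r) alg_expr"

definition exprs :: "('r, 'm) ring_scheme \<Rightarrow> 'x set \<Rightarrow> ('x, 'r) alg_expr set" where
  "exprs R X = {t. gens t \<subseteq> X \<and> scalars t \<subseteq> carrier R}"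

text \<open>The least congruence on the expressions over \<open>X\<close> which contains \<open>Rel\<close> and all instances of
  the axioms of associative (not necessarily unital) \<open>R\<close>-algebras.\<close>

inductive_set pres_cong ::
    "('r, 'm) ring_scheme \<Rightarrow> 'x set \<Rightarrow> (('x, 'r) alg_expr \<times> ('x, 'r) alg_expr) set
      \<Rightarrow> (('x, 'r) alg_expr \<times> ('x, 'r) alg_expr) set"
  for R :: "('r, 'm) ring_scheme" (structure)
    and X :: "'x set"
    and Rel :: "(('x, 'r) alg_expr \<times> ('x, 'r) alg_expr) set"
where
  rel: "\<lbrakk>(x, y) \<in> Rel; x \<in> exprs R X; y \<in> exprs R X\<rbrakk> \<Longrightarrow> (x, y) \<in> pres_cong R X Rel"
| refl: "x \<in> exprs R X \<Longrightarrow> (x, x) \<in> pres_cong R X Rel"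
| sym: "(x, y) \<in> pres_cong R X Rel \<Longrightarrow> (y, x) \<in> pres_cong R X Rel"
| trans: "\<lbrakk>(x, y) \<in> pres_cong R X Rel; (y, z) \<in> pres_cong R X Rel\<rbrakk> \<Longrightarrow> (x, z) \<in> pres_cong R X Rel"
| Add: "\<lbrakk>(x, x') \<in> pres_cong R X Rel; (y, y') \<in> pres_cong R X Rel\<rbrakk>
    \<Longrightarrow> (Add x y, Add x' y') \<in> pres_cong R X Rel"
| Neg: "(x, x') \<in> pres_cong R X Rel \<Longrightarrow> (Neg x, Neg x') \<in> pres_cong R X Rel"
| Mult: "\<lbrakk>(x, x') \<in> pres_cong R X Rel; (y, y') \<in> pres_cong R X Rel\<rbrakk>
    \<Longrightarrow> (Mult x y, Mult x' y') \<in> pres_cong R X Rel"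
| Smult: "\<lbrakk>a \<in> carrier R; (x, x') \<in> pres_cong R X Rel\<rbrakk>
    \<Longrightarrow> (Smult a x, Smult a x') \<in> pres_cong R X Rel"
| add_assoc: "\<lbrakk>x \<in> exprs R X; y \<in> exprs R X; z \<in> exprs R X\<rbrakk>
    \<Longrightarrow> (Add (Add x y) z, Add x (Add y z)) \<in> pres_cong R X Rel"
| add_comm: "\<lbrakk>x \<in> exprs R X; y \<in> exprs R X\<rbrakk> \<Longrightarrow> (Add x y, Add y x) \<in> pres_cong R X Rel"
| add_zero: "x \<in> exprs R X \<Longrightarrow> (Add Zero x, x) \<in> pres_cong R X Rel"
| add_neg: "x \<in> exprs R X \<Longrightarrow> (Add (Neg x) x, Zero) \<in> pres_cong R X Rel"
| mult_assoc: "\<lbrakk>x \<in> exprs R X; y \<in> exprs R X; z \<in> exprs R X\<rbrakk>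
    \<Longrightarrow> (Mult (Mult x y) z, Mult x (Mult y z)) \<in> pres_cong R X Rel"
| distrib_left: "\<lbrakk>x \<in> exprs R X; y \<in> exprs R X; z \<in> exprs R X\<rbrakk>
    \<Longrightarrow> (Mult (Add x y) z, Add (Mult x z) (Mult y z)) \<in> pres_cong R X Rel"
| distrib_right: "\<lbrakk>x \<in> exprs R X; y \<in> exprs R X; z \<in> exprs R X\<rbrakk>
    \<Longrightarrow> (Mult z (Add x y), Add (Mult z x) (Mult z y)) \<in> pres_cong R X Rel"
| smult_add: "\<lbrakk>a \<in> carrier R; x \<in> exprs R X; y \<in> exprs R X\<rbrakk>
    \<Longrightarrow> (Smult a (Add x y), Add (Smult a x) (Smult a y)) \<in> pres_cong R X Rel"
| add_smult: "\<lbrakk>a \<in> carrier R; b \<in> carrier R; x \<in> exprs R X\<rbrakk>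
    \<Longrightarrow> (Smult (a \<oplus> b) x, Add (Smult a x) (Smult b x)) \<in> pres_cong R X Rel"
| smult_smult: "\<lbrakk>a \<in> carrier R; b \<in> carrier R; x \<in> exprs R X\<rbrakk>
    \<Longrightarrow> (Smult (a \<otimes> b) x, Smult a (Smult b x)) \<in> pres_cong R X Rel"
| smult_one: "x \<in> exprs R X \<Longrightarrow> (Smult \<one> x, x) \<in> pres_cong R X Rel"
| smult_mult_left: "\<lbrakk>a \<in> carrier R; x \<in> exprs R X; y \<in> exprs R X\<rbrakk>
    \<Longrightarrow> (Mult (Smult a x) y, Smult a (Mult x y)) \<in> pres_cong R X Rel"
| smult_mult_right: "\<lbrakk>a \<in> carrier R; x \<in> exprs R X; y \<in> exprs R X\<rbrakk>
    \<Longrightarrow> (Mult x (Smult a y), Smult a (Mult x y)) \<in> pres_cong R X Rel"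

text \<open>The field \<open>one\<close> is junk: the algebra need not have an identity element.\<close>

definition presented_algebra ::
    "('r, 'm) ring_scheme \<Rightarrow> 'x set \<Rightarrow> (('x, 'r) alg_expr \<times> ('x, 'r) alg_expr) set
      \<Rightarrow> ('r, ('x, 'r) alg_expr set) module" where
  "presented_algebra R X Rel =
     \<lparr>carrier = exprs R X // pres_cong R X Rel,
      mult = (\<lambda>P Q. \<Union>x\<in>P. \<Union>y\<in>Q. pres_cong R X Rel `` {Mult x y}),
      one = undefined,
      zero = pres_cong R X Rel `` {Zero},
      add = (\<lambda>P Q. \<Union>x\<in>P. \<Union>y\<in>Q. pres_cong R X Rel `` {Add x y}),
      smult = (\<lambda>a P. \<Union>x\<in>P. pres_cong R X Rel `` {Smult a x})\<rparr>"

context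
  fixes R :: "('r, 'm) ring_scheme" (structure)
    and X :: "'x set"
    and Rel :: "(('x, 'r) alg_expr \<times> ('x, 'r) alg_expr) set"
  assumes R: "cring R"
begin

interpretation R: cring R by (rule R)

abbreviation (input) \<open>pcls x \<equiv> pres_cong R X Rel `` {x}\<close>
abbreviation (input) \<open>pres_alg \<equiv> presented_algebra R X Rel\<close>

lemma exprs_simps:
  "Gen g \<in> exprs R X \<longleftrightarrow> g \<in> X"
  "Zero \<in> exprs R X"
  "Add x y \<in> exprs R X \<longleftrightarrow> x \<in> exprs R X \<and> y \<in> exprs R X"
  "Neg x \<in> exprs R X \<longleftrightarrow> x \<in> exprs R X"
  "Mult x y \<in> exprs R X \<longleftrightarrow> x \<in> exprs R X \<and> y \<in> exprs R X"
  "Smult a x \<in> exprs R X \<longleftrightarrow> a \<in> carrier R \<and> x \<in> exprs R X"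
  by (auto simp: exprs_def)

lemma pres_cong_exprs:
  "(x, y) \<in> pres_cong R X Rel \<Longrightarrow> x \<in> exprs R X \<and> y \<in> exprs R X"
  by (induction rule: pres_cong.induct) (auto simp: exprs_simps)

lemma equiv_pres_cong: "equiv (exprs R X) (pres_cong R X Rel)"
  by (rule equivI)
    (auto intro!: refl_onI symI transI intro: pres_cong.refl pres_cong.sym pres_cong.trans
      dest: pres_cong_exprs)

lemma pcls_eq_iff:
  "\<lbrakk>x \<in> exprs R X; y \<in> exprs R X\<rbrakk> \<Longrightarrow> pcls x = pcls y \<longleftrightarrow> (x, y) \<in> pres_cong R X Rel"
  using equiv_pres_cong by (meson eq_equiv_class_iff)

lemma pcls_eqI: "(x, y) \<in> pres_cong R X Rel \<Longrightarrow> pcls x = pcls y"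
  using equiv_pres_cong by (rule equiv_class_eq)

lemma presented_carrier: "carrier pres_alg = pcls ` exprs R X"
  by (auto simp: presented_algebra_def quotient_def)

lemma presented_zero: "\<zero>\<^bsub>pres_alg\<^esub> = pcls Zero"
  by (simp add: presented_algebra_def)

lemma presented_add:
  assumes "x \<in> exprs R X" "y \<in> exprs R X"
  shows "pcls x \<oplus>\<^bsub>pres_alg\<^esub> pcls y = pcls (Add x y)"
proof -
  have "pcls (Add x' y') = pcls (Add x y)" if "x' \<in> pcls x" "y' \<in> pcls y" for x' y'
    using that by (intro pcls_eqI pres_cong.sym[OF pres_cong.Add]) simp_all
  then have "(\<Union>x'\<in>pcls x. \<Union>y'\<in>pcls y. pcls (Add x' y')) = (\<Union>x'\<in>pcls x. \<Union>y'\<in>pcls y. pcls (Add x y))"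
    by (intro SUP_cong HOL.refl) blast
  moreover have "pcls x \<noteq> {}" "pcls y \<noteq> {}"
    using assms pres_cong.refl by blast+
  ultimately show ?thesis
    by (simp only: presented_algebra_def ring.simps monoid.simps module.simps UN_constant if_False)
qed

lemma presented_mult:
  assumes "x \<in> exprs R X" "y \<in> exprs R X"
  shows "pcls x \<otimes>\<^bsub>pres_alg\<^esub> pcls y = pcls (Mult x y)"
proof -
  have "pcls (Mult x' y') = pcls (Mult x y)" if "x' \<in> pcls x" "y' \<in> pcls y" for x' y'
    using that by (intro pcls_eqI pres_cong.sym[OF pres_cong.Mult]) simp_all
  then have "(\<Union>x'\<in>pcls x. \<Union>y'\<in>pcls y. pcls (Mult x' y')) = (\<Union>x'\<in>pcls x. \<Union>y'\<in>pcls y. pcls (Mult x y))"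
    by (intro SUP_cong HOL.refl) blast
  moreover have "pcls x \<noteq> {}" "pcls y \<noteq> {}"
    using assms pres_cong.refl by blast+
  ultimately show ?thesis
    by (simp only: presented_algebra_def ring.simps monoid.simps module.simps UN_constant if_False)
qed

lemma presented_smult:
  assumes "a \<in> carrier R" "x \<in> exprs R X"
  shows "a \<odot>\<^bsub>pres_alg\<^esub> pcls x = pcls (Smult a x)"
proof -
  have "pcls (Smult a x') = pcls (Smult a x)" if "x' \<in> pcls x" for x'
    using that assms(1) by (intro pcls_eqI pres_cong.sym[OF pres_cong.Smult]) simp_all
  then have "(\<Union>x'\<in>pcls x. pcls (Smult a x')) = (\<Union>x'\<in>pcls x. pcls (Smult a x))"
    by (intro SUP_cong HOL.refl) blast
  moreover have "pcls x \<noteq> {}"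
    using assms(2) pres_cong.refl by blast
  ultimately show ?thesis
    by (simp only: presented_algebra_def module.simps UN_constant if_False)
qed

lemmas presented_simps =
  presented_carrier presented_zero presented_add presented_mult presented_smult exprs_simps

lemmas pres_cong_axioms =
  pres_cong.add_assoc pres_cong.add_comm pres_cong.add_zero pres_cong.add_neg pres_cong.mult_assoc
  pres_cong.distrib_left pres_cong.distrib_right pres_cong.smult_add pres_cong.add_smult
  pres_cong.smult_smult pres_cong.smult_one pres_cong.smult_mult_left pres_cong.smult_mult_right

lemma nonunital_algebra_presented: "nonunital_algebra R pres_alg"
proof -
  have ab: "abelian_group pres_alg"
  proof (rule abelian_groupI)
    fix P assume "P \<in> carrier pres_alg"
    then obtain x where x: "x \<in> exprs R X" "P = pcls x"
      by (auto simp: presented_simps)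
    then have "pcls (Neg x) \<oplus>\<^bsub>pres_alg\<^esub> P = \<zero>\<^bsub>pres_alg\<^esub>"
      by (auto simp: presented_simps intro!: pcls_eqI pres_cong_axioms del: equalityI subsetI)
    then show "\<exists>Q\<in>carrier pres_alg. Q \<oplus>\<^bsub>pres_alg\<^esub> P = \<zero>\<^bsub>pres_alg\<^esub>"
      using x by (auto simp: presented_simps)
  qed (auto simp: presented_simps intro!: pcls_eqI pres_cong_axioms del: equalityI subsetI)
  have mod: "module R pres_alg"
    by (rule moduleI[OF R ab])
      (auto simp: presented_simps intro!: pcls_eqI pres_cong_axioms del: equalityI subsetI)
  have rng: "nonunital_ring pres_alg"
    by (intro nonunital_ring.intro[OF ab] nonunital_ring_axioms.intro)
      (auto simp: presented_simps intro!: pcls_eqI pres_cong_axioms del: equalityI subsetI)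
  show ?thesis
    by (intro nonunital_algebra.intro[OF mod rng] nonunital_algebra_axioms.intro)
      (auto simp: presented_simps intro!: pcls_eqI pres_cong_axioms del: equalityI subsetI)
qed

end

primrec eval_expr :: "('r, 'a, 'm) module_scheme \<Rightarrow> ('x \<Rightarrow> 'a) \<Rightarrow> ('x, 'r) alg_expr \<Rightarrow> 'a" where
  "eval_expr A \<phi> (Gen g) = \<phi> g"
| "eval_expr A \<phi> Zero = \<zero>\<^bsub>A\<^esub>"
| "eval_expr A \<phi> (Add x y) = eval_expr A \<phi> x \<oplus>\<^bsub>A\<^esub> eval_expr A \<phi> y"
| "eval_expr A \<phi> (Neg x) = \<ominus>\<^bsub>A\<^esub> eval_expr A \<phi> x"
| "eval_expr A \<phi> (Mult x y) = eval_expr A \<phi> x \<otimes>\<^bsub>A\<^esub> eval_expr A \<phi> y"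
| "eval_expr A \<phi> (Smult a x) = a \<odot>\<^bsub>A\<^esub> eval_expr A \<phi> x"

text \<open>The universal property: a map from \<open>X\<close> to an algebra \<open>A\<close> which respects the relations
  factors through the presented algebra. (Uniqueness is clear, as every element is the class of an
  expression in the generators.)\<close>

lemma eval_expr_closed:
  assumes "nonunital_algebra R A" "\<phi> \<in> X \<rightarrow> carrier A" "x \<in> exprs R X"
  shows "eval_expr A \<phi> x \<in> carrier A"
proof -
  interpret nonunital_algebra R A by (rule assms(1))
  show ?thesis
    using assms(3) by (induction x) (use assms(2) in \<open>auto simp: exprs_simps[OF R.is_cring]\<close>)
qed

lemma presented_universal:
  assumes "nonunital_algebra R A" "\<phi> \<in> X \<rightarrow> carrier A"
    and "\<And>x y. \<lbrakk>(x, y) \<in> Rel; x \<in> exprs R X; y \<in> exprs R X\<rbrakk> \<Longrightarrow> eval_expr A \<phi> x = eval_expr A \<phi> y"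
    and "(x, y) \<in> pres_cong R X Rel"
  shows "eval_expr A \<phi> x = eval_expr A \<phi> y"
proof -
  interpret nonunital_algebra R A by (rule assms(1))
  note closed = eval_expr_closed[OF assms(1,2)]
  note ex = pres_cong_exprs[OF R.is_cring]
  show ?thesis
    using assms(4)
    by (induction rule: pres_cong.induct)
      (auto simp: assms(3) closed M.a_assoc M.a_comm M.a_lcomm M.l_neg M.r_neg mult_assoc l_distrib r_distrib
        smult_l_distr smult_r_distr smult_assoc1 smult_mult_left smult_mult_right)
qed


section \<open>Ultragraphs and their Leavitt path algebras\<close>

record ('v, 'e) ultragraph =
  verts :: "'v set"
  edges :: "'e set"
  rng :: "'e \<Rightarrow> 'v set"
  src :: "'e \<Rightarrow> 'v"

definition is_ultragraph :: "('v, 'e) ultragraph \<Rightarrow> bool" where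
  "is_ultragraph G \<longleftrightarrow>
     countable (verts G) \<and> countable (edges G) \<and>
     src G \<in> edges G \<rightarrow> verts G \<and> rng G \<in> edges G \<rightarrow> Pow (verts G) - {{}}"

text \<open>Only intersections of \<^emph>\<open>nonempty\<close> finite families are admitted, whereas the empty union
  puts \<open>{}\<close> into \<open>gen_verts G\<close>.\<close>

inductive_set gen_verts :: "('v, 'e) ultragraph \<Rightarrow> 'v set set"
  for G :: "('v, 'e) ultragraph"
where
  vertex: "v \<in> verts G \<Longrightarrow> {v} \<in> gen_verts G"
| range: "e \<in> edges G \<Longrightarrow> rng G e \<in> gen_verts G"
| Union: "\<lbrakk>finite \<A>; \<forall>A\<in>\<A>. A \<in> gen_verts G\<rbrakk> \<Longrightarrow> \<Union>\<A> \<in> gen_verts G"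
| Inter: "\<lbrakk>finite \<A>; \<A> \<noteq> {}; \<forall>A\<in>\<A>. A \<in> gen_verts G\<rbrakk> \<Longrightarrow> \<Inter>\<A> \<in> gen_verts G"

datatype ('v, 'e) lpa_gen = S_gen 'e | Sstar_gen 'e | P_gen "'v set"

definition lpa_gens :: "('v, 'e) ultragraph \<Rightarrow> ('v, 'e) lpa_gen set" where
  "lpa_gens G = S_gen ` edges G \<union> Sstar_gen ` edges G \<union> P_gen ` gen_verts G"

text \<open>A sum over a finite set is rendered as an iterated sum along an enumeration of that set;
  in the quotient all enumerations give the same element.\<close>

inductive_set lpa_rels ::
    "('v, 'e) ultragraph \<Rightarrow>
      ((('v, 'e) lpa_gen, 'r) alg_expr \<times> (('v, 'e) lpa_gen, 'r) alg_expr) set"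
  for G :: "('v, 'e) ultragraph"
where
  P_empty: "(Gen (P_gen {}), Zero) \<in> lpa_rels G"
| P_mult: "\<lbrakk>A \<in> gen_verts G; B \<in> gen_verts G\<rbrakk>
    \<Longrightarrow> (Mult (Gen (P_gen A)) (Gen (P_gen B)), Gen (P_gen (A \<inter> B))) \<in> lpa_rels G"
| P_union: "\<lbrakk>A \<in> gen_verts G; B \<in> gen_verts G\<rbrakk>
    \<Longrightarrow> (Gen (P_gen (A \<union> B)), Add (Add (Gen (P_gen A)) (Gen (P_gen B))) (Neg (Gen (P_gen (A \<inter> B)))))
          \<in> lpa_rels G"
| src_S: "e \<in> edges G \<Longrightarrow> (Mult (Gen (P_gen {src G e})) (Gen (S_gen e)), Gen (S_gen e)) \<in> lpa_rels G"
| S_rng: "e \<in> edges G \<Longrightarrow> (Mult (Gen (S_gen e)) (Gen (P_gen (rng G e))), Gen (S_gen e)) \<in> lpa_rels G"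
| rng_Sstar: "e \<in> edges G
    \<Longrightarrow> (Mult (Gen (P_gen (rng G e))) (Gen (Sstar_gen e)), Gen (Sstar_gen e)) \<in> lpa_rels G"
| Sstar_src: "e \<in> edges G
    \<Longrightarrow> (Mult (Gen (Sstar_gen e)) (Gen (P_gen {src G e})), Gen (Sstar_gen e)) \<in> lpa_rels G"
| Sstar_S: "\<lbrakk>e \<in> edges G; f \<in> edges G\<rbrakk>
    \<Longrightarrow> (Mult (Gen (Sstar_gen e)) (Gen (S_gen f)), if e = f then Gen (P_gen (rng G e)) else Zero)
          \<in> lpa_rels G"
| CK: "\<lbrakk>v \<in> verts G; es \<noteq> []; distinct es; set es = {e \<in> edges G. src G e = v}\<rbrakk>
    \<Longrightarrow> (Gen (P_gen {v}), foldr Add (map (\<lambda>e. Mult (Gen (S_gen e)) (Gen (Sstar_gen e))) es) Zero)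
          \<in> lpa_rels G"

definition leavitt ::
    "('r, 'm) ring_scheme \<Rightarrow> ('v, 'e) ultragraph
      \<Rightarrow> ('r, (('v, 'e) lpa_gen, 'r) alg_expr set) module" where
  "leavitt R G = presented_algebra R (lpa_gens G) (lpa_rels G)"

definition leavitt_gen ::
    "('r, 'm) ring_scheme \<Rightarrow> ('v, 'e) ultragraph \<Rightarrow> ('v, 'e) lpa_gen
      \<Rightarrow> (('v, 'e) lpa_gen, 'r) alg_expr set" where
  "leavitt_gen R G g = pres_cong R (lpa_gens G) (lpa_rels G) `` {Gen g}"

datatype ('v, 'e) upath = GenVert "'v set" | Edges "'e list"

definition finite_paths :: "('v, 'e) ultragraph \<Rightarrow> ('v, 'e) upath set" where
  "finite_paths G = GenVert ` gen_verts G \<union>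
     Edges ` {es. es \<noteq> [] \<and> set es \<subseteq> edges G \<and> successively (\<lambda>e f. src G f \<in> rng G e) es}"

fun path_length :: "('v, 'e) upath \<Rightarrow> nat" where
  "path_length (GenVert A) = 0"
| "path_length (Edges es) = length es"

fun list_product :: "('a, 'm) monoid_scheme \<Rightarrow> 'a list \<Rightarrow> 'a" where
  "list_product M [x] = x"
| "list_product M (x # y # zs) = x \<otimes>\<^bsub>M\<^esub> list_product M (y # zs)"

fun s_path :: "('r, 'm) ring_scheme \<Rightarrow> ('v, 'e) ultragraph \<Rightarrow> ('v, 'e) upath
    \<Rightarrow> (('v, 'e) lpa_gen, 'r) alg_expr set" where
  "s_path R G (GenVert A) = leavitt_gen R G (P_gen A)"
| "s_path R G (Edges es) = list_product (leavitt R G) (map (\<lambda>e. leavitt_gen R G (S_gen e)) es)"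

fun s_path_star :: "('r, 'm) ring_scheme \<Rightarrow> ('v, 'e) ultragraph \<Rightarrow> ('v, 'e) upath
    \<Rightarrow> (('v, 'e) lpa_gen, 'r) alg_expr set" where
  "s_path_star R G (GenVert A) = leavitt_gen R G (P_gen A)"
| "s_path_star R G (Edges es) = list_product (leavitt R G) (map (\<lambda>e. leavitt_gen R G (Sstar_gen e)) (rev es))"

definition leavitt_component ::
    "('r, 'm) ring_scheme \<Rightarrow> ('v, 'e) ultragraph \<Rightarrow> int
      \<Rightarrow> (('v, 'e) lpa_gen, 'r) alg_expr set set" where
  "leavitt_component R G m =
     {(\<Oplus>\<^bsub>leavitt R G\<^esub>i\<in>{..<n}. c i \<odot>\<^bsub>leavitt R G\<^esub>
         (s_path R G (\<alpha> i) \<otimes>\<^bsub>leavitt R G\<^esub> leavitt_gen R G (P_gen (A i)) \<otimes>\<^bsub>leavitt R G\<^esub> s_path_star R G (\<beta> i)))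
      | (n :: nat) c \<alpha> A \<beta>. \<forall>i<n.
          c i \<in> carrier R \<and> \<alpha> i \<in> finite_paths G \<and> A i \<in> gen_verts G \<and> \<beta> i \<in> finite_paths G \<and>
          int (path_length (\<alpha> i)) - int (path_length (\<beta> i)) = m}"

end

theory Submission
  imports Defs
begin

text \<open>
  Each homogeneous component is spanned by products \<open>u v\<close>, where \<open>u\<close> is a product of edges followed by
  some \<open>p\<^sub>A\<close>, and \<open>v\<close> is some \<open>p\<^sub>A\<close> followed by a product of ghost edges. If \<open>L\<close> is epsilon-strongly
  graded, then the identity \<open>\<epsilon>\<^sub>0\<close> is absorbed by a single \<open>p\<^sub>A\<close>, so that \<open>A\<close> contains every vertex; and
  \<open>\<epsilon>\<^sub>1\<close> involves only finitely many initial edges, so that \<open>s\<^sub>e\<^sup>* s\<^sub>e = s\<^sub>e\<^sup>* \<epsilon>\<^sub>1 s\<^sub>e = 0\<close> for all other edges \<open>e\<close>.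
  Both arguments rest on \<open>p\<^sub>v \<noteq> 0\<close>, which a branching system provides. Conversely, \<open>\<epsilon>\<^sub>n\<close> is the sum of
  \<open>s\<^sub>\<alpha> s\<^sub>\<alpha>\<^sup>*\<close> over the paths of length \<open>n\<close> for \<open>n > 0\<close>, the projection of the set of all vertices for
  \<open>n = 0\<close>, and the projection of the union of all ranges for \<open>n < 0\<close>.
\<close>

section \<open>Modules and algebras\<close>

text \<open>The components are defined through composable paths, but composability is awkward to
  preserve under multiplication.

  That the components are independent cannot be read off from a quotient of terms; it takes a map
  out of the algebra that sees degrees, here an action of \<open>L\<close> on
  \<open>L\<close>-valued functions. As \<open>L\<close> may lack an identity, this action returns a
  homogeneous part only after right multiplication by some \<open>y\<close>. The converse direction
  can take \<open>y = p (verts G)\<close>; in the forward direction the grading is part of the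
  hypothesis.

  For \<open>n < 0\<close> the unit must be a combination of products of a factor of degree
  \<open>n\<close> and one of degree \<open>-n\<close>. If a path ends with \<open>e\<close>, its
  ghost times the path is \<open>p (rng G e)\<close>. The condition on sources makes every edge the
  last edge of a path of length \<open>-n\<close>, so all range projections are available, and
  inclusion-exclusion yields that of their union.\<close>

definition lin_span :: "('r, 'm) ring_scheme \<Rightarrow> ('r, 'a, 'n) module_scheme \<Rightarrow> 'a set \<Rightarrow> 'a set" where
  "lin_span R M X =
     {(\<Oplus>\<^bsub>M\<^esub>i\<in>{..<n}. c i \<odot>\<^bsub>M\<^esub> x i) | (n :: nat) c x. \<forall>i<n. c i \<in> carrier R \<and> x i \<in> X}"

context module
begin

lemma lin_span_induct [consumes 2, case_names zero step]:
  assumes "x \<in> lin_span R M X" and X: "X \<subseteq> carrier M"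
    and zero: "P \<zero>\<^bsub>M\<^esub>"
    and step: "\<And>c x y. \<lbrakk>c \<in> carrier R; x \<in> X; y \<in> carrier M; P y\<rbrakk> \<Longrightarrow> P (c \<odot>\<^bsub>M\<^esub> x \<oplus>\<^bsub>M\<^esub> y)"
  shows "P x"
proof -
  obtain n :: nat and c y where x: "x = (\<Oplus>\<^bsub>M\<^esub>i\<in>{..<n}. c i \<odot>\<^bsub>M\<^esub> y i)"
    and cy: "\<And>i. i < n \<Longrightarrow> c i \<in> carrier R \<and> y i \<in> X"
    using assms(1) by (auto simp: lin_span_def)
  have "(\<Oplus>\<^bsub>M\<^esub>i\<in>{..<k}. c i \<odot>\<^bsub>M\<^esub> y i) \<in> carrier M \<and> P (\<Oplus>\<^bsub>M\<^esub>i\<in>{..<k}. c i \<odot>\<^bsub>M\<^esub> y i)" if "k \<le> n" for k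
    using that
  proof (induction k)
    case 0
    then show ?case by (simp add: zero)
  next
    case (Suc k)
    have "c i \<odot>\<^bsub>M\<^esub> y i \<in> carrier M" if "i \<le> k" for i
      using cy[of i] X that Suc.prems by (auto intro: smult_closed)
    then have "(\<Oplus>\<^bsub>M\<^esub>i\<in>{..<Suc k}. c i \<odot>\<^bsub>M\<^esub> y i)
        = c k \<odot>\<^bsub>M\<^esub> y k \<oplus>\<^bsub>M\<^esub> (\<Oplus>\<^bsub>M\<^esub>i\<in>{..<k}. c i \<odot>\<^bsub>M\<^esub> y i)" "c k \<odot>\<^bsub>M\<^esub> y k \<in> carrier M"
      by (simp_all add: lessThan_Suc Pi_def)
    then show ?case
      using Suc cy[of k] step by auto
  qed
  then show ?thesis
    using x by blast
qed

lemma lin_span_closed: "X \<subseteq> carrier M \<Longrightarrow> lin_span R M X \<subseteq> carrier M"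
  by (auto simp: lin_span_def subset_iff intro!: M.finsum_closed smult_closed)

lemma lin_span_zero: "\<zero>\<^bsub>M\<^esub> \<in> lin_span R M X"
  unfolding lin_span_def by (intro CollectI exI[of _ 0]) simp

lemma lin_span_step:
  assumes "c \<in> carrier R" "x \<in> X" "y \<in> lin_span R M X" "X \<subseteq> carrier M"
  shows "c \<odot>\<^bsub>M\<^esub> x \<oplus>\<^bsub>M\<^esub> y \<in> lin_span R M X"
proof -
  obtain n :: nat and d z where y: "y = (\<Oplus>\<^bsub>M\<^esub>i\<in>{..<n}. d i \<odot>\<^bsub>M\<^esub> z i)"
    and dz: "\<And>i. i < n \<Longrightarrow> d i \<in> carrier R \<and> z i \<in> X"
    using assms(3) by (auto simp: lin_span_def)
  have "(\<Oplus>\<^bsub>M\<^esub>i\<in>{..<Suc n}. (d(n := c)) i \<odot>\<^bsub>M\<^esub> (z(n := x)) i)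
      = c \<odot>\<^bsub>M\<^esub> x \<oplus>\<^bsub>M\<^esub> (\<Oplus>\<^bsub>M\<^esub>i\<in>{..<n}. (d(n := c)) i \<odot>\<^bsub>M\<^esub> (z(n := x)) i)"
    using dz assms by (simp add: lessThan_Suc Pi_def subset_iff)
  also have "(\<Oplus>\<^bsub>M\<^esub>i\<in>{..<n}. (d(n := c)) i \<odot>\<^bsub>M\<^esub> (z(n := x)) i) = y"
    unfolding y by (rule M.finsum_cong') (use dz assms(4) in auto)
  finally show ?thesis
    unfolding lin_span_def using dz assms(1,2)
    by (intro CollectI exI[of _ "Suc n"] exI[of _ "d(n := c)"] exI[of _ "z(n := x)"])
      (auto simp: less_Suc_eq)
qed

lemma lin_span_add:
  assumes "x \<in> lin_span R M X" "y \<in> lin_span R M X" "X \<subseteq> carrier M"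
  shows "x \<oplus>\<^bsub>M\<^esub> y \<in> lin_span R M X"
  using assms(1,3)
proof (induction rule: lin_span_induct)
  case zero
  then show ?case using assms(2) lin_span_closed[OF assms(3)] by auto
next
  case (step c x z)
  moreover have "x \<in> carrier M" "y \<in> carrier M"
    using step assms lin_span_closed by blast+
  ultimately have "c \<odot>\<^bsub>M\<^esub> x \<oplus>\<^bsub>M\<^esub> z \<oplus>\<^bsub>M\<^esub> y = c \<odot>\<^bsub>M\<^esub> x \<oplus>\<^bsub>M\<^esub> (z \<oplus>\<^bsub>M\<^esub> y)"
    by (simp add: M.a_assoc)
  then show ?case
    using step assms by (simp add: lin_span_step)
qed

lemma lin_span_smult:
  assumes "a \<in> carrier R" "x \<in> lin_span R M X" "X \<subseteq> carrier M"
  shows "a \<odot>\<^bsub>M\<^esub> x \<in> lin_span R M X"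
  using assms(2,3)
proof (induction rule: lin_span_induct)
  case zero
  then show ?case using assms by (simp add: lin_span_zero smult_r_null)
next
  case (step c x y)
  have "a \<odot>\<^bsub>M\<^esub> (c \<odot>\<^bsub>M\<^esub> x \<oplus>\<^bsub>M\<^esub> y) = (a \<otimes> c) \<odot>\<^bsub>M\<^esub> x \<oplus>\<^bsub>M\<^esub> a \<odot>\<^bsub>M\<^esub> y"
    using step assms by (auto simp: smult_r_distr smult_assoc1 subset_iff)
  then show ?case
    using step assms by (auto intro: lin_span_step)
qed

lemma lin_span_base:
  assumes "x \<in> X" "X \<subseteq> carrier M"
  shows "x \<in> lin_span R M X"
  using lin_span_step[of \<one> x X "\<zero>\<^bsub>M\<^esub>"] assms by (auto simp: lin_span_zero subset_iff)

lemma lin_span_uminus: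
  assumes "x \<in> lin_span R M X" "X \<subseteq> carrier M"
  shows "\<ominus>\<^bsub>M\<^esub> x \<in> lin_span R M X"
  using lin_span_smult[of "\<ominus> \<one>" x X] assms lin_span_closed[OF assms(2)] smult_l_minus[of \<one> x]
  by auto

lemma lin_span_subsetI:
  assumes "X \<subseteq> lin_span R M Y" "Y \<subseteq> carrier M"
  shows "lin_span R M X \<subseteq> lin_span R M Y"
proof
  fix x
  assume "x \<in> lin_span R M X"
  moreover have "X \<subseteq> carrier M"
    using assms lin_span_closed by blast
  ultimately show "x \<in> lin_span R M Y"
    by (induction rule: lin_span_induct)
      (use assms in \<open>auto intro!: lin_span_zero lin_span_add lin_span_smult\<close>)
qed

lemma additive_subgroup_lin_span:
  assumes "X \<subseteq> carrier M"
  shows "additive_subgroup (lin_span R M X) M"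
proof -
  have "subgroup (lin_span R M X) (add_monoid M)"
    using assms lin_span_closed[OF assms] lin_span_zero[of X]
    by (intro group.subgroupI[OF M.a_group])
      (auto simp: lin_span_add lin_span_uminus simp flip: a_inv_def)
  then show ?thesis
    by (rule additive_subgroup.intro)
qed

end

lemma (in module) lin_span_finsum:
  assumes "finite I" "\<And>i. i \<in> I \<Longrightarrow> f i \<in> lin_span R M X" "X \<subseteq> carrier M"
  shows "(\<Oplus>\<^bsub>M\<^esub>i\<in>I. f i) \<in> lin_span R M X"
  using assms(1,2)
proof (induction I rule: finite_induct)
  case (insert i I)
  moreover have "f j \<in> carrier M" if "j \<in> insert i I" for j
    using insert.prems[OF that] lin_span_closed[OF assms(3)] by blast
  ultimately show ?case
    using assms(3) by (simp add: Pi_def lin_span_add)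
qed (simp add: lin_span_zero)

text \<open>Since \<open>X\<close> is closed under scalars, a coefficient can be absorbed into the
  left factor. The point is to make \<open>lin_span_induct\<close> and the closure rules for spans
  available for sums of products.\<close>

lemma (in nonunital_algebra) sums_of_products_eq_lin_span:
  assumes "X \<subseteq> carrier A" "Y \<subseteq> carrier A"
    and smult: "\<And>c x. \<lbrakk>c \<in> carrier R; x \<in> X\<rbrakk> \<Longrightarrow> c \<odot>\<^bsub>A\<^esub> x \<in> X"
  shows "sums_of_products A X Y = lin_span R A {x \<otimes>\<^bsub>A\<^esub> y | x y. x \<in> X \<and> y \<in> Y}"
proof (intro equalityI subsetI)
  fix z assume "z \<in> sums_of_products A X Y"
  then obtain n :: nat and a b where z: "z = (\<Oplus>\<^bsub>A\<^esub>i\<in>{..<n}. a i \<otimes>\<^bsub>A\<^esub> b i)"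
    and ab: "a \<in> {..<n} \<rightarrow> X" "b \<in> {..<n} \<rightarrow> Y"
    by (auto simp: sums_of_products_def)
  have "a i \<in> carrier A" "b i \<in> carrier A" "a i \<in> X" "b i \<in> Y" if "i < n" for i
    using ab assms that by auto
  then show "z \<in> lin_span R A {x \<otimes>\<^bsub>A\<^esub> y | x y. x \<in> X \<and> y \<in> Y}"
    unfolding z using assms(1,2) by (intro lin_span_finsum lin_span_base) blast+
next
  fix z assume "z \<in> lin_span R A {x \<otimes>\<^bsub>A\<^esub> y | x y. x \<in> X \<and> y \<in> Y}"
  then obtain n :: nat and c w where z: "z = (\<Oplus>\<^bsub>A\<^esub>i\<in>{..<n}. c i \<odot>\<^bsub>A\<^esub> w i)"
    and cw: "\<forall>i<n. c i \<in> carrier R \<and> (\<exists>x y. w i = x \<otimes>\<^bsub>A\<^esub> y \<and> x \<in> X \<and> y \<in> Y)"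
    by (auto simp: lin_span_def)
  then obtain a b where ab: "\<forall>i<n. w i = a i \<otimes>\<^bsub>A\<^esub> b i \<and> a i \<in> X \<and> b i \<in> Y"
    by metis
  have closed: "a i \<in> carrier A" "b i \<in> carrier A" "c i \<in> carrier R" "a i \<in> X" "b i \<in> Y" if "i < n" for i
    using ab cw assms(1,2) that by auto
  have "z = (\<Oplus>\<^bsub>A\<^esub>i\<in>{..<n}. (c i \<odot>\<^bsub>A\<^esub> a i) \<otimes>\<^bsub>A\<^esub> b i)"
    unfolding z by (rule M.finsum_cong') (use ab closed in \<open>auto simp: smult_mult_left\<close>)
  then show "z \<in> sums_of_products A X Y"
    unfolding sums_of_products_def using closed smult
    by (intro CollectI exI[of _ n] exI[of _ "\<lambda>i. c i \<odot>\<^bsub>A\<^esub> a i"] exI[of _ b]) auto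
qed

section \<open>Function modules and linear endomorphisms, as targets of representations\<close>

definition self_module :: "('r, 'm) ring_scheme \<Rightarrow> ('r, 'r) module" where
  "self_module R = \<lparr>carrier = carrier R, mult = (\<otimes>\<^bsub>R\<^esub>), one = \<one>\<^bsub>R\<^esub>, zero = \<zero>\<^bsub>R\<^esub>, add = (\<oplus>\<^bsub>R\<^esub>),
     smult = (\<otimes>\<^bsub>R\<^esub>)\<rparr>"

lemma self_module_simps [simp]:
  "carrier (self_module R) = carrier R" "\<zero>\<^bsub>self_module R\<^esub> = \<zero>\<^bsub>R\<^esub>"
  "x \<oplus>\<^bsub>self_module R\<^esub> y = x \<oplus>\<^bsub>R\<^esub> y" "a \<odot>\<^bsub>self_module R\<^esub> x = a \<otimes>\<^bsub>R\<^esub> x"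
  by (simp_all add: self_module_def)

lemma (in cring) module_self: "module R (self_module R)"
proof (rule moduleI)
  show "abelian_group (self_module R)"
    by (rule abelian_groupI)
      (auto simp: a_ac intro: l_neg bexI[of _ "\<ominus> _"])
qed (auto simp: l_distr r_distr m_assoc is_cring)

lemma (in cring) self_module_uminus: "x \<in> carrier R \<Longrightarrow> \<ominus>\<^bsub>self_module R\<^esub> x = \<ominus> x"
proof -
  interpret S: module R "self_module R" by (rule module_self)
  show "x \<in> carrier R \<Longrightarrow> \<ominus>\<^bsub>self_module R\<^esub> x = \<ominus> x"
    by (intro S.M.minus_equality) (auto simp: l_neg)
qed

text \<open>The field \<open>mult\<close> is irrelevant for a module.\<close>

definition fun_module :: "('r, 'a, 'n) module_scheme \<Rightarrow> ('r, 'i \<Rightarrow> 'a) module" where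
  "fun_module M = \<lparr>carrier = UNIV \<rightarrow> carrier M, mult = undefined, one = undefined,
     zero = (\<lambda>_. \<zero>\<^bsub>M\<^esub>), add = (\<lambda>f g i. f i \<oplus>\<^bsub>M\<^esub> g i), smult = (\<lambda>a f i. a \<odot>\<^bsub>M\<^esub> f i)\<rparr>"

lemma fun_module_simps:
  "f \<in> carrier (fun_module M) \<longleftrightarrow> (\<forall>i. f i \<in> carrier M)" "\<zero>\<^bsub>fun_module M\<^esub> = (\<lambda>_. \<zero>\<^bsub>M\<^esub>)"
  "f \<oplus>\<^bsub>fun_module M\<^esub> g = (\<lambda>i. f i \<oplus>\<^bsub>M\<^esub> g i)" "a \<odot>\<^bsub>fun_module M\<^esub> f = (\<lambda>i. a \<odot>\<^bsub>M\<^esub> f i)"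
  by (auto simp: fun_module_def)

lemma (in module) module_fun: "module R (fun_module M :: ('a, 'i \<Rightarrow> 'c) module)"
proof (rule moduleI)
  show "abelian_group (fun_module M :: ('a, 'i \<Rightarrow> 'c) module)"
  proof (rule abelian_groupI)
    fix f :: "'i \<Rightarrow> 'c" assume "f \<in> carrier (fun_module M)"
    then show "\<exists>g\<in>carrier (fun_module M). g \<oplus>\<^bsub>fun_module M\<^esub> f = \<zero>\<^bsub>fun_module M\<^esub>"
      by (intro bexI[of _ "\<lambda>i. \<ominus>\<^bsub>M\<^esub> f i"]) (auto simp: fun_module_simps M.l_neg)
  qed (auto simp: fun_module_simps M.a_ac)
qed (auto simp: fun_module_simps smult_l_distr smult_r_distr smult_assoc1 is_cring)

text \<open>Negation in a record is a description based on its additive monoid, so the pointwise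
  formula comes from the uniqueness of additive inverses. It is needed to evaluate terms
  \<open>Neg x\<close>, which occur in the relation for \<open>p (A \<union> B)\<close>.\<close>

lemma (in module) fun_module_uminus:
  assumes "f \<in> carrier (fun_module M)"
  shows "\<ominus>\<^bsub>fun_module M\<^esub> f = (\<lambda>i. \<ominus>\<^bsub>M\<^esub> f i)"
proof -
  interpret F: module R "fun_module M" by (rule module_fun)
  show ?thesis
    using assms by (intro F.M.minus_equality) (auto simp: fun_module_simps M.l_neg)
qed

text \<open>Endomorphisms are extensional, so that agreement on \<open>carrier M\<close> is
  equality; this is why all operations are restricted to \<open>carrier M\<close>.\<close>

definition lin_end ::
    "('r, 'm) ring_scheme \<Rightarrow> ('r, 'a, 'n) module_scheme \<Rightarrow> ('r, 'a \<Rightarrow> 'a) module" where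
  "lin_end R M =
     \<lparr>carrier = {f \<in> carrier M \<rightarrow>\<^sub>E carrier M.
        (\<forall>x\<in>carrier M. \<forall>y\<in>carrier M. f (x \<oplus>\<^bsub>M\<^esub> y) = f x \<oplus>\<^bsub>M\<^esub> f y) \<and>
        (\<forall>a\<in>carrier R. \<forall>x\<in>carrier M. f (a \<odot>\<^bsub>M\<^esub> x) = a \<odot>\<^bsub>M\<^esub> f x)},
      mult = (\<lambda>f g. \<lambda>x\<in>carrier M. f (g x)), one = (\<lambda>x\<in>carrier M. x), zero = (\<lambda>x\<in>carrier M. \<zero>\<^bsub>M\<^esub>),
      add = (\<lambda>f g. \<lambda>x\<in>carrier M. f x \<oplus>\<^bsub>M\<^esub> g x), smult = (\<lambda>a f. \<lambda>x\<in>carrier M. a \<odot>\<^bsub>M\<^esub> f x)\<rparr>"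

lemma lin_end_carrier:
  "f \<in> carrier (lin_end R M) \<longleftrightarrow> f \<in> carrier M \<rightarrow>\<^sub>E carrier M \<and>
     (\<forall>x\<in>carrier M. \<forall>y\<in>carrier M. f (x \<oplus>\<^bsub>M\<^esub> y) = f x \<oplus>\<^bsub>M\<^esub> f y) \<and>
     (\<forall>a\<in>carrier R. \<forall>x\<in>carrier M. f (a \<odot>\<^bsub>M\<^esub> x) = a \<odot>\<^bsub>M\<^esub> f x)"
  by (simp add: lin_end_def)

lemma lin_end_simps:
  "f \<otimes>\<^bsub>lin_end R M\<^esub> g = (\<lambda>x\<in>carrier M. f (g x))" "\<zero>\<^bsub>lin_end R M\<^esub> = (\<lambda>x\<in>carrier M. \<zero>\<^bsub>M\<^esub>)"
  "f \<oplus>\<^bsub>lin_end R M\<^esub> g = (\<lambda>x\<in>carrier M. f x \<oplus>\<^bsub>M\<^esub> g x)" "a \<odot>\<^bsub>lin_end R M\<^esub> f = (\<lambda>x\<in>carrier M. a \<odot>\<^bsub>M\<^esub> f x)"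
  by (auto simp: lin_end_def)

lemma lin_end_apply:
  assumes "x \<in> carrier M"
  shows "(f \<otimes>\<^bsub>lin_end R M\<^esub> g) x = f (g x)" "\<zero>\<^bsub>lin_end R M\<^esub> x = \<zero>\<^bsub>M\<^esub>"
    "(f \<oplus>\<^bsub>lin_end R M\<^esub> g) x = f x \<oplus>\<^bsub>M\<^esub> g x" "(a \<odot>\<^bsub>lin_end R M\<^esub> f) x = a \<odot>\<^bsub>M\<^esub> f x"
  using assms by (simp_all add: lin_end_simps)

lemma lin_end_apply_closed:
  "\<lbrakk>f \<in> carrier (lin_end R M); x \<in> carrier M\<rbrakk> \<Longrightarrow> f x \<in> carrier M"
  by (auto simp: lin_end_carrier)

lemma lin_end_eqI:
  assumes "f \<in> carrier (lin_end R M)" "g \<in> carrier (lin_end R M)"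
    and "\<And>x. x \<in> carrier M \<Longrightarrow> f x = g x"
  shows "f = g"
  using assms by (auto simp: lin_end_carrier intro: PiE_ext)

context module
begin

lemma lin_end_closed:
  shows "\<zero>\<^bsub>lin_end R M\<^esub> \<in> carrier (lin_end R M)"
    and "\<lbrakk>f \<in> carrier (lin_end R M); g \<in> carrier (lin_end R M)\<rbrakk>
      \<Longrightarrow> f \<oplus>\<^bsub>lin_end R M\<^esub> g \<in> carrier (lin_end R M)"
    and "\<lbrakk>f \<in> carrier (lin_end R M); g \<in> carrier (lin_end R M)\<rbrakk>
      \<Longrightarrow> f \<otimes>\<^bsub>lin_end R M\<^esub> g \<in> carrier (lin_end R M)"
    and "\<lbrakk>a \<in> carrier R; f \<in> carrier (lin_end R M)\<rbrakk>
      \<Longrightarrow> a \<odot>\<^bsub>lin_end R M\<^esub> f \<in> carrier (lin_end R M)"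
proof -
  show "\<zero>\<^bsub>lin_end R M\<^esub> \<in> carrier (lin_end R M)"
    by (auto simp: lin_end_carrier lin_end_simps smult_r_null)
  show "f \<oplus>\<^bsub>lin_end R M\<^esub> g \<in> carrier (lin_end R M)"
    if fg: "f \<in> carrier (lin_end R M)" "g \<in> carrier (lin_end R M)" for f g
  proof -
    have c: "f x \<in> carrier M" "g x \<in> carrier M" if "x \<in> carrier M" for x
      using fg that by (blast intro: lin_end_apply_closed)+
    have l: "f (x \<oplus>\<^bsub>M\<^esub> y) = f x \<oplus>\<^bsub>M\<^esub> f y" "g (x \<oplus>\<^bsub>M\<^esub> y) = g x \<oplus>\<^bsub>M\<^esub> g y"
      if "x \<in> carrier M" "y \<in> carrier M" for x y
      using fg that by (auto simp: lin_end_carrier)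
    have m: "f (a \<odot>\<^bsub>M\<^esub> x) = a \<odot>\<^bsub>M\<^esub> f x" "g (a \<odot>\<^bsub>M\<^esub> x) = a \<odot>\<^bsub>M\<^esub> g x"
      if "a \<in> carrier R" "x \<in> carrier M" for a x
      using fg that by (auto simp: lin_end_carrier)
    show ?thesis
      unfolding lin_end_carrier lin_end_simps
      by (auto simp: l m c smult_r_distr M.a_ac)
  qed
  show "f \<otimes>\<^bsub>lin_end R M\<^esub> g \<in> carrier (lin_end R M)"
    if "f \<in> carrier (lin_end R M)" "g \<in> carrier (lin_end R M)" for f g
    using that lin_end_apply_closed[of f R M] lin_end_apply_closed[of g R M]
    by (auto simp: lin_end_carrier lin_end_simps)
  show "a \<odot>\<^bsub>lin_end R M\<^esub> f \<in> carrier (lin_end R M)"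
    if "a \<in> carrier R" "f \<in> carrier (lin_end R M)" for a f
  proof -
    have "f x \<in> carrier M" if "x \<in> carrier M" for x
      using \<open>f \<in> _\<close> that by (rule lin_end_apply_closed)
    \<comment> \<open>Commutativity of \<open>R\<close> enters here: a scalar multiple of a linear
      map is again linear because the two scalars can be exchanged.\<close>
    moreover have "a \<odot>\<^bsub>M\<^esub> (b \<odot>\<^bsub>M\<^esub> f x) = b \<odot>\<^bsub>M\<^esub> (a \<odot>\<^bsub>M\<^esub> f x)"
      if "b \<in> carrier R" "x \<in> carrier M" for b x
      using that \<open>a \<in> _\<close> smult_assoc1[of a b "f x"] smult_assoc1[of b a "f x"] calculation
      by (simp add: R.m_comm)
    ultimately show ?thesis
      using that by (auto simp: lin_end_carrier lin_end_simps smult_r_distr)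
  qed
qed

lemma nonunital_algebra_lin_end: "nonunital_algebra R (lin_end R M)"
proof -
  let ?E = "lin_end R M"
  note eq = lin_end_eqI[of _ R M]
  have app: "f x \<in> carrier M" if "f \<in> carrier ?E" "x \<in> carrier M" for f x
    using that by (rule lin_end_apply_closed)
  have lin: "f (x \<oplus>\<^bsub>M\<^esub> y) = f x \<oplus>\<^bsub>M\<^esub> f y" "a \<in> carrier R \<Longrightarrow> f (a \<odot>\<^bsub>M\<^esub> x) = a \<odot>\<^bsub>M\<^esub> f x"
    if "f \<in> carrier ?E" "x \<in> carrier M" "y \<in> carrier M" for f x y a
    using that by (auto simp: lin_end_carrier)
  have ab: "abelian_group ?E"
  proof (rule abelian_groupI)
    fix f assume f: "f \<in> carrier ?E"
    show "\<exists>g\<in>carrier ?E. g \<oplus>\<^bsub>?E\<^esub> f = \<zero>\<^bsub>?E\<^esub>"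
    proof (intro bexI[of _ "\<ominus> \<one> \<odot>\<^bsub>?E\<^esub> f"] eq lin_end_closed)
      fix x assume "x \<in> carrier M"
      then show "((\<ominus> \<one> \<odot>\<^bsub>?E\<^esub> f) \<oplus>\<^bsub>?E\<^esub> f) x = \<zero>\<^bsub>?E\<^esub> x"
        using f by (simp add: lin_end_apply app smult_l_minus M.l_neg)
    qed (use f in auto)
  qed (auto intro!: lin_end_closed eq simp: lin_end_apply app M.a_ac)
  have mod: "module R ?E"
    by (rule moduleI[OF is_cring ab])
      (auto intro!: lin_end_closed eq simp: lin_end_apply app smult_l_distr smult_r_distr smult_assoc1)
  have "nonunital_ring ?E"
    by (intro nonunital_ring.intro[OF ab] nonunital_ring_axioms.intro)
      (auto intro!: lin_end_closed eq simp: lin_end_apply app lin)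
  then show ?thesis
    by (intro nonunital_algebra.intro[OF mod] nonunital_algebra_axioms.intro)
      (auto intro!: lin_end_closed eq simp: lin_end_apply app lin)
qed

lemma lin_end_uminus_apply:
  assumes "f \<in> carrier (lin_end R M)" "x \<in> carrier M"
  shows "(\<ominus>\<^bsub>lin_end R M\<^esub> f) x = \<ominus>\<^bsub>M\<^esub> f x"
proof -
  interpret E: nonunital_algebra R "lin_end R M" by (rule nonunital_algebra_lin_end)
  have "(\<ominus>\<^bsub>lin_end R M\<^esub> f) \<oplus>\<^bsub>lin_end R M\<^esub> f = \<zero>\<^bsub>lin_end R M\<^esub>"
    using assms by (simp add: E.M.l_neg)
  from fun_cong[OF this, of x] have "(\<ominus>\<^bsub>lin_end R M\<^esub> f) x \<oplus>\<^bsub>M\<^esub> f x = \<zero>\<^bsub>M\<^esub>"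
    using assms by (simp add: lin_end_simps)
  then show ?thesis
    using assms by (metis E.M.a_inv_closed M.minus_equality lin_end_apply_closed)
qed

end

lemma (in nonunital_ring) l_minus:
  assumes "x \<in> carrier T" "y \<in> carrier T"
  shows "(\<ominus> x) \<otimes> y = \<ominus> (x \<otimes> y)"
proof -
  have "(\<ominus> x) \<otimes> y \<oplus> x \<otimes> y = \<zero>"
    using assms by (simp add: l_neg flip: l_distrib)
  then show ?thesis
    using assms by (simp add: minus_equality)
qed

lemma (in nonunital_ring) list_product_closed:
  "\<lbrakk>xs \<noteq> []; set xs \<subseteq> carrier T\<rbrakk> \<Longrightarrow> list_product T xs \<in> carrier T"
proof (induction xs rule: list_nonempty_induct)
  case (cons x xs)
  then show ?case by (cases xs) auto
qed simp

lemma (in nonunital_ring) list_product_Cons: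
  "xs \<noteq> [] \<Longrightarrow> list_product T (x # xs) = x \<otimes> list_product T xs"
  by (cases xs) auto

lemma (in nonunital_ring) list_product_snoc:
  "\<lbrakk>xs \<noteq> []; set xs \<subseteq> carrier T; x \<in> carrier T\<rbrakk>
    \<Longrightarrow> list_product T (xs @ [x]) = list_product T xs \<otimes> x"
proof (induction xs rule: list_nonempty_induct)
  case (cons y ys)
  then show ?case
    using list_product_closed[of ys] by (auto simp: list_product_Cons mult_assoc)
qed auto

text \<open>The map evaluates a chosen representative of the class;
  \<open>presented_universal\<close> makes the result independent of the choice. Compatibility with
  the operations is not stated separately, as it follows from the recursion for
  \<open>eval_expr\<close>.\<close>

lemma presented_lift:
  assumes R: "cring R" and A: "nonunital_algebra R A" and \<phi>: "\<phi> \<in> X \<rightarrow> carrier A"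
    and rel: "\<And>x y. \<lbrakk>(x, y) \<in> Rel; x \<in> exprs R X; y \<in> exprs R X\<rbrakk>
      \<Longrightarrow> eval_expr A \<phi> x = eval_expr A \<phi> y"
  obtains \<Phi> where "\<And>x. x \<in> exprs R X \<Longrightarrow> \<Phi> (pres_cong R X Rel `` {x}) = eval_expr A \<phi> x"
proof
  fix x assume x: "x \<in> exprs R X"
  then have "x \<in> pres_cong R X Rel `` {x}"
    by (simp add: pres_cong.refl)
  then have "(x, SOME y. y \<in> pres_cong R X Rel `` {x}) \<in> pres_cong R X Rel"
    by (rule someI2) simp
  then show "eval_expr A \<phi> (SOME y. y \<in> pres_cong R X Rel `` {x}) = eval_expr A \<phi> x"
    using presented_universal[OF A \<phi> rel] by simp
qed

lemma presented_uminus: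
  assumes R: "cring R" and x: "x \<in> exprs R X"
  shows "\<ominus>\<^bsub>presented_algebra R X Rel\<^esub> (pres_cong R X Rel `` {x}) = pres_cong R X Rel `` {Neg x}"
proof -
  interpret nonunital_algebra R "presented_algebra R X Rel"
    by (rule nonunital_algebra_presented[OF R])
  note simps = presented_simps[OF R]
  have "pres_cong R X Rel `` {Neg x} \<oplus>\<^bsub>presented_algebra R X Rel\<^esub> pres_cong R X Rel `` {x}
      = \<zero>\<^bsub>presented_algebra R X Rel\<^esub>"
    using x by (simp add: simps pcls_eqI[OF R] pres_cong.add_neg)
  then show ?thesis
    using x by (intro M.minus_equality) (auto simp: simps)
qed

section \<open>The Leavitt path algebra and its components\<close>

lemma gen_verts_empty: "{} \<in> gen_verts G"
  using gen_verts.Union[of "{}" G] by simp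

lemma gen_verts_Un: "\<lbrakk>A \<in> gen_verts G; B \<in> gen_verts G\<rbrakk> \<Longrightarrow> A \<union> B \<in> gen_verts G"
  using gen_verts.Union[of "{A, B}" G] by simp

lemma gen_verts_Int: "\<lbrakk>A \<in> gen_verts G; B \<in> gen_verts G\<rbrakk> \<Longrightarrow> A \<inter> B \<in> gen_verts G"
  using gen_verts.Inter[of "{A, B}" G] by simp

lemma gen_verts_subset: "\<lbrakk>is_ultragraph G; A \<in> gen_verts G\<rbrakk> \<Longrightarrow> A \<subseteq> verts G"
  by (rotate_tac, induction rule: gen_verts.induct) (auto simp: is_ultragraph_def Pi_def)

locale leavitt_algebra =
  fixes R :: "('r, 'm) ring_scheme" and G :: "('v, 'e) ultragraph"
  assumes cring: "cring R" and ultragraph: "is_ultragraph G"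
begin

abbreviation L where "L \<equiv> leavitt R G"
abbreviation mul (infixl "\<cdot>" 70) where "x \<cdot> y \<equiv> x \<otimes>\<^bsub>leavitt R G\<^esub> y"
abbreviation p where "p A \<equiv> leavitt_gen R G (P_gen A)"
abbreviation s where "s e \<equiv> leavitt_gen R G (S_gen e)"
abbreviation t where "t e \<equiv> leavitt_gen R G (Sstar_gen e)"
abbreviation cls where "cls x \<equiv> pres_cong R (lpa_gens G) (lpa_rels G) `` {x}"
abbreviation "terms \<equiv> exprs R (lpa_gens G) :: (('v, 'e) lpa_gen, 'r) alg_expr set"

text \<open>Elements of the algebra are sets of terms, and automation must not compare them by
  extensionality.\<close>

declare equalityI [rule del]

sublocale nonunital_algebra R "leavitt R G"
  unfolding leavitt_def by (rule nonunital_algebra_presented[OF cring])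

text \<open>The order matters, because later proofs select facts by position: 1 is the carrier, 2
  the zero, 3 to 5 are the operations, and those from 6 on decide membership in
  \<open>terms\<close>.\<close>

lemmas cls_simps =
  presented_carrier[OF cring, where X = "lpa_gens G" and Rel = "lpa_rels G", folded leavitt_def]
  presented_zero[OF cring, where X = "lpa_gens G" and Rel = "lpa_rels G", folded leavitt_def]
  presented_add[OF cring, where X = "lpa_gens G" and Rel = "lpa_rels G", folded leavitt_def]
  presented_mult[OF cring, where X = "lpa_gens G" and Rel = "lpa_rels G", folded leavitt_def]
  presented_smult[OF cring, where X = "lpa_gens G" and Rel = "lpa_rels G", folded leavitt_def]
  exprs_simps[OF cring]

lemma cls_Gen: "cls (Gen g) = leavitt_gen R G g"
  by (simp add: leavitt_gen_def)

lemma cls_eqI: "\<lbrakk>(x, y) \<in> lpa_rels G; x \<in> terms; y \<in> terms\<rbrakk> \<Longrightarrow> cls x = cls y"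
  by (intro pcls_eqI[OF cring] pres_cong.rel)

lemma cls_uminus: "x \<in> terms \<Longrightarrow> \<ominus>\<^bsub>L\<^esub> cls x = cls (Neg x)"
  unfolding leavitt_def by (rule presented_uminus[OF cring])

lemma gens_mem [simp]:
  "P_gen A \<in> lpa_gens G \<longleftrightarrow> A \<in> gen_verts G"
  "S_gen e \<in> lpa_gens G \<longleftrightarrow> e \<in> edges G"
  "Sstar_gen e \<in> lpa_gens G \<longleftrightarrow> e \<in> edges G"
  by (auto simp: lpa_gens_def)

lemma gen_closed [simp, intro]: "g \<in> lpa_gens G \<Longrightarrow> leavitt_gen R G g \<in> carrier L"
  by (auto simp: cls_simps simp flip: cls_Gen)

lemma verts_facts [simp]:
  "e \<in> edges G \<Longrightarrow> src G e \<in> verts G" "e \<in> edges G \<Longrightarrow> {src G e} \<in> gen_verts G"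
  "e \<in> edges G \<Longrightarrow> rng G e \<in> gen_verts G" "v \<in> verts G \<Longrightarrow> {v} \<in> gen_verts G"
  "{} \<in> gen_verts G"
  using ultragraph by (auto simp: is_ultragraph_def Pi_def gen_verts_empty intro: gen_verts.intros)

lemma p_empty [simp]: "p {} = \<zero>\<^bsub>L\<^esub>"
  using cls_eqI[OF lpa_rels.P_empty] by (simp add: cls_simps cls_Gen)

lemma p_mult [simp]: "\<lbrakk>A \<in> gen_verts G; B \<in> gen_verts G\<rbrakk> \<Longrightarrow> p A \<cdot> p B = p (A \<inter> B)"
  using cls_eqI[OF lpa_rels.P_mult[of A G B]]
  by (simp add: cls_simps gen_verts_Int flip: cls_Gen)

lemma p_union:
  "\<lbrakk>A \<in> gen_verts G; B \<in> gen_verts G\<rbrakk> \<Longrightarrow> p (A \<union> B) = p A \<oplus>\<^bsub>L\<^esub> p B \<oplus>\<^bsub>L\<^esub> \<ominus>\<^bsub>L\<^esub> p (A \<inter> B)"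
  using cls_eqI[OF lpa_rels.P_union[of A G B]]
  by (simp add: cls_simps gen_verts_Int gen_verts_Un cls_uminus flip: cls_Gen)

lemma edge_rels [simp]:
  assumes "e \<in> edges G"
  shows "p {src G e} \<cdot> s e = s e" "s e \<cdot> p (rng G e) = s e"
    "p (rng G e) \<cdot> t e = t e" "t e \<cdot> p {src G e} = t e"
  using cls_eqI[OF lpa_rels.src_S[OF assms]] cls_eqI[OF lpa_rels.S_rng[OF assms]]
    cls_eqI[OF lpa_rels.rng_Sstar[OF assms]] cls_eqI[OF lpa_rels.Sstar_src[OF assms]] assms
  by (simp_all add: cls_simps flip: cls_Gen)

lemma t_s: "\<lbrakk>e \<in> edges G; f \<in> edges G\<rbrakk> \<Longrightarrow> t e \<cdot> s f = (if e = f then p (rng G e) else \<zero>\<^bsub>L\<^esub>)"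
  using cls_eqI[OF lpa_rels.Sstar_S[of e G f]]
  by (auto simp add: cls_simps simp flip: cls_Gen split: if_splits)

section \<open>Words in the generators and the components they span\<close>

lemma p_s:
  assumes "A \<in> gen_verts G" "e \<in> edges G"
  shows "p A \<cdot> s e = (if src G e \<in> A then s e else \<zero>\<^bsub>L\<^esub>)"
proof -
  have "p A \<cdot> s e = p A \<cdot> p {src G e} \<cdot> s e"
    using assms by (simp add: mult_assoc del: p_mult)
  also have "\<dots> = p (A \<inter> {src G e}) \<cdot> s e"
    using assms by simp
  finally show ?thesis
    using assms by (auto simp: Int_insert_right)
qed

lemma t_p:
  assumes "A \<in> gen_verts G" "e \<in> edges G"
  shows "t e \<cdot> p A = (if src G e \<in> A then t e else \<zero>\<^bsub>L\<^esub>)"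
proof -
  have "t e \<cdot> p A = t e \<cdot> (p {src G e} \<cdot> p A)"
    using assms by (simp del: p_mult flip: mult_assoc)
  also have "\<dots> = t e \<cdot> p ({src G e} \<inter> A)"
    using assms by simp
  finally show ?thesis
    using assms by auto
qed

text \<open>Consecutive edges need not be composable; a non-composable product is zero. The explicit
  zero keeps each set closed under left multiplication by \<open>p A\<close>. Left words grow at
  their left end and right words at their right end, so that in a product \<open>u \<cdot> v\<close>
  the projections sit in the middle.\<close>

primrec left_words where
  "left_words 0 = insert \<zero>\<^bsub>L\<^esub> (p ` gen_verts G)"
| "left_words (Suc k) = insert \<zero>\<^bsub>L\<^esub> {s e \<cdot> u | e u. e \<in> edges G \<and> u \<in> left_words k}"

primrec right_words where
  "right_words 0 = insert \<zero>\<^bsub>L\<^esub> (p ` gen_verts G)"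
| "right_words (Suc k) = insert \<zero>\<^bsub>L\<^esub> {v \<cdot> t e | e v. e \<in> edges G \<and> v \<in> right_words k}"

definition monomials :: "int \<Rightarrow> (('v, 'e) lpa_gen, 'r) alg_expr set set" where
  "monomials m = {u \<cdot> v | i j u v. u \<in> left_words i \<and> v \<in> right_words j \<and> int i - int j = m}"

lemma left_words_closed: "u \<in> left_words k \<Longrightarrow> u \<in> carrier L"
  by (induction k arbitrary: u) auto

lemma right_words_closed: "v \<in> right_words k \<Longrightarrow> v \<in> carrier L"
  by (induction k arbitrary: v) auto

lemma words_zero [simp]: "\<zero>\<^bsub>L\<^esub> \<in> left_words k" "\<zero>\<^bsub>L\<^esub> \<in> right_words k"
  by (cases k; simp)+

lemma monomials_closed: "monomials m \<subseteq> carrier L"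
  by (auto simp: monomials_def left_words_closed right_words_closed)

lemma monomialsI: "\<lbrakk>u \<in> left_words i; v \<in> right_words j; int i - int j = m\<rbrakk> \<Longrightarrow> u \<cdot> v \<in> monomials m"
  unfolding monomials_def by blast

lemma monomialsE:
  assumes "x \<in> monomials m"
  obtains i j u v where "x = u \<cdot> v" "u \<in> left_words i" "v \<in> right_words j" "int i - int j = m"
    "u \<in> carrier L" "v \<in> carrier L"
  using assms left_words_closed right_words_closed unfolding monomials_def by blast

lemma p_left_words: "\<lbrakk>A \<in> gen_verts G; u \<in> left_words k\<rbrakk> \<Longrightarrow> p A \<cdot> u \<in> left_words k"
  by (cases k)
    (auto simp: gen_verts_Int p_s left_words_closed simp flip: mult_assoc split: if_splits)

lemma right_words_p: "\<lbrakk>A \<in> gen_verts G; v \<in> right_words k\<rbrakk> \<Longrightarrow> v \<cdot> p A \<in> right_words k"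
  by (cases k)
    (auto simp: gen_verts_Int t_p right_words_closed mult_assoc split: if_splits)

text \<open>The witness is the idempotent projection at the inner end of the word, or
  \<open>{}\<close> for the zero word. It makes a left word a monomial whose right word is just
  \<open>p A\<close>.\<close>

lemma left_words_id:
  "u \<in> left_words k \<Longrightarrow> \<exists>A\<in>gen_verts G. u \<cdot> p A = u"
proof (induction k arbitrary: u)
  case 0
  then consider "u = \<zero>\<^bsub>L\<^esub>" | A where "A \<in> gen_verts G" "u = p A"
    by auto
  then show ?case
  proof cases
    case 1
    then show ?thesis by (intro bexI[of _ "{}"]) simp_all
  next
    case (2 A)
    then show ?thesis by (intro bexI[of _ A]) simp_all
  qed
next
  case (Suc k)
  show ?case
  proof (cases "u = \<zero>\<^bsub>L\<^esub>")
    case False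
    then obtain e u' where u: "e \<in> edges G" "u' \<in> left_words k" "u = s e \<cdot> u'"
      using Suc.prems by auto
    then obtain A where "A \<in> gen_verts G" "u' \<cdot> p A = u'"
      using Suc.IH by blast
    then show ?thesis
      using u by (intro bexI[of _ A]) (simp_all add: mult_assoc left_words_closed)
  qed (use gen_verts_empty in auto)
qed

lemma right_words_id:
  "v \<in> right_words k \<Longrightarrow> \<exists>A\<in>gen_verts G. p A \<cdot> v = v"
proof (induction k arbitrary: v)
  case 0
  then consider "v = \<zero>\<^bsub>L\<^esub>" | A where "A \<in> gen_verts G" "v = p A"
    by auto
  then show ?case
  proof cases
    case 1
    then show ?thesis by (intro bexI[of _ "{}"]) simp_all
  next
    case (2 A)
    then show ?thesis by (intro bexI[of _ A]) simp_all
  qed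
next
  case (Suc k)
  show ?case
  proof (cases "v = \<zero>\<^bsub>L\<^esub>")
    case False
    then obtain e v' where v: "e \<in> edges G" "v' \<in> right_words k" "v = v' \<cdot> t e"
      using Suc.prems by auto
    then obtain A where "A \<in> gen_verts G" "p A \<cdot> v' = v'"
      using Suc.IH by blast
    then show ?thesis
      using v by (intro bexI[of _ A]) (simp_all add: right_words_closed flip: mult_assoc)
  qed (use gen_verts_empty in auto)
qed

lemma left_words_monomials:
  assumes "u \<in> left_words k"
  shows "u \<in> monomials (int k)"
proof -
  obtain A where "A \<in> gen_verts G" "u \<cdot> p A = u"
    using left_words_id[OF assms] by blast
  then show ?thesis
    using monomialsI[of u k "p A" 0 "int k"] assms by simp
qed

lemma right_words_monomials:
  assumes "v \<in> right_words k"
  shows "v \<in> monomials (- int k)"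
proof -
  obtain A where "A \<in> gen_verts G" "p A \<cdot> v = v"
    using right_words_id[OF assms] by blast
  then show ?thesis
    using monomialsI[of "p A" 0 v k "- int k"] assms by simp
qed

lemma s_left_words: "e \<in> edges G \<Longrightarrow> s e \<in> left_words 1"
proof -
  assume "e \<in> edges G"
  moreover from this have "s e = s e \<cdot> p (rng G e)" by simp
  ultimately have "\<exists>e' u. s e = s e' \<cdot> u \<and> e' \<in> edges G \<and> u \<in> left_words 0"
    by (metis imageI insertCI left_words.simps(1) verts_facts(3))
  then show ?thesis by simp
qed

lemma t_right_words: "e \<in> edges G \<Longrightarrow> t e \<in> right_words 1"
proof -
  assume "e \<in> edges G"
  moreover from this have "t e = p (rng G e) \<cdot> t e" by simp
  ultimately have "\<exists>e' v. t e = v \<cdot> t e' \<and> e' \<in> edges G \<and> v \<in> right_words 0"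
    by (metis imageI insertCI right_words.simps(1) verts_facts(3))
  then show ?thesis by simp
qed

text \<open>The new ghost edge arrives at the left, whereas right words are built at the right. The
  induction therefore moves it inwards to the projection, where \<open>t_p\<close> leaves either
  \<open>t e\<close> or zero.\<close>

lemma t_mult_right_words:
  "\<lbrakk>e \<in> edges G; v \<in> right_words k\<rbrakk> \<Longrightarrow> t e \<cdot> v \<in> right_words (Suc k)"
proof (induction k arbitrary: v)
  case 0
  then have "t e \<cdot> v = t e \<or> t e \<cdot> v = \<zero>\<^bsub>L\<^esub>"
    by (auto simp: t_p)
  then show ?case
    using t_right_words[OF 0(1)] words_zero(2)[of "Suc 0"] by (metis One_nat_def)
next
  case (Suc k)
  show ?case
  proof (cases "v = \<zero>\<^bsub>L\<^esub>")
    case True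
    then show ?thesis using Suc.prems by simp
  next
    case False
    then obtain f v' where v: "f \<in> edges G" "v' \<in> right_words k" "v = v' \<cdot> t f"
      using Suc.prems by auto
    then have "t e \<cdot> v' \<in> right_words (Suc k)" "t e \<cdot> v = t e \<cdot> v' \<cdot> t f"
      using Suc by (simp_all add: right_words_closed mult_assoc)
    then show ?thesis
      using v(1) by (subst right_words.simps) blast
  qed
qed

fun gen_degree :: "('v, 'e) lpa_gen \<Rightarrow> int" where
  "gen_degree (S_gen e) = 1"
| "gen_degree (Sstar_gen e) = -1"
| "gen_degree (P_gen A) = 0"

lemma gen_mult_monomials:
  assumes g: "g \<in> lpa_gens G" and x: "x \<in> monomials m"
  shows "leavitt_gen R G g \<cdot> x \<in> monomials (gen_degree g + m)"
proof -
  obtain i j u v where uv: "x = u \<cdot> v" "u \<in> left_words i" "v \<in> right_words j" "int i - int j = m"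
    "u \<in> carrier L" "v \<in> carrier L"
    using x by (rule monomialsE)
  have eq: "leavitt_gen R G g \<cdot> x = leavitt_gen R G g \<cdot> u \<cdot> v"
    using g uv by (simp add: mult_assoc)
  show ?thesis
  proof (cases g)
    case (S_gen e)
    then have "s e \<cdot> u \<in> left_words (Suc i)"
      using g uv by auto
    then show ?thesis
      unfolding eq using monomialsI[of "s e \<cdot> u" "Suc i" v j "1 + m"] uv S_gen by simp
  next
    case (P_gen A)
    then show ?thesis
      unfolding eq using monomialsI[OF p_left_words[of A u i] uv(3)] uv g by simp
  next
    case (Sstar_gen e)
    then have e: "e \<in> edges G" using g by simp
    have zero: "\<zero>\<^bsub>L\<^esub> \<in> monomials (- 1 + m)"
      using monomialsI[of "\<zero>\<^bsub>L\<^esub>" i "\<zero>\<^bsub>L\<^esub>" "Suc j" "- 1 + m"] uv by simp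
    show ?thesis
    \<comment> \<open>If \<open>u\<close> contains no edge, \<open>t e\<close> passes through its
      projection, or is killed by it, and joins the right word. Otherwise it meets the first edge of
      \<open>u\<close> and cancels it or gives zero. The degree drops by one in both cases.\<close>
    proof (cases i)
      case 0
      then consider "u = \<zero>\<^bsub>L\<^esub>" | A where "A \<in> gen_verts G" "u = p A"
        using uv by auto
      then show ?thesis
      proof cases
        case 2
        have "t e \<cdot> u = t e \<or> t e \<cdot> u = \<zero>\<^bsub>L\<^esub>"
          using 2 e by (simp add: t_p)
        moreover have "t e \<cdot> v \<in> monomials (- 1 + m)"
          proof -
          have "- int (Suc j) = - 1 + m"
            using uv(4) 0 by simp
          then show ?thesis
            using right_words_monomials[OF t_mult_right_words[OF e uv(3)]] by simp
        qed
        ultimately show ?thesis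
          unfolding eq using zero uv Sstar_gen by auto
      qed (use zero eq e Sstar_gen uv in auto)
    next
      case (Suc k)
      have "t e \<cdot> u \<in> left_words k"
      proof (cases "u = \<zero>\<^bsub>L\<^esub>")
        case False
        then obtain f u' where u: "f \<in> edges G" "u' \<in> left_words k" "u = s f \<cdot> u'"
          using uv(2) Suc by auto
        then have "t e \<cdot> u = t e \<cdot> s f \<cdot> u'"
          using e by (simp add: mult_assoc left_words_closed)
        then show ?thesis
          using u e by (auto simp: t_s p_left_words left_words_closed)
      qed (use e in simp)
      then show ?thesis
        unfolding eq using monomialsI[of "t e \<cdot> u" k v j "- 1 + m"] uv Suc Sstar_gen by simp
    qed
  qed
qed

definition component where "component m = lin_span R L (monomials m)"

lemma component_closed: "component m \<subseteq> carrier L"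
  unfolding component_def by (rule lin_span_closed[OF monomials_closed])

lemma component_induct [consumes 1, case_names zero step]:
  assumes "x \<in> component m" and "P \<zero>\<^bsub>L\<^esub>"
    and "\<And>c i j u v y. \<lbrakk>c \<in> carrier R; u \<in> left_words i; v \<in> right_words j; int i - int j = m;
      u \<in> carrier L; v \<in> carrier L; y \<in> carrier L; P y\<rbrakk> \<Longrightarrow> P (c \<odot>\<^bsub>L\<^esub> (u \<cdot> v) \<oplus>\<^bsub>L\<^esub> y)"
  shows "P x"
proof (rule lin_span_induct[OF _ monomials_closed])
  show "x \<in> lin_span R L (monomials m)"
    using assms(1) by (simp add: component_def)
  show "P (c \<odot>\<^bsub>L\<^esub> x \<oplus>\<^bsub>L\<^esub> y)"
    if "c \<in> carrier R" "x \<in> monomials m" "y \<in> carrier L" "P y" for c x y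
    using that(2) by (rule monomialsE) (use that assms(3) in auto)
qed (rule assms(2))

lemma component_zero: "\<zero>\<^bsub>L\<^esub> \<in> component m"
  unfolding component_def by (rule lin_span_zero)

lemma component_add: "\<lbrakk>x \<in> component m; y \<in> component m\<rbrakk> \<Longrightarrow> x \<oplus>\<^bsub>L\<^esub> y \<in> component m"
  unfolding component_def by (intro lin_span_add monomials_closed)

lemma component_smult: "\<lbrakk>a \<in> carrier R; x \<in> component m\<rbrakk> \<Longrightarrow> a \<odot>\<^bsub>L\<^esub> x \<in> component m"
  unfolding component_def by (intro lin_span_smult monomials_closed)

lemma monomials_component: "x \<in> monomials m \<Longrightarrow> x \<in> component m"
  unfolding component_def by (intro lin_span_base monomials_closed)

lemma gen_mult_component:
  assumes "g \<in> lpa_gens G" "x \<in> component m"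
  shows "leavitt_gen R G g \<cdot> x \<in> component (gen_degree g + m)"
  using assms(2)
proof (induction rule: component_induct)
  case (step c i j u v y)
  have "leavitt_gen R G g \<cdot> (c \<odot>\<^bsub>L\<^esub> (u \<cdot> v) \<oplus>\<^bsub>L\<^esub> y)
      = c \<odot>\<^bsub>L\<^esub> (leavitt_gen R G g \<cdot> (u \<cdot> v)) \<oplus>\<^bsub>L\<^esub> leavitt_gen R G g \<cdot> y"
    using step assms(1) by (simp add: r_distrib smult_mult_right)
  moreover have "leavitt_gen R G g \<cdot> (u \<cdot> v) \<in> component (gen_degree g + m)"
    using step assms(1) by (intro monomials_component gen_mult_monomials monomialsI)
  ultimately show ?case
    using step by (simp add: component_add component_smult)
qed (use assms(1) in \<open>simp add: component_zero\<close>)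

lemma left_words_mult_component:
  "\<lbrakk>u \<in> left_words k; x \<in> component m\<rbrakk> \<Longrightarrow> u \<cdot> x \<in> component (int k + m)"
proof (induction k arbitrary: u)
  case 0
  then show ?case
    using gen_mult_component[of "P_gen _" x m] component_closed component_zero by (auto simp: subset_iff)
next
  case (Suc k)
  have x: "x \<in> carrier L" using Suc.prems component_closed by blast
  show ?case
  proof (cases "u = \<zero>\<^bsub>L\<^esub>")
    case False
    then obtain e u' where u: "e \<in> edges G" "u' \<in> left_words k" "u = s e \<cdot> u'"
      using Suc.prems by auto
    then show ?thesis
      using gen_mult_component[of "S_gen e" "u' \<cdot> x" "int k + m"] Suc x
      by (simp add: mult_assoc left_words_closed add_ac)
  qed (use x component_zero in simp)
qed

text \<open>The ghost edge next to \<open>x\<close> is the one that unfolds, so it acts on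
  \<open>x\<close> before the rest of the word does. Hence the induction hypothesis is needed for
  all \<open>x\<close> and \<open>m\<close>.\<close>

lemma right_words_mult_component:
  "\<lbrakk>v \<in> right_words k; x \<in> component m\<rbrakk> \<Longrightarrow> v \<cdot> x \<in> component (- int k + m)"
proof (induction k arbitrary: v x m)
  case 0
  then show ?case
    using gen_mult_component[of "P_gen _" x m] component_closed component_zero by (auto simp: subset_iff)
next
  case (Suc k)
  have x: "x \<in> carrier L" using Suc.prems component_closed by blast
  show ?case
  proof (cases "v = \<zero>\<^bsub>L\<^esub>")
    case False
    then obtain e v' where v: "e \<in> edges G" "v' \<in> right_words k" "v = v' \<cdot> t e"
      using Suc.prems by auto
    then show ?thesis
      using Suc.IH[of v' "t e \<cdot> x" "- 1 + m"] gen_mult_component[of "Sstar_gen e" x m] Suc.prems x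
      by (simp add: mult_assoc right_words_closed algebra_simps)
  qed (use x component_zero in simp)
qed

lemma component_mult:
  assumes "x \<in> component m" and y: "y \<in> component n"
  shows "x \<cdot> y \<in> component (m + n)"
  using assms(1)
proof (induction rule: component_induct)
  case zero
  have "y \<in> carrier L" using y component_closed by blast
  then show ?case using component_zero by simp
next
  case (step c i j u v z)
  have yc: "y \<in> carrier L" using y component_closed by blast
  have "(c \<odot>\<^bsub>L\<^esub> (u \<cdot> v) \<oplus>\<^bsub>L\<^esub> z) \<cdot> y = c \<odot>\<^bsub>L\<^esub> (u \<cdot> (v \<cdot> y)) \<oplus>\<^bsub>L\<^esub> z \<cdot> y"
    using step yc by (simp add: l_distrib smult_mult_left mult_assoc)
  moreover have "u \<cdot> (v \<cdot> y) \<in> component (int i + (- int j + n))"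
    using step y by (intro left_words_mult_component right_words_mult_component)
  then have "u \<cdot> (v \<cdot> y) \<in> component (m + n)"
    using step(4) by (auto simp: algebra_simps)
  ultimately show ?case
    using step by (simp add: component_add component_smult)
qed

lemma additive_subgroup_component: "additive_subgroup (component m) L"
  unfolding component_def by (rule additive_subgroup_lin_span[OF monomials_closed])

section \<open>Comparison of words with composable paths\<close>

abbreviation edge_path :: "'e list \<Rightarrow> bool" where
  "edge_path es \<equiv> es \<noteq> [] \<and> set es \<subseteq> edges G \<and> successively (\<lambda>e f. src G f \<in> rng G e) es"

lemma Edges_path: "Edges es \<in> finite_paths G \<longleftrightarrow> edge_path es"
  by (auto simp: finite_paths_def)

lemma GenVert_path: "GenVert A \<in> finite_paths G \<longleftrightarrow> A \<in> gen_verts G"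
  by (auto simp: finite_paths_def)

lemma edge_gens_closed:
  "set es \<subseteq> edges G \<Longrightarrow> s ` set es \<subseteq> carrier L" "set es \<subseteq> edges G \<Longrightarrow> t ` set es \<subseteq> carrier L"
  using gen_closed gens_mem by blast+

lemma s_path_closed: "\<alpha> \<in> finite_paths G \<Longrightarrow> s_path R G \<alpha> \<in> carrier L"
  by (cases \<alpha>) (auto simp: Edges_path GenVert_path edge_gens_closed intro!: list_product_closed del: subsetI)

lemma s_path_star_closed: "\<alpha> \<in> finite_paths G \<Longrightarrow> s_path_star R G \<alpha> \<in> carrier L"
  by (cases \<alpha>) (auto simp: Edges_path GenVert_path edge_gens_closed intro!: list_product_closed del: subsetI)

lemma s_path_Cons: "es \<noteq> [] \<Longrightarrow> s_path R G (Edges (e # es)) = s e \<cdot> s_path R G (Edges es)"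
  by (simp add: list_product_Cons)

lemma s_path_star_Cons:
  "\<lbrakk>es \<noteq> []; set es \<subseteq> edges G; e \<in> edges G\<rbrakk>
    \<Longrightarrow> s_path_star R G (Edges (e # es)) = s_path_star R G (Edges es) \<cdot> t e"
  using list_product_snoc[of "map t (rev es)" "t e"] by (auto simp: edge_gens_closed)

lemma src_s_path:
  assumes "edge_path (e # es)"
  shows "p {src G e} \<cdot> s_path R G (Edges (e # es)) = s_path R G (Edges (e # es))"
proof (cases "es = []")
  case False
  then have "Edges es \<in> finite_paths G"
    using assms by (auto simp: Edges_path successively_Cons)
  then show ?thesis
    using s_path_closed[of "Edges es"] False assms
    by (simp add: s_path_Cons del: s_path.simps flip: mult_assoc)
qed (use assms in simp)

lemma s_path_star_src:
  assumes "edge_path (e # es)"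
  shows "s_path_star R G (Edges (e # es)) \<cdot> p {src G e} = s_path_star R G (Edges (e # es))"
proof (cases "es = []")
  case False
  then have "Edges es \<in> finite_paths G"
    using assms by (auto simp: Edges_path successively_Cons)
  then show ?thesis
    using s_path_star_closed[of "Edges es"] False assms
    by (simp add: s_path_star_Cons mult_assoc del: s_path_star.simps)
qed (use assms in simp)

lemma s_path_left_words:
  assumes "edge_path es" "u \<in> left_words k"
  shows "s_path R G (Edges es) \<cdot> u \<in> left_words (length es + k)"
  using assms(1)
proof (induction es)
  case (Cons e es)
  show ?case
  proof (cases "es = []")
    case True
    then show ?thesis using Cons.prems assms(2) by auto
  next
    case False
    then have es: "edge_path es" "s_path R G (Edges es) \<in> carrier L"
      using Cons.prems s_path_closed[of "Edges es"] by (auto simp: Edges_path successively_Cons)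
    then have "s_path R G (Edges (e # es)) \<cdot> u = s e \<cdot> (s_path R G (Edges es) \<cdot> u)"
      using False Cons.prems assms(2)
      by (simp add: s_path_Cons mult_assoc left_words_closed del: s_path.simps)
    then show ?thesis
      using Cons es by auto
  qed
qed simp

lemma right_words_s_path_star:
  assumes "edge_path es" "v \<in> right_words k"
  shows "v \<cdot> s_path_star R G (Edges es) \<in> right_words (length es + k)"
  using assms(1)
proof (induction es)
  case (Cons e es)
  show ?case
  proof (cases "es = []")
    case True
    then show ?thesis using Cons.prems assms(2) by auto
  next
    case False
    then have es: "edge_path es" "s_path_star R G (Edges es) \<in> carrier L"
      using Cons.prems s_path_star_closed[of "Edges es"] by (auto simp: Edges_path successively_Cons)
    then have "v \<cdot> s_path_star R G (Edges (e # es)) = (v \<cdot> s_path_star R G (Edges es)) \<cdot> t e"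
      using False Cons.prems assms(2)
      by (simp add: s_path_star_Cons mult_assoc right_words_closed del: s_path_star.simps)
    then show ?thesis
      using Cons es by auto
  qed
qed simp

text \<open>Prepending an edge to a path gives a longer path if the two are composable and zero
  otherwise. A path \<open>GenVert B\<close> of length 0 contributes only a projection, which is
  merged with \<open>p A\<close>.\<close>

lemma left_words_path:
  "u \<in> left_words k \<Longrightarrow> u = \<zero>\<^bsub>L\<^esub> \<or>
    (\<exists>\<alpha> A. \<alpha> \<in> finite_paths G \<and> path_length \<alpha> = k \<and> A \<in> gen_verts G \<and> u = s_path R G \<alpha> \<cdot> p A)"
proof (induction k arbitrary: u)
  case 0
  then consider "u = \<zero>\<^bsub>L\<^esub>" | A where "A \<in> gen_verts G" "u = p A"
    by auto
  then show ?case
  proof cases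
    case (2 A)
    then show ?thesis
      by (intro disjI2 exI[of _ "GenVert A"] exI[of _ A]) (simp add: GenVert_path)
  qed simp
next
  case (Suc k)
  then consider "u = \<zero>\<^bsub>L\<^esub>" | e u' where "e \<in> edges G" "u' \<in> left_words k" "u = s e \<cdot> u'"
    by auto
  then show ?case
  proof cases
    case (2 e u')
    consider "u' = \<zero>\<^bsub>L\<^esub>"
      | \<alpha> A where "\<alpha> \<in> finite_paths G" "path_length \<alpha> = k" "A \<in> gen_verts G" "u' = s_path R G \<alpha> \<cdot> p A"
      using Suc.IH[OF 2(2)] by blast
    then show ?thesis
    proof cases
      case 1
      then show ?thesis using 2 by simp
    next
      case \<alpha>: (2 \<alpha> A)
      show ?thesis
      proof (cases \<alpha>)
        case (GenVert B)
        then have B: "B \<in> gen_verts G" "k = 0"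
          using \<alpha> by (auto simp: GenVert_path)
        then have "u = s_path R G (Edges [e]) \<cdot> p (B \<inter> A)"
          using 2 \<alpha> GenVert by simp
        moreover have "Edges [e] \<in> finite_paths G"
          using 2 by (simp add: Edges_path)
        ultimately show ?thesis
          using B \<alpha> gen_verts_Int by (metis One_nat_def length_Cons list.size(3) path_length.simps(2))
      next
        case (Edges es)
        then obtain f fs where fs: "es = f # fs"
          using \<alpha>(1) by (cases es) (auto simp: Edges_path)
        have f: "f \<in> edges G" "edge_path (f # fs)"
          using \<alpha>(1) Edges fs by (auto simp: Edges_path)
        let ?x = "s_path R G (Edges (f # fs))"
        have x: "?x \<in> carrier L"
          using s_path_closed \<alpha>(1) Edges fs by blast
        show ?thesis
        proof (cases "src G f \<in> rng G e")
          case True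
          then have "Edges (e # f # fs) \<in> finite_paths G"
            using f 2 by (simp add: Edges_path)
          moreover have "u = s_path R G (Edges (e # f # fs)) \<cdot> p A"
            using 2 \<alpha> Edges fs x by (simp add: s_path_Cons mult_assoc del: s_path.simps)
          moreover have "path_length (Edges (e # f # fs)) = Suc k"
            using \<alpha>(2) Edges fs by simp
          ultimately show ?thesis
            using \<alpha>(3) by blast
        next
          case False
          \<comment> \<open>Both factors absorb a projection, and the two projections inserted in
            between belong to disjoint sets.\<close>
          have "s e \<cdot> ?x = (s e \<cdot> p (rng G e)) \<cdot> (p {src G f} \<cdot> ?x)"
            by (simp only: edge_rels(2)[OF 2(1)] src_s_path[OF f(2)])
          also have "\<dots> = s e \<cdot> (p (rng G e) \<cdot> p {src G f} \<cdot> ?x)"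
            using 2 f x by (simp add: mult_assoc del: p_mult edge_rels s_path.simps)
          also have "\<dots> = \<zero>\<^bsub>L\<^esub>"
            using 2 f x False by (simp del: s_path.simps)
          finally have "u = \<zero>\<^bsub>L\<^esub>"
            using 2 \<alpha> Edges fs x by (simp del: s_path.simps flip: mult_assoc)
          then show ?thesis by simp
        qed
      qed
    qed
  qed simp
qed

lemma right_words_path:
  "v \<in> right_words k \<Longrightarrow> v = \<zero>\<^bsub>L\<^esub> \<or>
    (\<exists>\<beta> A. \<beta> \<in> finite_paths G \<and> path_length \<beta> = k \<and> A \<in> gen_verts G \<and> v = p A \<cdot> s_path_star R G \<beta>)"
proof (induction k arbitrary: v)
  case 0
  then consider "v = \<zero>\<^bsub>L\<^esub>" | A where "A \<in> gen_verts G" "v = p A"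
    by auto
  then show ?case
  proof cases
    case (2 A)
    then show ?thesis
      by (intro disjI2 exI[of _ "GenVert A"] exI[of _ A]) (simp add: GenVert_path)
  qed simp
next
  case (Suc k)
  then consider "v = \<zero>\<^bsub>L\<^esub>" | e v' where "e \<in> edges G" "v' \<in> right_words k" "v = v' \<cdot> t e"
    by auto
  then show ?case
  proof cases
    case (2 e v')
    consider "v' = \<zero>\<^bsub>L\<^esub>"
      | \<beta> A where "\<beta> \<in> finite_paths G" "path_length \<beta> = k" "A \<in> gen_verts G" "v' = p A \<cdot> s_path_star R G \<beta>"
      using Suc.IH[OF 2(2)] by blast
    then show ?thesis
    proof cases
      case 1
      then show ?thesis using 2 by simp
    next
      case \<beta>: (2 \<beta> A)
      show ?thesis
      proof (cases \<beta>)
        case (GenVert B)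
        then have B: "B \<in> gen_verts G" "k = 0"
          using \<beta> by (auto simp: GenVert_path)
        then have "v = p (A \<inter> B) \<cdot> s_path_star R G (Edges [e])"
          using 2 \<beta> GenVert by simp
        moreover have "Edges [e] \<in> finite_paths G"
          using 2 by (simp add: Edges_path)
        ultimately show ?thesis
          using B \<beta> gen_verts_Int by (metis One_nat_def length_Cons list.size(3) path_length.simps(2))
      next
        case (Edges es)
        then obtain f fs where fs: "es = f # fs"
          using \<beta>(1) by (cases es) (auto simp: Edges_path)
        have f: "f \<in> edges G" "edge_path (f # fs)"
          using \<beta>(1) Edges fs by (auto simp: Edges_path)
        let ?x = "s_path_star R G (Edges (f # fs))"
        have x: "?x \<in> carrier L"
          using s_path_star_closed \<beta>(1) Edges fs by blast
        show ?thesis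
        proof (cases "src G f \<in> rng G e")
          case True
          then have "Edges (e # f # fs) \<in> finite_paths G"
            using f 2 by (simp add: Edges_path)
          moreover have "v = p A \<cdot> s_path_star R G (Edges (e # f # fs))"
            using 2 \<beta> Edges fs x f by (simp add: s_path_star_Cons mult_assoc del: s_path_star.simps)
          moreover have "path_length (Edges (e # f # fs)) = Suc k"
            using \<beta>(2) Edges fs by simp
          ultimately show ?thesis
            using \<beta>(3) by blast
        next
          case False
          have "?x \<cdot> t e = (?x \<cdot> p {src G f}) \<cdot> (p (rng G e) \<cdot> t e)"
            by (simp only: edge_rels(3)[OF 2(1)] s_path_star_src[OF f(2)])
          also have "\<dots> = ?x \<cdot> (p {src G f} \<cdot> p (rng G e)) \<cdot> t e"
            using 2 f x by (simp add: mult_assoc del: p_mult edge_rels s_path_star.simps)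
          also have "\<dots> = \<zero>\<^bsub>L\<^esub>"
            using 2 f x False by (simp del: s_path_star.simps)
          finally have "v = \<zero>\<^bsub>L\<^esub>"
            using 2 \<beta> Edges fs x by (simp add: mult_assoc del: s_path_star.simps)
          then show ?thesis by simp
        qed
      qed
    qed
  qed simp
qed

definition path_monomials where
  "path_monomials m = {s_path R G \<alpha> \<cdot> p A \<cdot> s_path_star R G \<beta> | \<alpha> A \<beta>.
     \<alpha> \<in> finite_paths G \<and> A \<in> gen_verts G \<and> \<beta> \<in> finite_paths G \<and>
     int (path_length \<alpha>) - int (path_length \<beta>) = m}"

lemma leavitt_component_eq_lin_span: "leavitt_component R G m = lin_span R L (path_monomials m)"
proof (intro equalityI subsetI)
  fix x assume "x \<in> leavitt_component R G m"
  then obtain n :: nat and c \<alpha> A \<beta> where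
      "x = (\<Oplus>\<^bsub>L\<^esub>i\<in>{..<n}. c i \<odot>\<^bsub>L\<^esub> (s_path R G (\<alpha> i) \<cdot> p (A i) \<cdot> s_path_star R G (\<beta> i)))"
      "\<forall>i<n. c i \<in> carrier R \<and> \<alpha> i \<in> finite_paths G \<and> A i \<in> gen_verts G \<and> \<beta> i \<in> finite_paths G \<and>
        int (path_length (\<alpha> i)) - int (path_length (\<beta> i)) = m"
    unfolding leavitt_component_def by blast
  then show "x \<in> lin_span R L (path_monomials m)"
    unfolding lin_span_def path_monomials_def
    by (intro CollectI exI[of _ n] exI[of _ c]
        exI[of _ "\<lambda>i. s_path R G (\<alpha> i) \<cdot> p (A i) \<cdot> s_path_star R G (\<beta> i)"]) blast
next
  fix x assume "x \<in> lin_span R L (path_monomials m)"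
  then obtain n :: nat and c y where x: "x = (\<Oplus>\<^bsub>L\<^esub>i\<in>{..<n}. c i \<odot>\<^bsub>L\<^esub> y i)"
    and cy: "\<forall>i<n. c i \<in> carrier R \<and> y i \<in> path_monomials m"
    by (auto simp: lin_span_def)
  let ?P = "\<lambda>i \<alpha> A \<beta>. y i = s_path R G \<alpha> \<cdot> p A \<cdot> s_path_star R G \<beta> \<and>
    \<alpha> \<in> finite_paths G \<and> A \<in> gen_verts G \<and> \<beta> \<in> finite_paths G \<and>
     int (path_length \<alpha>) - int (path_length \<beta>) = m"
  have "\<forall>i\<in>{..<n}. \<exists>\<alpha> A \<beta>. ?P i \<alpha> A \<beta>"
    using cy by (auto simp: path_monomials_def)
  then obtain \<alpha> A \<beta> where P: "\<forall>i\<in>{..<n}. ?P i (\<alpha> i) (A i) (\<beta> i)"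
    by metis
  have closed: "s_path R G (\<alpha> i) \<cdot> p (A i) \<cdot> s_path_star R G (\<beta> i) \<in> carrier L" if "i < n" for i
    using P that s_path_closed s_path_star_closed by simp
  have "x = (\<Oplus>\<^bsub>L\<^esub>i\<in>{..<n}. c i \<odot>\<^bsub>L\<^esub> (s_path R G (\<alpha> i) \<cdot> p (A i) \<cdot> s_path_star R G (\<beta> i)))"
    unfolding x by (rule M.finsum_cong') (use P closed cy in auto)
  then show "x \<in> leavitt_component R G m"
    unfolding leavitt_component_def using P cy
    by (intro CollectI exI[of _ n] exI[of _ c] exI[of _ \<alpha>] exI[of _ A] exI[of _ \<beta>]) auto
qed

text \<open>Each spanning set lies in the span of the other. To split a path monomial into a left
  and a right word, its \<open>p A\<close> is doubled; conversely, the two projections in the middle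
  of \<open>u \<cdot> v\<close> merge into \<open>p (A \<inter> B)\<close>.\<close>

lemma leavitt_component_eq: "leavitt_component R G m = component m"
  unfolding leavitt_component_eq_lin_span component_def
proof (intro equalityI lin_span_subsetI subsetI monomials_closed)
  show path_closed: "x \<in> carrier L" if "x \<in> path_monomials m" for x
    using that s_path_closed s_path_star_closed by (auto simp: path_monomials_def)
  fix x assume "x \<in> path_monomials m"
  then obtain \<alpha> A \<beta> where x: "x = s_path R G \<alpha> \<cdot> p A \<cdot> s_path_star R G \<beta>"
    "\<alpha> \<in> finite_paths G" "A \<in> gen_verts G" "\<beta> \<in> finite_paths G"
    "int (path_length \<alpha>) - int (path_length \<beta>) = m"
    by (auto simp: path_monomials_def)
  have "s_path R G \<alpha> \<cdot> p A \<in> left_words (path_length \<alpha>)"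
    using x s_path_left_words[of _ "p A" 0]
    by (cases \<alpha>) (auto simp: Edges_path GenVert_path gen_verts_Int)
  moreover have "p A \<cdot> s_path_star R G \<beta> \<in> right_words (path_length \<beta>)"
    using x right_words_s_path_star[of _ "p A" 0]
    by (cases \<beta>) (auto simp: Edges_path GenVert_path gen_verts_Int)
  moreover have "x = (s_path R G \<alpha> \<cdot> p A) \<cdot> (p A \<cdot> s_path_star R G \<beta>)"
  proof -
    have "s_path R G \<alpha> \<cdot> p A \<cdot> (p A \<cdot> s_path_star R G \<beta>) = s_path R G \<alpha> \<cdot> (p A \<cdot> p A) \<cdot> s_path_star R G \<beta>"
      using x s_path_closed s_path_star_closed by (simp add: mult_assoc del: p_mult)
    then show ?thesis using x by simp
  qed
  ultimately show "x \<in> lin_span R L (monomials m)"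
    using x(5) by (intro lin_span_base monomials_closed) (simp add: monomialsI)
next
  fix x assume "x \<in> monomials m"
  then obtain i j u v where uv: "x = u \<cdot> v" "u \<in> left_words i" "v \<in> right_words j"
    "int i - int j = m" "u \<in> carrier L" "v \<in> carrier L"
    by (rule monomialsE)
  consider "u = \<zero>\<^bsub>L\<^esub> \<or> v = \<zero>\<^bsub>L\<^esub>"
    | \<alpha> A \<beta> B where "\<alpha> \<in> finite_paths G" "path_length \<alpha> = i" "A \<in> gen_verts G" "u = s_path R G \<alpha> \<cdot> p A"
      "\<beta> \<in> finite_paths G" "path_length \<beta> = j" "B \<in> gen_verts G" "v = p B \<cdot> s_path_star R G \<beta>"
    using left_words_path[OF uv(2)] right_words_path[OF uv(3)] by blast
  then show "x \<in> lin_span R L (path_monomials m)"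
  proof cases
    case 1
    then show ?thesis using uv by (auto simp: lin_span_zero)
  next
    case (2 \<alpha> A \<beta> B)
    have "x = s_path R G \<alpha> \<cdot> (p A \<cdot> p B) \<cdot> s_path_star R G \<beta>"
      using 2 uv s_path_closed s_path_star_closed by (simp add: mult_assoc del: p_mult)
    then have "x \<in> path_monomials m"
      using 2 uv gen_verts_Int[of A G B] unfolding path_monomials_def by auto
    moreover have "path_monomials m \<subseteq> carrier L"
      using s_path_closed s_path_star_closed by (auto simp: path_monomials_def)
    ultimately show ?thesis
      by (rule lin_span_base)
  qed
qed (use monomials_closed in auto)

end

section \<open>The grading\<close>

context leavitt_algebra
begin

text \<open>Let a generator \<open>g\<close> act on the functions \<open>int \<Rightarrow> L\<close> by multiplication by \<open>g\<close>, followed by a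
  translation by the degree of \<open>g\<close>. This representation of \<open>L\<close> separates the components.\<close>

abbreviation seqs :: "('r, int \<Rightarrow> (('v, 'e) lpa_gen, 'r) alg_expr set) module" where
  "seqs \<equiv> fun_module L"

definition shift where
  "shift g = (\<lambda>f\<in>carrier seqs. \<lambda>n. leavitt_gen R G g \<cdot> f (n - gen_degree g))"

text \<open>A relation rather than a degree function, since a term may have several degrees:
  \<open>Zero\<close> has all of them.\<close>

primrec homogeneous :: "(('v, 'e) lpa_gen, 'r) alg_expr \<Rightarrow> int \<Rightarrow> bool" where
  "homogeneous (Gen g) d \<longleftrightarrow> gen_degree g = d"
| "homogeneous Zero d \<longleftrightarrow> True"
| "homogeneous (Add x y) d \<longleftrightarrow> homogeneous x d \<and> homogeneous y d"
| "homogeneous (Neg x) d \<longleftrightarrow> homogeneous x d"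
| "homogeneous (Mult x y) d \<longleftrightarrow> (\<exists>i j. i + j = d \<and> homogeneous x i \<and> homogeneous y j)"
| "homogeneous (Smult a x) d \<longleftrightarrow> homogeneous x d"

lemma module_seqs: "module R seqs"
  by (rule module_fun)

lemma algebra_end_seqs: "nonunital_algebra R (lin_end R seqs)"
  by (rule module.nonunital_algebra_lin_end[OF module_seqs])

lemma shift_closed: "shift \<in> lpa_gens G \<rightarrow> carrier (lin_end R seqs)"
  by (auto simp: lin_end_carrier shift_def fun_module_simps r_distrib smult_mult_right)

lemma cls_closed: "x \<in> terms \<Longrightarrow> cls x \<in> carrier L"
  by (simp add: cls_simps)

text \<open>The action of a homogeneous term depends only on its class and its degree. Two terms
  with the same class and a common degree therefore act alike, which is what makes the action
  respect the relations. In a product the two translations add up.\<close>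

lemma eval_shift:
  assumes "x \<in> terms" "homogeneous x d" "f \<in> carrier seqs"
  shows "eval_expr (lin_end R seqs) shift x f = (\<lambda>n. cls x \<cdot> f (n - d))"
  using assms
proof (induction x arbitrary: d f)
  case (Gen g)
  then show ?case by (simp add: shift_def cls_Gen)
next
  case Zero
  then show ?case
    by (simp add: lin_end_apply fun_module_simps flip: cls_simps(2))
next
  case (Add x y)
  have "cls (Add x y) = cls x \<oplus>\<^bsub>L\<^esub> cls y"
    using Add.prems by (simp add: cls_simps)
  moreover have "eval_expr (lin_end R seqs) shift x f = (\<lambda>n. cls x \<cdot> f (n - d))"
    "eval_expr (lin_end R seqs) shift y f = (\<lambda>n. cls y \<cdot> f (n - d))"
    using Add by (simp_all add: cls_simps(6-))
  ultimately show ?case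
    using Add.prems
    by (simp add: lin_end_apply fun_module_simps cls_simps(6-) cls_closed l_distrib)
next
  case (Neg x)
  have "eval_expr (lin_end R seqs) shift x \<in> carrier (lin_end R seqs)"
    using Neg.prems by (intro eval_expr_closed[OF algebra_end_seqs shift_closed]) (simp add: cls_simps)
  moreover have "(\<lambda>n. cls x \<cdot> f (n - d)) \<in> carrier seqs"
    using Neg.prems by (auto simp: fun_module_simps cls_simps(6-) cls_closed)
  ultimately show ?case
    using Neg by (simp add: module.lin_end_uminus_apply[OF module_seqs] fun_module_uminus
        cls_simps(6-) cls_closed cls_uminus[symmetric] l_minus fun_module_simps)
next
  case (Mult x y)
  then obtain i j where ij: "i + j = d" "homogeneous x i" "homogeneous y j"
    by auto
  have xy: "x \<in> terms" "y \<in> terms" "cls (Mult x y) = cls x \<cdot> cls y"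
    using Mult.prems by (simp_all add: cls_simps)
  then have "(\<lambda>n. cls y \<cdot> f (n - j)) \<in> carrier seqs"
    using Mult.prems by (auto simp: fun_module_simps cls_closed)
  then have "eval_expr (lin_end R seqs) shift (Mult x y) f = (\<lambda>n. cls x \<cdot> (cls y \<cdot> f (n - i - j)))"
    using Mult ij xy by (simp add: lin_end_apply)
  then show ?case
    using xy Mult.prems ij by (auto simp: mult_assoc cls_closed fun_module_simps diff_diff_eq)
next
  case (Smult a x)
  have "cls (Smult a x) = a \<odot>\<^bsub>L\<^esub> cls x"
    using Smult.prems by (simp add: cls_simps)
  then show ?case
    using Smult
    by (simp add: lin_end_apply fun_module_simps cls_simps(6-) cls_closed smult_mult_left)
qed

lemma homogeneous_rels:
  assumes "(x, y) \<in> lpa_rels G"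
  shows "\<exists>d. homogeneous x d \<and> homogeneous y d"
  using assms
proof cases
  case (P_mult A B)
  then show ?thesis by (intro exI[of _ "0"]) auto
next
  case (src_S e)
  then show ?thesis by (intro exI[of _ "1"]) auto
next
  case (S_rng e)
  then show ?thesis by (intro exI[of _ "1"]) auto
next
  case (rng_Sstar e)
  then show ?thesis by (intro exI[of _ "- 1"]) auto
next
  case (Sstar_src e)
  then show ?thesis by (intro exI[of _ "- 1"]) auto
next
  case (Sstar_S e f)
  then show ?thesis by (intro exI[of _ "0"]) auto
next
  case (CK v es)
  \<comment> \<open>Stated for every list \<open>fs\<close>, because the hypotheses on
    \<open>es\<close> do not pass to its tail. Each summand has degree
    \<open>1 + (-1)\<close>.\<close>
  have "homogeneous (foldr Add (map (\<lambda>e. Mult (Gen (S_gen e)) (Gen (Sstar_gen e))) fs) Zero) 0" for fs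
    by (induction fs) auto
  then show ?thesis using CK by auto
qed (intro exI[of _ 0], auto)+

text \<open>There is no circularity in letting \<open>L\<close> act on \<open>L\<close>-valued
  functions: the defining relations already hold for the classes in \<open>L\<close>, and both sides
  of each have a common degree.\<close>

lemma shift_representation:
  obtains \<Phi> where
    "\<And>x y. \<lbrakk>x \<in> carrier L; y \<in> carrier L\<rbrakk> \<Longrightarrow> \<Phi> (x \<oplus>\<^bsub>L\<^esub> y) = \<Phi> x \<oplus>\<^bsub>lin_end R seqs\<^esub> \<Phi> y"
    "\<Phi> \<zero>\<^bsub>L\<^esub> = \<zero>\<^bsub>lin_end R seqs\<^esub>"
    "\<And>x d f. \<lbrakk>x \<in> terms; homogeneous x d; f \<in> carrier seqs\<rbrakk> \<Longrightarrow> \<Phi> (cls x) f = (\<lambda>n. cls x \<cdot> f (n - d))"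
proof -
  have "eval_expr (lin_end R seqs) shift x = eval_expr (lin_end R seqs) shift y"
    if "(x, y) \<in> lpa_rels G" "x \<in> terms" "y \<in> terms" for x y
  proof (rule lin_end_eqI)
    obtain d where "homogeneous x d" "homogeneous y d"
      using homogeneous_rels[OF \<open>(x, y) \<in> _\<close>] by blast
    then show "eval_expr (lin_end R seqs) shift x f = eval_expr (lin_end R seqs) shift y f"
      if "f \<in> carrier seqs" for f
      using eval_shift \<open>x \<in> terms\<close> \<open>y \<in> terms\<close> cls_eqI[OF \<open>(x, y) \<in> _\<close>] that by simp
  qed (use that eval_expr_closed[OF algebra_end_seqs shift_closed] in auto)
  then obtain \<Phi> where \<Phi>: "\<And>x. x \<in> terms \<Longrightarrow> \<Phi> (cls x) = eval_expr (lin_end R seqs) shift x"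
    using presented_lift[OF cring algebra_end_seqs shift_closed] by blast
  show ?thesis
  proof (rule that)
    show "\<Phi> (x \<oplus>\<^bsub>L\<^esub> y) = \<Phi> x \<oplus>\<^bsub>lin_end R seqs\<^esub> \<Phi> y" if xy: "x \<in> carrier L" "y \<in> carrier L" for x y
    proof -
      obtain a b where "a \<in> terms" "b \<in> terms" "x = cls a" "y = cls b"
        using xy unfolding cls_simps(1) by blast
      then show ?thesis by (simp add: cls_simps(3-) \<Phi>)
    qed
    show "\<Phi> \<zero>\<^bsub>L\<^esub> = \<zero>\<^bsub>lin_end R seqs\<^esub>"
      using \<Phi>[of Zero] by (simp add: cls_simps)
  qed (simp add: \<Phi> eval_shift)
qed

section \<open>Separation of the components\<close>

definition homogeneous_classes where
  "homogeneous_classes d = {cls x | x. x \<in> terms \<and> homogeneous x d}"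

lemma homogeneous_classes_mult:
  "\<lbrakk>x \<in> homogeneous_classes d; y \<in> homogeneous_classes d'\<rbrakk>
    \<Longrightarrow> x \<cdot> y \<in> homogeneous_classes (d + d')"
proof -
  assume "x \<in> homogeneous_classes d" "y \<in> homogeneous_classes d'"
  then obtain a b where "a \<in> terms" "homogeneous a d" "x = cls a"
    "b \<in> terms" "homogeneous b d'" "y = cls b"
    by (auto simp: homogeneous_classes_def)
  then show ?thesis
    unfolding homogeneous_classes_def
    by (intro CollectI exI[of _ "Mult a b"]) (auto simp: cls_simps(3-))
qed

lemma homogeneous_classes_zero: "\<zero>\<^bsub>L\<^esub> \<in> homogeneous_classes d"
  unfolding homogeneous_classes_def by (intro CollectI exI[of _ Zero]) (simp add: cls_simps)

lemma homogeneous_classes_gen: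
  "g \<in> lpa_gens G \<Longrightarrow> leavitt_gen R G g \<in> homogeneous_classes (gen_degree g)"
  unfolding homogeneous_classes_def
  by (intro CollectI exI[of _ "Gen g"]) (simp add: cls_simps cls_Gen)

lemma left_words_homogeneous: "u \<in> left_words k \<Longrightarrow> u \<in> homogeneous_classes (int k)"
proof (induction k arbitrary: u)
  case 0
  then show ?case
    using homogeneous_classes_gen[of "P_gen _"] homogeneous_classes_zero by auto
next
  case (Suc k)
  then show ?case
    using homogeneous_classes_gen[of "S_gen _"] homogeneous_classes_zero
      homogeneous_classes_mult[of _ 1 _ "int k"] by auto
qed

lemma right_words_homogeneous: "v \<in> right_words k \<Longrightarrow> v \<in> homogeneous_classes (- int k)"
proof (induction k arbitrary: v)
  case 0
  then show ?case
    using homogeneous_classes_gen[of "P_gen _"] homogeneous_classes_zero by auto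
next
  case (Suc k)
  consider "v = \<zero>\<^bsub>L\<^esub>" | e v' where "e \<in> edges G" "v' \<in> right_words k" "v = v' \<cdot> t e"
    using Suc.prems by auto
  then show ?case
  proof cases
    case (2 e v')
    then have "v \<in> homogeneous_classes (- int k + - 1)"
      using homogeneous_classes_mult[OF Suc.IH homogeneous_classes_gen[of "Sstar_gen e"]] by simp
    then show ?thesis by (simp add: algebra_simps)
  qed (simp add: homogeneous_classes_zero)
qed

text \<open>Links the semantic description of a component, as a span of words, to the syntactic
  degree of terms on which the shift action is known.\<close>

lemma component_homogeneous: "x \<in> component m \<Longrightarrow> x \<in> homogeneous_classes m"
proof (induction rule: component_induct)
  case (step c i j u v y)
  have "u \<cdot> v \<in> homogeneous_classes (int i + - int j)"
    using step by (intro homogeneous_classes_mult left_words_homogeneous right_words_homogeneous)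
  then obtain a b where "a \<in> terms" "homogeneous a m" "u \<cdot> v = cls a"
    "b \<in> terms" "homogeneous b m" "y = cls b"
    using step by (auto simp: homogeneous_classes_def)
  then show ?case
    unfolding homogeneous_classes_def using step(1)
    by (intro CollectI exI[of _ "Add (Smult c a) b"]) (auto simp: cls_simps(3-))
qed (rule homogeneous_classes_zero)

text \<open>The map \<open>C\<close> is fixed before \<open>S\<close> and \<open>f\<close>, so it
  reads the parts off the sum alone, without knowing the decomposition. This is what yields
  uniqueness, up to the factor \<open>y\<close>.\<close>

lemma component_extract:
  obtains C where "\<And>(S :: int set) f y n. \<lbrakk>finite S; \<And>m. f m \<in> component m; y \<in> carrier L\<rbrakk>
    \<Longrightarrow> C (\<Oplus>\<^bsub>L\<^esub>m\<in>S. f m) y n = (if n \<in> S then f n \<cdot> y else \<zero>\<^bsub>L\<^esub>)"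
proof -
  obtain \<Phi> where \<Phi>:
    "\<And>x y. \<lbrakk>x \<in> carrier L; y \<in> carrier L\<rbrakk> \<Longrightarrow> \<Phi> (x \<oplus>\<^bsub>L\<^esub> y) = \<Phi> x \<oplus>\<^bsub>lin_end R seqs\<^esub> \<Phi> y"
    "\<Phi> \<zero>\<^bsub>L\<^esub> = \<zero>\<^bsub>lin_end R seqs\<^esub>"
    "\<And>x d f. \<lbrakk>x \<in> terms; homogeneous x d; f \<in> carrier seqs\<rbrakk> \<Longrightarrow> \<Phi> (cls x) f = (\<lambda>n. cls x \<cdot> f (n - d))"
    using shift_representation by blast
  \<comment> \<open>The function supported at 0 with value \<open>y\<close>. An element of degree
    \<open>m\<close> moves it to position \<open>m\<close>, so position \<open>n\<close> of the
    image sees only the part of degree \<open>n\<close>.\<close>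
  let ?\<delta> = "\<lambda>y (k :: int). if k = 0 then y else \<zero>\<^bsub>L\<^esub>"
  show ?thesis
  proof (rule that[of "\<lambda>x y. \<Phi> x (?\<delta> y)"])
    fix S :: "int set" and f y n
    assume S: "finite S" and f: "\<And>m. f m \<in> component m" and y: "y \<in> carrier L"
    have fc: "f m \<in> carrier L" for m
      using f component_closed by blast
    have \<delta>: "?\<delta> y \<in> carrier seqs"
      using y by (simp add: fun_module_simps)
    have \<Phi>f: "\<Phi> (f m) (?\<delta> y) n = (if n = m then f m \<cdot> y else \<zero>\<^bsub>L\<^esub>)" for m
    proof -
      obtain x where "x \<in> terms" "homogeneous x m" "f m = cls x"
        using component_homogeneous[OF f] by (auto simp: homogeneous_classes_def)
      then have "\<Phi> (f m) (?\<delta> y) n = f m \<cdot> ?\<delta> y (n - m)"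
        using \<Phi>(3)[OF _ _ \<delta>] by simp
      then show ?thesis using fc by simp
    qed
    show "\<Phi> (\<Oplus>\<^bsub>L\<^esub>m\<in>S. f m) (?\<delta> y) n = (if n \<in> S then f n \<cdot> y else \<zero>\<^bsub>L\<^esub>)"
      using S
    proof (induction S rule: finite_induct)
      case empty
      show ?case using \<delta> by (simp add: \<Phi>(2) lin_end_apply fun_module_simps)
    next
      case (insert m S)
      have "\<Phi> (\<Oplus>\<^bsub>L\<^esub>m\<in>insert m S. f m) (?\<delta> y) n
          = \<Phi> (f m) (?\<delta> y) n \<oplus>\<^bsub>L\<^esub> \<Phi> (\<Oplus>\<^bsub>L\<^esub>m\<in>S. f m) (?\<delta> y) n"
        using insert(1,2) fc \<delta> by (simp add: \<Phi>(1) lin_end_apply fun_module_simps)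
      then show ?case
        using insert fc y by (simp add: \<Phi>f)
    qed
  qed
qed

text \<open>The sum of all components, with summands added one at a time and degrees allowed to
  repeat. Closure under the operations is then a plain induction; supports are handled only in
  \<open>component_decomposition\<close>.\<close>

inductive_set component_sums where
  zero: "\<zero>\<^bsub>L\<^esub> \<in> component_sums"
| add: "\<lbrakk>x \<in> component m; y \<in> component_sums\<rbrakk> \<Longrightarrow> x \<oplus>\<^bsub>L\<^esub> y \<in> component_sums"

lemma component_sums_closed: "x \<in> component_sums \<Longrightarrow> x \<in> carrier L"
  by (induction rule: component_sums.induct) (use component_closed in auto)

lemma component_sums_add:
  "\<lbrakk>x \<in> component_sums; y \<in> component_sums\<rbrakk> \<Longrightarrow> x \<oplus>\<^bsub>L\<^esub> y \<in> component_sums"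
proof (induction rule: component_sums.induct)
  case zero
  then show ?case by (simp add: component_sums_closed)
next
  case (add x m z)
  then have "x \<in> carrier L" "y \<in> carrier L" "z \<in> carrier L"
    using component_closed component_sums_closed by blast+
  then have "x \<oplus>\<^bsub>L\<^esub> z \<oplus>\<^bsub>L\<^esub> y = x \<oplus>\<^bsub>L\<^esub> (z \<oplus>\<^bsub>L\<^esub> y)"
    by (simp add: M.a_assoc)
  then show ?case
    using add by (simp add: component_sums.add)
qed

lemma component_in_sums: "x \<in> component m \<Longrightarrow> x \<in> component_sums"
  using component_sums.add[of x m "\<zero>\<^bsub>L\<^esub>"] component_sums.zero component_closed[of m]
  by (auto simp: subset_iff)

lemma component_sums_smult:
  "\<lbrakk>x \<in> component_sums; a \<in> carrier R\<rbrakk> \<Longrightarrow> a \<odot>\<^bsub>L\<^esub> x \<in> component_sums"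
proof (induction rule: component_sums.induct)
  case zero
  then show ?case by (simp add: component_sums.zero)
next
  case (add x m z)
  then have "x \<in> carrier L" "z \<in> carrier L"
    using component_closed component_sums_closed by blast+
  then show ?case
    using add by (simp add: smult_r_distr) (meson component_smult component_sums.add)
qed

lemma component_mult_sums:
  "\<lbrakk>y \<in> component_sums; x \<in> component m\<rbrakk> \<Longrightarrow> x \<cdot> y \<in> component_sums"
proof (induction rule: component_sums.induct)
  case zero
  then have "x \<in> carrier L" using component_closed by blast
  then show ?case by (simp add: component_sums.zero)
next
  case (add y n z)
  then have "x \<in> carrier L" "y \<in> carrier L" "z \<in> carrier L"
    using component_closed component_sums_closed by blast+
  then show ?case
    using add by (simp add: r_distrib) (meson component_mult component_sums.add)
qed

lemma component_sums_mult:
  "\<lbrakk>x \<in> component_sums; y \<in> component_sums\<rbrakk> \<Longrightarrow> x \<cdot> y \<in> component_sums"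
proof (induction rule: component_sums.induct)
  case zero
  then show ?case by (simp add: component_sums.zero component_sums_closed)
next
  case (add x m z)
  then have "x \<in> carrier L" "y \<in> carrier L" "z \<in> carrier L"
    using component_closed component_sums_closed by blast+
  then show ?case
    using add by (simp add: l_distrib component_sums_add component_mult_sums)
qed

lemma gen_component:
  assumes "g \<in> lpa_gens G"
  shows "leavitt_gen R G g \<in> component (gen_degree g)"
proof (cases g)
  case (S_gen e)
  then show ?thesis
    using left_words_monomials[OF s_left_words] assms by (auto intro: monomials_component)
next
  case (Sstar_gen e)
  then show ?thesis
    using right_words_monomials[OF t_right_words] assms by (auto intro: monomials_component)
next
  case (P_gen A)
  then show ?thesis
    using left_words_monomials[of "p A" 0] assms by (auto intro: monomials_component)
qed

lemma component_sums_eq: "component_sums = carrier L"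
proof (intro equalityI subsetI)
  fix x assume "x \<in> carrier L"
  then obtain a where a: "a \<in> terms" "x = cls a"
    by (auto simp: cls_simps(1))
  have "cls a \<in> component_sums"
    using a(1)
  proof (induction a)
    case (Gen g)
    then show ?case
      using component_in_sums[OF gen_component] by (simp add: cls_simps(6-) cls_Gen)
  next
    case Zero
    then show ?case using component_sums.zero by (simp add: cls_simps(2))
  next
    case (Neg a)
    \<comment> \<open>Negation is scalar multiplication by minus one, so closure under scalars
      covers it.\<close>
    then have "cls (Neg a) = (\<ominus>\<^bsub>R\<^esub> \<one>\<^bsub>R\<^esub>) \<odot>\<^bsub>L\<^esub> cls a"
      by (simp add: cls_simps(6-) cls_closed smult_l_minus flip: cls_uminus)
    then show ?case
      using Neg by (simp add: cls_simps(6-) component_sums_smult)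
  qed (simp_all add: cls_simps(6-) component_sums_add component_sums_mult component_sums_smult
      flip: cls_simps(3-5))
  then show "x \<in> component_sums" using a by simp
qed (rule component_sums_closed)

lemma component_decomposition:
  assumes "x \<in> carrier L"
  obtains S f where "finite S" "\<And>m. f m \<in> component m" "\<And>m. m \<notin> S \<Longrightarrow> f m = \<zero>\<^bsub>L\<^esub>"
    "x = (\<Oplus>\<^bsub>L\<^esub>m\<in>S. f m)"
proof -
  have "x \<in> component_sums" using assms component_sums_eq by simp
  then have "\<exists>S f. finite S \<and> (\<forall>m. f m \<in> component m) \<and> (\<forall>m. m \<notin> S \<longrightarrow> f m = \<zero>\<^bsub>L\<^esub>) \<and>
    x = (\<Oplus>\<^bsub>L\<^esub>m\<in>S. f m)"
  proof (induction rule: component_sums.induct)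
    case zero
    show ?case
      by (intro exI[of _ "{}"] exI[of _ "\<lambda>_. \<zero>\<^bsub>L\<^esub>"]) (simp add: component_zero)
  next
    case (add x k y)
    then obtain S f where S: "finite S" and f: "\<And>m. f m \<in> component m"
      and S0: "\<And>m. m \<notin> S \<Longrightarrow> f m = \<zero>\<^bsub>L\<^esub>" and y: "y = (\<Oplus>\<^bsub>L\<^esub>m\<in>S. f m)"
      by blast
    have fc: "f m \<in> carrier L" for m
      using f component_closed by blast
    have xc: "x \<in> carrier L"
      using add component_closed by blast
    let ?f = "f(k := x \<oplus>\<^bsub>L\<^esub> f k)"
    \<comment> \<open>Valid whether or not \<open>k\<close> lies in \<open>S\<close>, because
      \<open>f\<close> vanishes outside \<open>S\<close>. The new summand can then be added to the
      part of degree \<open>k\<close> without a further case distinction.\<close>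
    have "y = f k \<oplus>\<^bsub>L\<^esub> (\<Oplus>\<^bsub>L\<^esub>m\<in>S - {k}. f m)"
    proof (cases "k \<in> S")
      case True
      then show ?thesis
        using M.finsum_insert[of "S - {k}" k f] S fc unfolding y by (simp add: insert_absorb Pi_def)
    next
      case False
      then show ?thesis using S0 fc unfolding y by (simp add: Pi_def)
    qed
    moreover have "(\<Oplus>\<^bsub>L\<^esub>m\<in>insert k S. ?f m) = (x \<oplus>\<^bsub>L\<^esub> f k) \<oplus>\<^bsub>L\<^esub> (\<Oplus>\<^bsub>L\<^esub>m\<in>S - {k}. f m)"
    proof -
      have "(\<Oplus>\<^bsub>L\<^esub>m\<in>S - {k}. ?f m) = (\<Oplus>\<^bsub>L\<^esub>m\<in>S - {k}. f m)"
        by (rule M.finsum_cong') (use fc in auto)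
      moreover have "(\<Oplus>\<^bsub>L\<^esub>m\<in>insert k (S - {k}). ?f m) = ?f k \<oplus>\<^bsub>L\<^esub> (\<Oplus>\<^bsub>L\<^esub>m\<in>S - {k}. ?f m)"
        by (rule M.finsum_insert) (use S fc xc in auto)
      ultimately show ?thesis
        by (simp only: insert_Diff_single fun_upd_same)
    qed
    ultimately have "x \<oplus>\<^bsub>L\<^esub> y = (\<Oplus>\<^bsub>L\<^esub>m\<in>insert k S. ?f m)"
      using fc xc by (simp add: M.a_assoc Pi_def)
    then show ?case
      using S f S0 add(1) by (intro exI[of _ "insert k S"] exI[of _ ?f]) (auto simp: component_add)
  qed
  then show ?thesis using that by blast
qed

lemma p_verts:
  assumes "verts G \<in> gen_verts G"
  shows "u \<in> left_words k \<Longrightarrow> p (verts G) \<cdot> u = u" "v \<in> right_words k \<Longrightarrow> v \<cdot> p (verts G) = v"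
proof -
  have A: "verts G \<inter> A = A" "A \<inter> verts G = A" if "A \<in> gen_verts G" for A
    using gen_verts_subset[OF ultragraph that] by (simp_all add: Int_absorb1 Int_absorb2)
  show "p (verts G) \<cdot> u = u" if "u \<in> left_words k"
    using that assms A by (cases k) (auto simp: p_s left_words_closed simp flip: mult_assoc)
  show "v \<cdot> p (verts G) = v" if "v \<in> right_words k"
    using that assms A by (cases k) (auto simp: t_p right_words_closed mult_assoc)
qed

lemma component_left_id:
  assumes "x \<in> component m" "z \<in> carrier L"
    and "\<And>i j u v. \<lbrakk>u \<in> left_words i; v \<in> right_words j; int i - int j = m\<rbrakk> \<Longrightarrow> z \<cdot> (u \<cdot> v) = u \<cdot> v"
  shows "z \<cdot> x = x"
  using assms(1)
proof (induction rule: component_induct)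
  case (step c i j u v y)
  then show ?case
    using assms(2) assms(3)[OF step(2-4)] by (simp add: r_distrib smult_mult_right)
qed (use assms in simp)

lemma component_right_id:
  assumes "x \<in> component m" "z \<in> carrier L"
    and "\<And>i j u v. \<lbrakk>u \<in> left_words i; v \<in> right_words j; int i - int j = m\<rbrakk> \<Longrightarrow> u \<cdot> v \<cdot> z = u \<cdot> v"
  shows "x \<cdot> z = x"
  using assms(1)
proof (induction rule: component_induct)
  case (step c i j u v y)
  then show ?case
    using assms(2) assms(3)[OF step(2-4)] by (simp add: l_distrib smult_mult_left)
qed (use assms in simp)

text \<open>The assumption supplies \<open>p (verts G)\<close> as a right identity on every
  component. Taken as \<open>y\<close> in \<open>component_extract\<close>, it turns the recovered
  \<open>f n \<cdot> y\<close> into \<open>f n\<close> itself.\<close>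

lemma graded_ring_leavitt:
  assumes "verts G \<in> gen_verts G"
  shows "graded_ring L component"
  unfolding graded_ring_def
proof (intro conjI allI ballI)
  show "nonunital_ring L" by (rule nonunital_ring_axioms)
  fix x assume x: "x \<in> carrier L"
  obtain C where C: "\<And>(S :: int set) f y n. \<lbrakk>finite S; \<And>m. f m \<in> component m; y \<in> carrier L\<rbrakk>
    \<Longrightarrow> C (\<Oplus>\<^bsub>L\<^esub>m\<in>S. f m) y n = (if n \<in> S then f n \<cdot> y else \<zero>\<^bsub>L\<^esub>)"
    using component_extract by blast
  have unit: "y \<cdot> p (verts G) = y" if "y \<in> component m" for y m
    using that
    by (rule component_right_id)
      (use assms in \<open>auto simp: mult_assoc p_verts left_words_closed right_words_closed\<close>)
  show "\<exists>!f. (\<forall>m. f m \<in> component m) \<and> finite {m. f m \<noteq> \<zero>\<^bsub>L\<^esub>} \<and>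
    x = (\<Oplus>\<^bsub>L\<^esub>m\<in>{m. f m \<noteq> \<zero>\<^bsub>L\<^esub>}. f m)"
  proof (rule ex_ex1I)
    obtain S f where S: "finite S" and f: "\<And>m. f m \<in> component m"
      and S0: "\<And>m. m \<notin> S \<Longrightarrow> f m = \<zero>\<^bsub>L\<^esub>" and eq: "x = (\<Oplus>\<^bsub>L\<^esub>m\<in>S. f m)"
      using component_decomposition[OF x] by blast
    have supp: "{m. f m \<noteq> \<zero>\<^bsub>L\<^esub>} \<subseteq> S"
      using S0 by blast
    have "x = (\<Oplus>\<^bsub>L\<^esub>m\<in>{m. f m \<noteq> \<zero>\<^bsub>L\<^esub>}. f m)"
      unfolding eq using S supp subsetD[OF component_closed f]
      by (intro M.add.finprod_mono_neutral_cong_right) auto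
    then show "\<exists>f. (\<forall>m. f m \<in> component m) \<and> finite {m. f m \<noteq> \<zero>\<^bsub>L\<^esub>} \<and>
        x = (\<Oplus>\<^bsub>L\<^esub>m\<in>{m. f m \<noteq> \<zero>\<^bsub>L\<^esub>}. f m)"
      using f supp S finite_subset by blast
  next
    \<comment> \<open>The right-hand side does not mention the decomposition, so two decompositions
      of \<open>x\<close> agree in every degree.\<close>
    have uniq: "f n = C x (p (verts G)) n"
      if "(\<forall>m. f m \<in> component m) \<and> finite {m. f m \<noteq> \<zero>\<^bsub>L\<^esub>} \<and> x = (\<Oplus>\<^bsub>L\<^esub>m\<in>{m. f m \<noteq> \<zero>\<^bsub>L\<^esub>}. f m)"
      for f n
    proof -
      have "C x (p (verts G)) n
          = (if n \<in> {m. f m \<noteq> \<zero>\<^bsub>L\<^esub>} then f n \<cdot> p (verts G) else \<zero>\<^bsub>L\<^esub>)"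
        using C[of "{m. f m \<noteq> \<zero>\<^bsub>L\<^esub>}" f "p (verts G)" n] that assms by auto
      moreover have "f n \<cdot> p (verts G) = f n"
        using unit[of "f n" n] that by blast
      ultimately show ?thesis by auto
    qed
    show "f = g"
      if "(\<forall>m. f m \<in> component m) \<and> finite {m. f m \<noteq> \<zero>\<^bsub>L\<^esub>} \<and> x = (\<Oplus>\<^bsub>L\<^esub>m\<in>{m. f m \<noteq> \<zero>\<^bsub>L\<^esub>}. f m)"
        "(\<forall>m. g m \<in> component m) \<and> finite {m. g m \<noteq> \<zero>\<^bsub>L\<^esub>} \<and> x = (\<Oplus>\<^bsub>L\<^esub>m\<in>{m. g m \<noteq> \<zero>\<^bsub>L\<^esub>}. g m)"
      for f g
      by (rule ext) (simp only: uniq[OF that(1)] uniq[OF that(2)])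
  qed
qed (auto intro: additive_subgroup_component component_mult)

end

section \<open>Vertex projections are nonzero\<close>

lemma countable_bij_betw:
  assumes "countable A" "infinite A" "countable B" "infinite B"
  shows "\<exists>f. bij_betw f A B"
  using bij_betw_trans[OF to_nat_on_infinite[OF assms(1,2)] bij_betw_from_nat_into[OF assms(3,4)]]
  by blast

text \<open>A branching system: over each vertex \<open>v\<close> lie the points \<open>(v, n)\<close>, which are divided into
  infinite pieces, one for each edge \<open>e\<close> starting in \<open>v\<close>. The piece of \<open>e\<close> is in bijection with
  the points over the range of \<open>e\<close>, as both are countably infinite.\<close>

definition branch_edges :: "('v, 'e) ultragraph \<Rightarrow> 'v \<Rightarrow> 'e set" where
  "branch_edges G v = {e \<in> edges G. src G e = v}"

text \<open>The second coordinate codes a pair of numbers. Its first entry selects an edge at the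
  vertex through \<open>from_nat_into\<close>, which repeats values if there are only finitely many
  edges; its second entry is free and makes each piece infinite. Every point selects exactly one
  edge, whence disjointness.\<close>

definition branch :: "('v, 'e) ultragraph \<Rightarrow> 'e \<Rightarrow> ('v \<times> nat) set" where
  "branch G e = {x. fst x = src G e \<and>
     from_nat_into (branch_edges G (fst x)) (fst (prod_decode (snd x))) = e}"

definition over :: "'v set \<Rightarrow> ('v \<times> nat) set" where
  "over A = {x. fst x \<in> A}"

lemma infinite_over: "A \<noteq> {} \<Longrightarrow> infinite (over A)"
proof -
  assume "A \<noteq> {}"
  then obtain v where "v \<in> A" by blast
  then have "range (\<lambda>n. (v, n)) \<subseteq> over A"
    by (auto simp: over_def)
  moreover have "infinite (range (\<lambda>n :: nat. (v, n)))"
    by (rule range_inj_infinite) (simp add: inj_on_def)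
  ultimately show ?thesis
    using finite_subset by blast
qed

lemma countable_over: "countable A \<Longrightarrow> countable (over A)"
proof -
  have "over A = A \<times> UNIV" by (auto simp: over_def)
  then show "countable A \<Longrightarrow> countable (over A)" by simp
qed

lemma countable_branch: "countable (branch G e)"
  by (rule countable_subset[of _ "{src G e} \<times> UNIV"]) (auto simp: branch_def)

lemma infinite_branch:
  assumes "is_ultragraph G" "e \<in> edges G"
  shows "infinite (branch G e)"
proof -
  let ?E = "branch_edges G (src G e)"
  have "countable ?E" "e \<in> ?E"
    using assms by (auto simp: is_ultragraph_def branch_edges_def)
  \<comment> \<open>Fixing the index of \<open>e\<close> and varying the free entry of the pair
    gives infinitely many points.\<close>
  then have "range (\<lambda>m. (src G e, prod_encode (to_nat_on ?E e, m))) \<subseteq> branch G e"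
    by (auto simp: branch_def)
  moreover have "infinite (range (\<lambda>m. (src G e, prod_encode (to_nat_on ?E e, m))))"
    by (rule range_inj_infinite) (simp add: inj_on_def)
  ultimately show ?thesis
    using finite_subset by blast
qed

lemma branch_bij:
  assumes "is_ultragraph G" "e \<in> edges G"
  shows "\<exists>f. bij_betw f (over (rng G e)) (branch G e)"
proof -
  have "rng G e \<subseteq> verts G" "rng G e \<noteq> {}" "countable (verts G)"
    using assms by (auto simp: is_ultragraph_def)
  then show ?thesis
    using assms
    by (intro countable_bij_betw countable_over infinite_over countable_branch infinite_branch)
      (auto intro: countable_subset)
qed

lemma branch_disjoint: "\<lbrakk>x \<in> branch G e; x \<in> branch G f\<rbrakk> \<Longrightarrow> e = f"
  by (auto simp: branch_def)

lemma branch_cover: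
  "{e \<in> edges G. src G e = fst x} \<noteq> {} \<Longrightarrow> \<exists>e\<in>edges G. src G e = fst x \<and> x \<in> branch G e"
  using from_nat_into[of "branch_edges G (fst x)" "fst (prod_decode (snd x))"]
  by (auto simp: branch_def branch_edges_def)

context leavitt_algebra
begin

declare split_paired_All [simp del] split_paired_Ex [simp del]

section \<open>The representation on functions over the branching system\<close>

abbreviation funs :: "('r, 'v \<times> nat \<Rightarrow> 'r) module" where
  "funs \<equiv> fun_module (self_module R)"

definition branch_map where
  "branch_map e = (SOME f. bij_betw f (over (rng G e)) (branch G e))"

lemma branch_map_bij: "e \<in> edges G \<Longrightarrow> bij_betw (branch_map e) (over (rng G e)) (branch G e)"
  unfolding branch_map_def by (rule someI_ex[OF branch_bij[OF ultragraph]])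

definition branch_inv where
  "branch_inv e = the_inv_into (over (rng G e)) (branch_map e)"

lemma branch_map:
  assumes "e \<in> edges G"
  shows "x \<in> over (rng G e) \<Longrightarrow> branch_map e x \<in> branch G e"
    and "x \<in> over (rng G e) \<Longrightarrow> branch_inv e (branch_map e x) = x"
    and "y \<in> branch G e \<Longrightarrow> branch_inv e y \<in> over (rng G e)"
    and "y \<in> branch G e \<Longrightarrow> branch_map e (branch_inv e y) = y"
  using branch_map_bij[OF assms] unfolding branch_inv_def bij_betw_def
  by (auto simp: the_inv_into_f_f f_the_inv_into_f intro: the_inv_into_into)

text \<open>\<open>P_gen A\<close> restricts a function to the points over \<open>A\<close>.
  \<open>S_gen e\<close> transports a function from the points over the range of \<open>e\<close> to
  the piece of \<open>e\<close> and extends it by zero; \<open>Sstar_gen e\<close> transports it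
  back.\<close>

fun branch_op :: "('v, 'e) lpa_gen \<Rightarrow> ('v \<times> nat \<Rightarrow> 'r) \<Rightarrow> 'v \<times> nat \<Rightarrow> 'r" where
  "branch_op (P_gen A) = (\<lambda>f\<in>carrier funs. \<lambda>x. if fst x \<in> A then f x else \<zero>\<^bsub>R\<^esub>)"
| "branch_op (S_gen e) = (\<lambda>f\<in>carrier funs. \<lambda>x. if x \<in> branch G e then f (branch_inv e x) else \<zero>\<^bsub>R\<^esub>)"
| "branch_op (Sstar_gen e) = (\<lambda>f\<in>carrier funs. \<lambda>x. if fst x \<in> rng G e then f (branch_map e x) else \<zero>\<^bsub>R\<^esub>)"

lemma module_funs: "module R funs"
  by (rule module.module_fun[OF R.module_self])

lemma algebra_end_funs: "nonunital_algebra R (lin_end R funs)"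
  by (rule module.nonunital_algebra_lin_end[OF module_funs])

lemma branch_op_closed: "branch_op \<in> lpa_gens G \<rightarrow> carrier (lin_end R funs)"
proof
  fix g show "branch_op g \<in> carrier (lin_end R funs)"
    by (cases g) (auto simp: lin_end_carrier fun_module_simps)
qed

text \<open>An edge followed by its ghost acts as restriction to its piece. Since the pieces of
  distinct edges are disjoint, the sum restricts to their union and counts no point twice.\<close>

lemma eval_branch_CK:
  assumes "set es \<subseteq> edges G" "distinct es" "f \<in> carrier funs"
  shows "eval_expr (lin_end R funs) branch_op
      (foldr Add (map (\<lambda>e. Mult (Gen (S_gen e)) (Gen (Sstar_gen e))) es) Zero) f
    = (\<lambda>x. if \<exists>e\<in>set es. x \<in> branch G e then f x else \<zero>\<^bsub>R\<^esub>)"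
  using assms(1,2)
proof (induction es)
  case Nil
  then show ?case using assms(3) by (simp add: lin_end_apply fun_module_simps)
next
  case (Cons e es)
  have "(\<lambda>x. if fst x \<in> rng G e then f (branch_map e x) else \<zero>\<^bsub>R\<^esub>) \<in> carrier funs"
    using assms(3) by (simp add: fun_module_simps)
  then show ?case
    using Cons assms(3) branch_map(3,4)[of e]
    by (auto simp: lin_end_apply fun_module_simps fun_eq_iff over_def dest: branch_disjoint)
qed

lemma branch_op_rels:
  assumes "(x, y) \<in> lpa_rels G" "x \<in> terms" "y \<in> terms"
  shows "eval_expr (lin_end R funs) branch_op x = eval_expr (lin_end R funs) branch_op y"
proof (rule lin_end_eqI)
  fix f assume f: "f \<in> carrier funs"
  then have fc: "f i \<in> carrier R" for i
    by (simp add: fun_module_simps)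
  show "eval_expr (lin_end R funs) branch_op x f = eval_expr (lin_end R funs) branch_op y f"
    using assms(1)
  proof cases
    case P_empty
    then show ?thesis using f by (simp add: lin_end_apply fun_module_simps)
  next
    case (P_mult A B)
    then show ?thesis
      using f fc by (auto simp: lin_end_apply fun_module_simps fun_eq_iff)
  next
    case (P_union A B)
    have op: "branch_op (P_gen (A \<inter> B)) \<in> carrier (lin_end R funs)"
      by (rule funcset_mem[OF branch_op_closed]) (simp add: P_union gen_verts_Int)
    have "(\<lambda>x. if fst x \<in> A \<inter> B then f x else \<zero>\<^bsub>R\<^esub>) \<in> carrier funs"
      using fc by (simp add: fun_module_simps)
    from module.fun_module_uminus[OF R.module_self this] show ?thesis
      using P_union f fc module.lin_end_uminus_apply[OF module_funs op f]
      by (auto simp: lin_end_apply fun_module_simps fun_eq_iff R.a_assoc R.r_neg R.self_module_uminus)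
  next
    case (src_S e)
    then show ?thesis
      using f fc by (auto simp: lin_end_apply fun_module_simps fun_eq_iff branch_def)
  next
    case (S_rng e)
    then show ?thesis
      using f fc branch_map(3)[of e] by (auto simp: lin_end_apply fun_module_simps fun_eq_iff over_def)
  next
    case (rng_Sstar e)
    then show ?thesis
      using f fc by (auto simp: lin_end_apply fun_module_simps fun_eq_iff)
  next
    case (Sstar_src e)
    then show ?thesis
      using f fc branch_map(1)[of e]
      by (auto simp: lin_end_apply fun_module_simps fun_eq_iff over_def branch_def)
  next
    case (Sstar_S d e)
    \<comment> \<open>Pulling back along \<open>d\<close> a function supported on the piece of
      another edge gives zero.\<close>
    then have "branch_map d i \<notin> branch G e" if "d \<noteq> e" "fst i \<in> rng G d" for i
      using that branch_map(1)[of d i] branch_disjoint[of "branch_map d i" G d e]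
      by (auto simp: over_def)
    then show ?thesis
      using Sstar_S f fc branch_map(1,2)[of d]
      by (auto simp: lin_end_apply fun_module_simps fun_eq_iff over_def)
  next
    case (CK v es)
    \<comment> \<open>The pieces of the edges starting in \<open>v\<close> exhaust the points over
      \<open>v\<close>. The relation is imposed only for nonempty \<open>es\<close>, so
      \<open>v\<close> does emit an edge, as \<open>branch_cover\<close> requires.\<close>
    have "fst x = v \<longleftrightarrow> (\<exists>e\<in>set es. x \<in> branch G e)" for x
    proof
      assume x: "fst x = v"
      have "{e \<in> edges G. src G e = fst x} \<noteq> {}"
        using CK x by (metis set_empty)
      then show "\<exists>e\<in>set es. x \<in> branch G e"
        using branch_cover[of G x] CK x by auto
    qed (use CK in \<open>auto simp: branch_def\<close>)
    then show ?thesis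
      using CK f by (auto simp: eval_branch_CK fun_eq_iff)
  qed
qed (use assms eval_expr_closed[OF algebra_end_funs branch_op_closed] in auto)

lemma p_nonzero:
  assumes "\<one>\<^bsub>R\<^esub> \<noteq> \<zero>\<^bsub>R\<^esub>" "v \<in> verts G"
  shows "p {v} \<noteq> \<zero>\<^bsub>L\<^esub>"
proof
  assume "p {v} = \<zero>\<^bsub>L\<^esub>"
  then have "cls (Gen (P_gen {v})) = cls Zero"
    by (simp add: cls_Gen cls_simps(2))
  then have "(Gen (P_gen {v}), Zero) \<in> pres_cong R (lpa_gens G) (lpa_rels G)"
    using assms(2) by (subst pcls_eq_iff[OF cring, symmetric]) (simp_all add: cls_simps(6-))
  then have "eval_expr (lin_end R funs) branch_op (Gen (P_gen {v})) = eval_expr (lin_end R funs) branch_op Zero"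
    by (rule presented_universal[OF algebra_end_funs branch_op_closed, rotated])
      (rule branch_op_rels)
  \<comment> \<open>Restricting the constant function 1 to the points over \<open>v\<close>
    preserves its value at \<open>(v, 0)\<close>, whereas zero annihilates it.\<close>
  then have "(branch_op (P_gen {v})) (\<lambda>_. \<one>\<^bsub>R\<^esub>) (v, 0) = \<zero>\<^bsub>lin_end R funs\<^esub> (\<lambda>_. \<one>\<^bsub>R\<^esub>) (v, 0)"
    by simp
  then show False
    using assms(1) by (simp add: lin_end_apply fun_module_simps)
qed

end

section \<open>Identity elements\<close>

context leavitt_algebra
begin

section \<open>Products of two components and the finiteness of their support\<close>

definition products where
  "products m n = {x \<cdot> y | x y. x \<in> component m \<and> y \<in> component n}"

lemma products_closed: "products m n \<subseteq> carrier L"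
  using component_closed by (auto simp: products_def subset_iff)

lemma sums_of_products_component:
  "sums_of_products L (component m) (component n) = lin_span R L (products m n)"
  unfolding products_def
  by (rule sums_of_products_eq_lin_span) (use component_closed component_smult in auto)

lemma products_span_base:
  "\<lbrakk>x \<in> component m; y \<in> component n\<rbrakk> \<Longrightarrow> x \<cdot> y \<in> lin_span R L (products m n)"
  by (rule lin_span_base[OF _ products_closed]) (auto simp: products_def)

text \<open>Outer factors are absorbed into the two factors of each product. This builds new
  elements of such spans from old ones: \<open>s e\<close> and \<open>t e\<close> raise the length
  of path idempotents, and degree 0 factors produce intersections.\<close>

lemma products_span_mult:
  assumes "a \<in> component k" "b \<in> component l" "x \<in> lin_span R L (products m n)"
  shows "a \<cdot> x \<cdot> b \<in> lin_span R L (products (k + m) (n + l))"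
proof -
  have ab: "a \<in> carrier L" "b \<in> carrier L"
    using assms component_closed by blast+
  show ?thesis
    using assms(3) products_closed
  proof (induction rule: lin_span_induct)
    case zero
    then show ?case using ab by (simp add: lin_span_zero)
  next
    case (step c x y)
    obtain u v where uv: "x = u \<cdot> v" "u \<in> component m" "v \<in> component n"
      using step by (auto simp: products_def)
    have c: "u \<in> carrier L" "v \<in> carrier L"
      using uv component_closed by blast+
    have "a \<cdot> (c \<odot>\<^bsub>L\<^esub> x \<oplus>\<^bsub>L\<^esub> y) \<cdot> b = c \<odot>\<^bsub>L\<^esub> ((a \<cdot> u) \<cdot> (v \<cdot> b)) \<oplus>\<^bsub>L\<^esub> a \<cdot> y \<cdot> b"
      using step ab c uv(1)
      by (simp add: l_distrib r_distrib smult_mult_left smult_mult_right mult_assoc)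
    then show ?case
      using step uv assms
      by (auto intro!: lin_span_add lin_span_smult products_closed products_span_base component_mult)
  qed
qed

text \<open>Only finitely many spanning elements occur in \<open>x\<close>, and the union of their
  sets serves all of them, because \<open>p (A \<union> B)\<close> absorbs both \<open>p A\<close>
  and \<open>p B\<close>.\<close>

lemma span_local_unit:
  assumes "x \<in> lin_span R L X" "X \<subseteq> carrier L"
    and X: "\<And>x. x \<in> X \<Longrightarrow> \<exists>A\<in>gen_verts G. p A \<cdot> x = x"
  shows "\<exists>A\<in>gen_verts G. p A \<cdot> x = x"
  using assms(1,2)
proof (induction rule: lin_span_induct)
  case zero
  then show ?case by (intro bexI[of _ "{}"]) simp_all
next
  case (step c x y)
  obtain A B where AB: "A \<in> gen_verts G" "p A \<cdot> x = x" "B \<in> gen_verts G" "p B \<cdot> y = y"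
    using X[of x] step by blast
  have C: "A \<union> B \<in> gen_verts G"
    using AB gen_verts_Un by blast
  have x: "x \<in> carrier L" using step assms(2) by blast
  have "p (A \<union> B) \<cdot> x = p (A \<union> B) \<cdot> p A \<cdot> x" "p (A \<union> B) \<cdot> y = p (A \<union> B) \<cdot> p B \<cdot> y"
    using AB C x step by (simp_all add: mult_assoc del: p_mult)
  moreover have "p (A \<union> B) \<cdot> p A = p A" "p (A \<union> B) \<cdot> p B = p B"
    using AB C by (simp_all add: Int_absorb1)
  ultimately have "p (A \<union> B) \<cdot> x = x" "p (A \<union> B) \<cdot> y = y"
    using AB by simp_all
  then show ?case
    using C x step by (intro bexI[of _ "A \<union> B"]) (simp_all add: r_distrib smult_mult_right)
qed

text \<open>Only the first letter of a monomial matters: a projection \<open>p A\<close> absorbs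
  itself, and \<open>s e\<close> absorbs the projection of its source.\<close>

lemma component_local_unit:
  assumes "x \<in> component m"
  shows "\<exists>A\<in>gen_verts G. p A \<cdot> x = x"
  using assms unfolding component_def
proof (rule span_local_unit[OF _ monomials_closed])
  fix x assume "x \<in> monomials m"
  then obtain i j u v where uv: "x = u \<cdot> v" "u \<in> left_words i" "v \<in> right_words j"
    "int i - int j = m" "u \<in> carrier L" "v \<in> carrier L"
    by (rule monomialsE)
  have "\<exists>A\<in>gen_verts G. p A \<cdot> u = u"
  proof (cases i)
    case 0
    then consider "u = \<zero>\<^bsub>L\<^esub>" | A where "A \<in> gen_verts G" "u = p A"
      using uv by auto
    then show ?thesis
    proof cases
      case 1
      then show ?thesis by (intro bexI[of _ "{}"]) simp_all
    next
      case (2 A)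
      then show ?thesis by (intro bexI[of _ A]) simp_all
    qed
  next
    case (Suc k)
    then consider "u = \<zero>\<^bsub>L\<^esub>" | e u' where "e \<in> edges G" "u' \<in> left_words k" "u = s e \<cdot> u'"
      using uv by auto
    then show ?thesis
    proof cases
      case 1
      then show ?thesis by (intro bexI[of _ "{}"]) simp_all
    next
      case (2 e u')
      then show ?thesis
        by (intro bexI[of _ "{src G e}"]) (simp_all add: left_words_closed flip: mult_assoc)
    qed
  qed
  then show "\<exists>A\<in>gen_verts G. p A \<cdot> x = x"
    using uv by (auto simp flip: mult_assoc intro!: bexI)
qed

lemma products_span_local_unit:
  assumes "x \<in> lin_span R L (products m n)"
  shows "\<exists>A\<in>gen_verts G. p A \<cdot> x = x"
  using assms
proof (rule span_local_unit[OF _ products_closed])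
  fix x assume "x \<in> products m n"
  then obtain y z where "x = y \<cdot> z" "y \<in> component m" "z \<in> component n" "y \<in> carrier L" "z \<in> carrier L"
    using component_closed by (auto simp: products_def)
  then show "\<exists>A\<in>gen_verts G. p A \<cdot> x = x"
    using component_local_unit[of y m] by (auto simp flip: mult_assoc intro!: bexI)
qed

lemma span_finite_edges:
  assumes "x \<in> lin_span R L X" "X \<subseteq> carrier L"
    and X: "\<And>x. x \<in> X \<Longrightarrow> \<exists>F. finite F \<and> (\<forall>e\<in>edges G - F. t e \<cdot> x = \<zero>\<^bsub>L\<^esub>)"
  shows "\<exists>F. finite F \<and> (\<forall>e\<in>edges G - F. t e \<cdot> x = \<zero>\<^bsub>L\<^esub>)"
  using assms(1,2)
proof (induction rule: lin_span_induct)
  case zero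
  then show ?case by (intro exI[of _ "{}"]) simp
next
  case (step c x y)
  obtain E F where "finite E" "\<forall>e\<in>edges G - E. t e \<cdot> x = \<zero>\<^bsub>L\<^esub>"
    "finite F" "\<forall>e\<in>edges G - F. t e \<cdot> y = \<zero>\<^bsub>L\<^esub>"
    using X[of x] step by blast
  moreover have "x \<in> carrier L" using step assms(2) by blast
  ultimately show ?case
    using step by (intro exI[of _ "E \<union> F"]) (simp add: r_distrib smult_mult_right)
qed

text \<open>In positive degree every monomial has a nonempty left word, so it is zero or begins with
  some \<open>s e\<close> and is killed by \<open>t f\<close> for all \<open>f\<close> other than
  \<open>e\<close>.\<close>

lemma component_finite_edges:
  assumes "x \<in> component m" "m > 0"
  shows "\<exists>F. finite F \<and> (\<forall>e\<in>edges G - F. t e \<cdot> x = \<zero>\<^bsub>L\<^esub>)"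
  using assms(1) unfolding component_def
proof (rule span_finite_edges[OF _ monomials_closed])
  fix x assume "x \<in> monomials m"
  then obtain i j u v where uv: "x = u \<cdot> v" "u \<in> left_words i" "v \<in> right_words j"
    "int i - int j = m" "u \<in> carrier L" "v \<in> carrier L"
    by (rule monomialsE)
  obtain k where "i = Suc k"
    using uv(4) assms(2) by (cases i) auto
  then consider "u = \<zero>\<^bsub>L\<^esub>" | e u' where "e \<in> edges G" "u' \<in> left_words k" "u = s e \<cdot> u'"
    using uv by auto
  then show "\<exists>F. finite F \<and> (\<forall>e\<in>edges G - F. t e \<cdot> x = \<zero>\<^bsub>L\<^esub>)"
  proof cases
    case 1
    then show ?thesis using uv by (intro exI[of _ "{}"]) simp
  next
    case (2 e u')
    have "t f \<cdot> x = \<zero>\<^bsub>L\<^esub>" if "f \<in> edges G - {e}" for f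
    proof -
      have "t f \<cdot> x = t f \<cdot> s e \<cdot> (u' \<cdot> v)"
        using 2 uv that by (simp add: mult_assoc left_words_closed)
      then show ?thesis
        using 2 uv that by (auto simp: t_s left_words_closed)
    qed
    then show ?thesis by blast
  qed
qed

lemma products_span_finite_edges:
  assumes "x \<in> lin_span R L (products m n)" "m > 0"
  shows "\<exists>F. finite F \<and> (\<forall>e\<in>edges G - F. t e \<cdot> x = \<zero>\<^bsub>L\<^esub>)"
  using assms(1)
proof (rule span_finite_edges[OF _ products_closed])
  fix x assume "x \<in> products m n"
  then obtain y z where yz: "x = y \<cdot> z" "y \<in> component m" "z \<in> component n" "y \<in> carrier L" "z \<in> carrier L"
    using component_closed by (auto simp: products_def)
  obtain F where F: "finite F" "\<forall>e\<in>edges G - F. t e \<cdot> y = \<zero>\<^bsub>L\<^esub>"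
    using component_finite_edges[OF yz(2) assms(2)] by blast
  have "t e \<cdot> x = t e \<cdot> y \<cdot> z" if "e \<in> edges G" for e
    using yz that by (simp add: mult_assoc)
  then show "\<exists>F. finite F \<and> (\<forall>e\<in>edges G - F. t e \<cdot> x = \<zero>\<^bsub>L\<^esub>)"
    using F yz by (intro exI[of _ F]) auto
qed

section \<open>Necessity of the two finiteness conditions\<close>

lemma verts_gen_verts:
  assumes "\<one>\<^bsub>R\<^esub> \<noteq> \<zero>\<^bsub>R\<^esub>" "\<epsilon> \<in> lin_span R L (products 0 0)"
    and \<epsilon>: "\<And>x. x \<in> component 0 \<Longrightarrow> \<epsilon> \<cdot> x = x"
  shows "verts G \<in> gen_verts G"
proof -
  obtain A where A: "A \<in> gen_verts G" "p A \<cdot> \<epsilon> = \<epsilon>"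
    using products_span_local_unit[OF assms(2)] by blast
  have \<epsilon>c: "\<epsilon> \<in> carrier L"
    using assms(2) lin_span_closed[OF products_closed] by blast
  have "v \<in> A" if v: "v \<in> verts G" for v
  proof (rule ccontr)
    assume "v \<notin> A"
    have "\<epsilon> \<cdot> p {v} = p {v}"
      using \<epsilon> gen_component[of "P_gen {v}"] v by simp
    then have "p {v} = p A \<cdot> \<epsilon> \<cdot> p {v}"
      using A by simp
    also have "\<dots> = p A \<cdot> p {v}"
      using A(1) \<epsilon>c v \<open>\<epsilon> \<cdot> p {v} = p {v}\<close> by (simp add: mult_assoc del: p_mult)
    also have "\<dots> = \<zero>\<^bsub>L\<^esub>"
      using A v \<open>v \<notin> A\<close> by simp
    finally show False
      using p_nonzero[OF assms(1) v] by simp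
  qed
  then have "verts G = A"
    using gen_verts_subset[OF ultragraph A(1)] by (intro subset_antisym subsetI) (auto dest: subsetD)
  then show ?thesis using A by simp
qed

lemma finite_edges:
  assumes "\<one>\<^bsub>R\<^esub> \<noteq> \<zero>\<^bsub>R\<^esub>" "\<epsilon> \<in> lin_span R L (products 1 n)"
    and \<epsilon>: "\<And>x. x \<in> component 1 \<Longrightarrow> \<epsilon> \<cdot> x = x"
  shows "finite (edges G)"
proof -
  obtain F where F: "finite F" "\<And>e. e \<in> edges G - F \<Longrightarrow> t e \<cdot> \<epsilon> = \<zero>\<^bsub>L\<^esub>"
    using products_span_finite_edges[OF assms(2)] by auto
  have \<epsilon>c: "\<epsilon> \<in> carrier L"
    using assms(2) lin_span_closed[OF products_closed] by blast
  have "e \<in> F" if e: "e \<in> edges G" for e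
  proof (rule ccontr)
    assume "e \<notin> F"
    have "\<epsilon> \<cdot> s e = s e"
      using \<epsilon> gen_component[of "S_gen e"] e by simp
    \<comment> \<open>The product of \<open>t e\<close>, \<open>\<epsilon>\<close> and
      \<open>s e\<close> is computed twice: absorbing \<open>\<epsilon>\<close> into
      \<open>s e\<close> gives the range projection, while \<open>t e \<cdot> \<epsilon>\<close> is
      zero.\<close>
    then have "p (rng G e) = t e \<cdot> (\<epsilon> \<cdot> s e)"
      using e by (simp add: t_s)
    also have "\<dots> = \<zero>\<^bsub>L\<^esub>"
      using F(2)[of e] e \<open>e \<notin> F\<close> \<epsilon>c by (simp flip: mult_assoc)
    finally have "p (rng G e) = \<zero>\<^bsub>L\<^esub>" .
    have "rng G e \<in> Pow (verts G) - {{}}"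
      using ultragraph e by (auto simp: is_ultragraph_def simp del: Diff_iff)
    then obtain v where v: "v \<in> rng G e" "v \<in> verts G"
      by (auto simp flip: ex_in_conv)
    \<comment> \<open>Ranges are nonempty, so a vanishing range projection would force some vertex
      projection to vanish.\<close>
    have "p {v} = p (rng G e) \<cdot> p {v}"
      using e v by simp
    then show False
      using \<open>p (rng G e) = \<zero>\<^bsub>L\<^esub>\<close> v p_nonzero[OF assms(1) v(2)] by simp
  qed
  then have "edges G \<subseteq> F" by (rule subsetI)
  then show ?thesis by (rule finite_subset) (rule F(1))
qed

text \<open>For finitely many edges this is the sum of \<open>s_\<alpha> s_\<alpha>\<^sup>*\<close> over all paths \<open>\<alpha>\<close> of length \<open>n\<close>.\<close>

primrec path_idem where
  "path_idem 0 = p (verts G)"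
| "path_idem (Suc n) = (\<Oplus>\<^bsub>L\<^esub>e\<in>edges G. s e \<cdot> path_idem n \<cdot> t e)"

section \<open>Sufficiency: units of nonnegative degree\<close>

context
  assumes finite: "finite (edges G)" and verts: "verts G \<in> gen_verts G"
begin

lemma path_idem_span: "path_idem n \<in> lin_span R L (products (int n) (- int n))"
proof (induction n)
  case 0
  have "p (verts G) \<in> component 0"
    using gen_component[of "P_gen (verts G)"] verts by simp
  then have "p (verts G) \<cdot> p (verts G) \<in> lin_span R L (products 0 0)"
    by (intro products_span_base)
  then show ?case using verts by simp
next
  case (Suc n)
  have "s e \<cdot> path_idem n \<cdot> t e \<in> lin_span R L (products (1 + int n) (- int n + - 1))"
    if "e \<in> edges G" for e
    using gen_component[of "S_gen e"] gen_component[of "Sstar_gen e"] that Suc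
    by (intro products_span_mult) simp_all
  moreover have "1 + int n = int (Suc n)" "- int n + - 1 = - int (Suc n)"
    by simp_all
  ultimately show ?case
    unfolding path_idem.simps by (intro lin_span_finsum products_closed finite) (simp only:)
qed

lemma path_idem_closed: "path_idem n \<in> carrier L"
  using path_idem_span lin_span_closed[OF products_closed] by blast

text \<open>On a word beginning with \<open>s e\<close> only the summand of \<open>e\<close>
  survives. There \<open>t e \<cdot> s e\<close> becomes \<open>p (rng G e)\<close>, so the
  induction hypothesis is applied not to the rest \<open>u'\<close> of the word but to
  \<open>p (rng G e) \<cdot> u'\<close>.\<close>

lemma path_idem_left: "\<lbrakk>u \<in> left_words k; n \<le> k\<rbrakk> \<Longrightarrow> path_idem n \<cdot> u = u"
proof (induction n arbitrary: u k)
  case 0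
  then show ?case using p_verts(1)[OF verts] by simp
next
  case (Suc n)
  then obtain l where l: "k = Suc l" "n \<le> l"
    by (cases k) auto
  consider "u = \<zero>\<^bsub>L\<^esub>" | e u' where "e \<in> edges G" "u' \<in> left_words l" "u = s e \<cdot> u'"
    using Suc.prems l by auto
  then show ?case
  proof cases
    case (2 e u')
    have u': "u' \<in> carrier L" "p (rng G e) \<cdot> u' \<in> left_words l"
      using 2 left_words_closed p_left_words by simp_all
    have "path_idem (Suc n) \<cdot> u = (\<Oplus>\<^bsub>L\<^esub>f\<in>edges G. s f \<cdot> path_idem n \<cdot> t f \<cdot> u)"
      unfolding path_idem.simps
      by (rule sum_mult_right) (use finite 2 u' path_idem_closed in auto)
    also have "\<dots> = (\<Oplus>\<^bsub>L\<^esub>f\<in>edges G. if e = f then u else \<zero>\<^bsub>L\<^esub>)"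
    proof (rule M.finsum_cong')
      fix f assume f: "f \<in> edges G"
      have "s f \<cdot> path_idem n \<cdot> t f \<cdot> u = s f \<cdot> (path_idem n \<cdot> (t f \<cdot> s e \<cdot> u'))"
        using f 2 u' path_idem_closed by (simp add: mult_assoc)
      also have "\<dots> = (if e = f then u else \<zero>\<^bsub>L\<^esub>)"
      proof (cases "e = f")
        case True
        have "s e \<cdot> (path_idem n \<cdot> (p (rng G e) \<cdot> u')) = s e \<cdot> p (rng G e) \<cdot> u'"
          using Suc.IH[OF u'(2) l(2)] 2 u'(1) by (simp add: mult_assoc del: edge_rels)
        then show ?thesis
          using True 2 by (simp add: t_s)
      qed (use f 2 u' path_idem_closed in \<open>simp add: t_s\<close>)
      finally show "s f \<cdot> path_idem n \<cdot> t f \<cdot> u = (if e = f then u else \<zero>\<^bsub>L\<^esub>)" .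
    qed (use 2 u' in auto)
    also have "\<dots> = u"
      by (rule M.finsum_singleton) (use finite 2 u' in auto)
    finally show ?thesis .
  qed (simp add: path_idem_closed del: path_idem.simps)
qed

lemma path_idem_right: "\<lbrakk>v \<in> right_words k; n \<le> k\<rbrakk> \<Longrightarrow> v \<cdot> path_idem n = v"
proof (induction n arbitrary: v k)
  case 0
  then show ?case using p_verts(2)[OF verts] by simp
next
  case (Suc n)
  then obtain l where l: "k = Suc l" "n \<le> l"
    by (cases k) auto
  consider "v = \<zero>\<^bsub>L\<^esub>" | e v' where "e \<in> edges G" "v' \<in> right_words l" "v = v' \<cdot> t e"
    using Suc.prems l by auto
  then show ?case
  proof cases
    case (2 e v')
    have v': "v' \<in> carrier L" "v' \<cdot> p (rng G e) \<in> right_words l"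
      using 2 right_words_closed right_words_p by simp_all
    have "v \<cdot> path_idem (Suc n) = (\<Oplus>\<^bsub>L\<^esub>f\<in>edges G. v \<cdot> (s f \<cdot> path_idem n \<cdot> t f))"
      unfolding path_idem.simps
      by (rule sum_mult_left) (use finite 2 v' path_idem_closed in auto)
    also have "\<dots> = (\<Oplus>\<^bsub>L\<^esub>f\<in>edges G. if e = f then v else \<zero>\<^bsub>L\<^esub>)"
    proof (rule M.finsum_cong')
      fix f assume f: "f \<in> edges G"
      have "v \<cdot> (s f \<cdot> path_idem n \<cdot> t f) = v' \<cdot> (t e \<cdot> s f) \<cdot> path_idem n \<cdot> t f"
        using f 2 v' path_idem_closed by (simp add: mult_assoc)
      also have "\<dots> = (if e = f then v else \<zero>\<^bsub>L\<^esub>)"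
      proof (cases "e = f")
        case True
        have "v' \<cdot> p (rng G e) \<cdot> path_idem n \<cdot> t e = v' \<cdot> (p (rng G e) \<cdot> t e)"
          using Suc.IH[OF v'(2) l(2)] 2 v'(1) by (simp add: mult_assoc del: edge_rels)
        then show ?thesis
          using True 2 by (simp add: t_s)
      qed (use f 2 v' path_idem_closed in \<open>simp add: t_s\<close>)
      finally show "v \<cdot> (s f \<cdot> path_idem n \<cdot> t f) = (if e = f then v else \<zero>\<^bsub>L\<^esub>)" .
    qed (use 2 v' in auto)
    also have "\<dots> = v"
      by (rule M.finsum_singleton) (use finite 2 v' in auto)
    finally show ?thesis .
  qed (simp add: path_idem_closed del: path_idem.simps)
qed

section \<open>Sufficiency: units of negative degree\<close>

definition ranges :: "'v set" where
  "ranges = \<Union>(rng G ` edges G)"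

lemma ranges_gen_verts: "ranges \<in> gen_verts G"
  unfolding ranges_def using finite by (intro gen_verts.Union) auto

context
  assumes source_in_range: "\<And>e. e \<in> edges G \<Longrightarrow> \<exists>f\<in>edges G. src G e \<in> rng G f"
begin

lemma src_ranges: "e \<in> edges G \<Longrightarrow> src G e \<in> ranges"
  using source_in_range unfolding ranges_def by blast

lemma rng_ranges: "e \<in> edges G \<Longrightarrow> ranges \<inter> rng G e = rng G e" "e \<in> edges G \<Longrightarrow> rng G e \<inter> ranges = rng G e"
  unfolding ranges_def by (simp_all add: Int_absorb1 Int_absorb2 UN_upper)

text \<open>At the outer end the projection meets the source of an edge, and each source lies in
  some range by assumption.\<close>

lemma ranges_left_words: "u \<in> left_words (Suc k) \<Longrightarrow> p ranges \<cdot> u = u"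
  using ranges_gen_verts
  by (auto simp: p_s src_ranges left_words_closed simp flip: mult_assoc)

lemma right_words_ranges: "v \<in> right_words (Suc k) \<Longrightarrow> v \<cdot> p ranges = v"
  using ranges_gen_verts
  by (auto simp: t_p src_ranges right_words_closed mult_assoc)

lemma ranges_t: "e \<in> edges G \<Longrightarrow> p ranges \<cdot> t e = t e"
proof -
  assume e: "e \<in> edges G"
  then have "p ranges \<cdot> t e = p ranges \<cdot> p (rng G e) \<cdot> t e"
    using ranges_gen_verts by (simp add: mult_assoc del: p_mult)
  then show ?thesis
    using e ranges_gen_verts by (simp add: rng_ranges)
qed

lemma s_ranges: "e \<in> edges G \<Longrightarrow> s e \<cdot> p ranges = s e"
proof -
  assume e: "e \<in> edges G"
  then have "s e \<cdot> p ranges = s e \<cdot> (p (rng G e) \<cdot> p ranges)"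
    using ranges_gen_verts by (simp del: p_mult flip: mult_assoc)
  then show ?thesis
    using e ranges_gen_verts by (simp add: rng_ranges)
qed

lemma p_ranges_comm: "A \<in> gen_verts G \<Longrightarrow> p ranges \<cdot> p A = p A \<cdot> p ranges"
  using ranges_gen_verts by (simp add: Int_commute)

text \<open>At the inner end the projection commutes past \<open>p A\<close> and meets a ghost edge,
  whose range lies in \<open>ranges\<close>. At least one ghost edge is required: \<open>p A\<close>
  alone need not be fixed.\<close>

lemma ranges_right_words: "v \<in> right_words (Suc k) \<Longrightarrow> p ranges \<cdot> v = v"
proof (induction k arbitrary: v)
  case 0
  then consider "v = \<zero>\<^bsub>L\<^esub>" | e A where "e \<in> edges G" "A \<in> gen_verts G" "v = p A \<cdot> t e"
    by auto
  then show ?case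
  proof cases
    case (2 e A)
    then have "p ranges \<cdot> v = p A \<cdot> p ranges \<cdot> t e"
      using ranges_gen_verts p_ranges_comm[of A] by (simp del: p_mult flip: mult_assoc)
    then show ?thesis
      using 2 ranges_gen_verts ranges_t by (simp add: mult_assoc del: p_mult)
  qed (use ranges_gen_verts in simp)
next
  case (Suc k)
  consider "v = \<zero>\<^bsub>L\<^esub>" | e v' where "e \<in> edges G" "v' \<in> right_words (Suc k)" "v = v' \<cdot> t e"
    using Suc.prems by (subst (asm) right_words.simps) auto
  then show ?case
  proof cases
    case (2 e v')
    then show ?thesis
      using Suc.IH[OF 2(2)] right_words_closed[OF 2(2)] ranges_gen_verts
      by (simp del: right_words.simps flip: mult_assoc)
  qed (use ranges_gen_verts in simp)
qed

lemma left_words_ranges: "u \<in> left_words (Suc k) \<Longrightarrow> u \<cdot> p ranges = u"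
proof (induction k arbitrary: u)
  case 0
  then consider "u = \<zero>\<^bsub>L\<^esub>" | e A where "e \<in> edges G" "A \<in> gen_verts G" "u = s e \<cdot> p A"
    by auto
  then show ?case
  proof cases
    case (2 e A)
    then have "u \<cdot> p ranges = s e \<cdot> (p ranges \<cdot> p A)"
      using ranges_gen_verts p_ranges_comm[of A] by (simp add: mult_assoc del: p_mult)
    then show ?thesis
      using 2 ranges_gen_verts s_ranges by (simp del: p_mult flip: mult_assoc)
  qed (use ranges_gen_verts in simp)
next
  case (Suc k)
  consider "u = \<zero>\<^bsub>L\<^esub>" | e u' where "e \<in> edges G" "u' \<in> left_words (Suc k)" "u = s e \<cdot> u'"
    using Suc.prems by (subst (asm) left_words.simps) auto
  then show ?case
  proof cases
    case (2 e u')
    then show ?thesis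
      using Suc.IH[OF 2(2)] left_words_closed[OF 2(2)] ranges_gen_verts
      by (simp add: mult_assoc del: left_words.simps)
  qed (use ranges_gen_verts in simp)
qed

text \<open>Negative degree forces a nonempty right word. If the left word contains an edge, its
  source absorbs the projection; if it is a bare \<open>p A\<close>, the projection commutes past it
  and is absorbed by the right word.\<close>

lemma ranges_left:
  assumes "x \<in> component m" "m < 0"
  shows "p ranges \<cdot> x = x"
  using assms(1)
proof (rule component_left_id)
  fix i j u v assume uv: "u \<in> left_words i" "v \<in> right_words j" "int i - int j = m"
  have c: "u \<in> carrier L" "v \<in> carrier L"
    using uv left_words_closed right_words_closed by blast+
  obtain l where l: "j = Suc l"
    using uv(3) assms(2) by (cases j) auto
  have v: "p ranges \<cdot> v = v"
    using uv(2) unfolding l by (rule ranges_right_words)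
  show "p ranges \<cdot> (u \<cdot> v) = u \<cdot> v"
  proof (cases i)
    case 0
    then consider "u = \<zero>\<^bsub>L\<^esub>" | A where "A \<in> gen_verts G" "u = p A"
      using uv by auto
    then show ?thesis
    proof cases
      case (2 A)
      then have "p ranges \<cdot> (u \<cdot> v) = p A \<cdot> (p ranges \<cdot> v)"
        using ranges_gen_verts p_ranges_comm[of A] c by (simp del: p_mult flip: mult_assoc)
      then show ?thesis using v 2 by simp
    qed (use c ranges_gen_verts in simp)
  next
    case (Suc k)
    then show ?thesis
      using uv ranges_left_words[of u k] c ranges_gen_verts
      by (simp del: left_words.simps flip: mult_assoc)
  qed
qed (use ranges_gen_verts in simp)

lemma ranges_right:
  assumes "x \<in> component m" "m > 0"
  shows "x \<cdot> p ranges = x"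
  using assms(1)
proof (rule component_right_id)
  fix i j u v assume uv: "u \<in> left_words i" "v \<in> right_words j" "int i - int j = m"
  have c: "u \<in> carrier L" "v \<in> carrier L"
    using uv left_words_closed right_words_closed by blast+
  obtain l where l: "i = Suc l"
    using uv(3) assms(2) by (cases i) auto
  have u: "u \<cdot> p ranges = u"
    using uv(1) unfolding l by (rule left_words_ranges)
  show "u \<cdot> v \<cdot> p ranges = u \<cdot> v"
  proof (cases j)
    case 0
    then consider "v = \<zero>\<^bsub>L\<^esub>" | A where "A \<in> gen_verts G" "v = p A"
      using uv by auto
    then show ?thesis
    proof cases
      case (2 A)
      then have "u \<cdot> v \<cdot> p ranges = u \<cdot> p ranges \<cdot> p A"
        using ranges_gen_verts p_ranges_comm[of A] c by (simp add: mult_assoc del: p_mult)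
      then show ?thesis using u 2 by simp
    qed (use c ranges_gen_verts in simp)
  next
    case (Suc k)
    then show ?thesis
      using uv right_words_ranges[of v k] c ranges_gen_verts
      by (simp add: mult_assoc del: right_words.simps)
  qed
qed (use ranges_gen_verts in simp)

text \<open>Extending \<open>e\<close> backwards gives paths of any length with the same range as \<open>e\<close>.\<close>

lemma p_rng_product:
  "e \<in> edges G \<Longrightarrow> \<exists>a b. a \<in> component (- int (Suc k)) \<and> b \<in> component (int (Suc k)) \<and> a \<cdot> b = p (rng G e)"
proof (induction k arbitrary: e)
  case 0
  then show ?case
    using gen_component[of "S_gen e"] gen_component[of "Sstar_gen e"]
    by (intro exI[of _ "t e"] exI[of _ "s e"]) (simp add: t_s)
next
  case (Suc k)
  obtain f where f: "f \<in> edges G" "src G e \<in> rng G f"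
    using source_in_range Suc.prems by blast
  obtain a b where ab: "a \<in> component (- int (Suc k))" "b \<in> component (int (Suc k))"
    "a \<cdot> b = p (rng G f)"
    using Suc.IH[OF f(1)] by blast
  have c: "a \<in> carrier L" "b \<in> carrier L"
    using ab component_closed by blast+
  have "t e \<cdot> a \<in> component (- int (Suc (Suc k)))"
    using component_mult[OF gen_component[of "Sstar_gen e"] ab(1)] Suc.prems by simp
  moreover have "b \<cdot> s e \<in> component (int (Suc (Suc k)))"
    using component_mult[OF ab(2) gen_component[of "S_gen e"]] Suc.prems by (simp add: add_ac)
  \<comment> \<open>The middle product \<open>a \<cdot> b\<close> is \<open>p (rng G f)\<close>,
    which fixes \<open>s e\<close> because \<open>f\<close> was chosen with the source of
    \<open>e\<close> in its range.\<close>
  moreover have "t e \<cdot> a \<cdot> (b \<cdot> s e) = p (rng G e)"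
  proof -
    have "t e \<cdot> a \<cdot> (b \<cdot> s e) = t e \<cdot> ((a \<cdot> b) \<cdot> s e)"
      using c Suc.prems by (simp add: mult_assoc)
    then show ?thesis
      using Suc.prems f ab(3) by (simp add: p_s t_s)
  qed
  ultimately show ?case by blast
qed

text \<open>Range projections lie in the span by \<open>p_rng_product\<close>; inclusion-exclusion
  then adds one range at a time.\<close>

lemma p_ranges_span: "p ranges \<in> lin_span R L (products (- int (Suc k)) (int (Suc k)))"
proof -
  let ?P = "lin_span R L (products (- int (Suc k)) (int (Suc k)))"
  have "\<Union>(rng G ` F) \<in> gen_verts G \<and> p (\<Union>(rng G ` F)) \<in> ?P" if "F \<subseteq> edges G" for F
    using finite_subset[OF that finite] that
  proof (induction F rule: finite_induct)
    case empty
    then show ?case by (simp add: lin_span_zero)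
  next
    case (insert e F)
    let ?A = "rng G e" and ?B = "\<Union>(rng G ` F)"
    have AB: "?A \<in> gen_verts G" "?B \<in> gen_verts G" "p ?B \<in> ?P"
      using insert by auto
    have A: "p ?A \<in> ?P"
      using p_rng_product[of e k] insert.prems products_span_base by fastforce
    \<comment> \<open>The middle \<open>p ?B\<close> is the element of the span, and the outer
      factors have degree 0, so the degrees are unchanged and the intersection term stays in the
      span.\<close>
    have "p ?A \<cdot> p ?B \<cdot> p ?B \<in> lin_span R L (products (0 + - int (Suc k)) (int (Suc k) + 0))"
      using gen_component[of "P_gen ?A"] gen_component[of "P_gen ?B"] AB
      by (intro products_span_mult) simp_all
    then have "p (?A \<inter> ?B) \<in> ?P"
      using AB gen_verts_Int[of ?A G ?B] by (simp add: Int_assoc)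
    then have "p (?A \<union> ?B) \<in> ?P"
      using A AB by (simp add: p_union lin_span_add lin_span_uminus products_closed)
    then show ?case
      using gen_verts_Un[OF AB(1,2)] by simp
  qed
  then show ?thesis
    unfolding ranges_def by blast
qed

definition graded_unit :: "int \<Rightarrow> (('v, 'e) lpa_gen, 'r) alg_expr set" where
  "graded_unit n = (if n \<ge> 0 then path_idem (nat n) else p ranges)"

lemma graded_unit_span: "graded_unit n \<in> lin_span R L (products n (- n))"
proof (cases "n \<ge> 0")
  case False
  \<comment> \<open>\<open>p_ranges_span\<close> treats length \<open>Suc k\<close>, so degree
    \<open>n\<close> corresponds to \<open>k = -n - 1\<close>.\<close>
  then have "n = - int (Suc (nat (- n) - 1))"
    by simp
  then show ?thesis
    using p_ranges_span[of "nat (- n) - 1"] False unfolding graded_unit_def by simp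
qed (use path_idem_span[of "nat n"] in \<open>simp add: graded_unit_def\<close>)

text \<open>For \<open>n \<ge> 0\<close>, \<open>i - j = n\<close> gives \<open>i \<ge> n\<close>,
  so the left word is long enough for \<open>path_idem_left\<close>.\<close>

lemma graded_unit_left: "x \<in> component n \<Longrightarrow> graded_unit n \<cdot> x = x"
proof (cases "n \<ge> 0")
  case True
  assume "x \<in> component n"
  then show ?thesis
  proof (rule component_left_id)
    fix i j u v assume "u \<in> left_words i" "v \<in> right_words j" "int i - int j = n"
    then show "graded_unit n \<cdot> (u \<cdot> v) = u \<cdot> v"
      using True path_idem_left[of u i "nat n"]
      by (simp add: graded_unit_def left_words_closed right_words_closed path_idem_closed
          flip: mult_assoc)
  qed (use True path_idem_closed in \<open>simp add: graded_unit_def\<close>)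
qed (simp add: graded_unit_def ranges_left)

text \<open>For \<open>n \<le> 0\<close> the right word has length at least \<open>-n\<close>, which
  is the length of the path idempotent on the right. For \<open>n > 0\<close> the index
  \<open>-n\<close> is negative and the unit is \<open>p ranges\<close>.\<close>

lemma graded_unit_right: "x \<in> component n \<Longrightarrow> x \<cdot> graded_unit (- n) = x"
proof (cases "n \<le> 0")
  case True
  assume "x \<in> component n"
  then show ?thesis
  proof (rule component_right_id)
    fix i j u v assume "u \<in> left_words i" "v \<in> right_words j" "int i - int j = n"
    then show "u \<cdot> v \<cdot> graded_unit (- n) = u \<cdot> v"
      using True path_idem_right[of v j "nat (- n)"]
      by (simp add: graded_unit_def left_words_closed right_words_closed path_idem_closed
          mult_assoc)
  qed (use True path_idem_closed in \<open>simp add: graded_unit_def\<close>)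
qed (simp add: graded_unit_def ranges_right)

lemma epsilon_strongly_graded_leavitt: "epsilon_strongly_graded L component"
  unfolding epsilon_strongly_graded_iff sums_of_products_component
  using graded_ring_leavitt[OF verts] graded_unit_span graded_unit_left graded_unit_right by blast

end

end

end

theorem proposition5p5:
  fixes R :: "('r, 'm) ring_scheme" and G :: "('v, 'e) ultragraph"
  assumes "cring R" and "\<one>\<^bsub>R\<^esub> \<noteq> \<zero>\<^bsub>R\<^esub>" and "is_ultragraph G"
  shows "(epsilon_strongly_graded (leavitt R G) (leavitt_component R G) \<longrightarrow>
            finite (edges G) \<and> verts G \<in> gen_verts G) \<and>
         (finite (edges G) \<and> verts G \<in> gen_verts G \<and>
            (\<forall>e1\<in>edges G. \<exists>e2\<in>edges G. src G e1 \<in> rng G e2) \<longrightarrow>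
          epsilon_strongly_graded (leavitt R G) (leavitt_component R G))"
proof -
  interpret leavitt_algebra R G
    by (rule leavitt_algebra.intro) (fact assms)+
  have eq: "leavitt_component R G = component"
    by (rule ext) (rule leavitt_component_eq)
  have "finite (edges G) \<and> verts G \<in> gen_verts G" if eps: "epsilon_strongly_graded L component"
  proof -
    have "\<exists>\<epsilon>. \<forall>g. \<epsilon> g \<in> lin_span R L (products g (- g)) \<and>
        (\<forall>x\<in>component g. \<epsilon> g \<cdot> x = x \<and> x \<cdot> \<epsilon> (- g) = x)"
      using eps unfolding epsilon_strongly_graded_iff sums_of_products_component by (rule conjunct2)
    then obtain \<epsilon> where \<epsilon>: "\<And>g. \<epsilon> g \<in> lin_span R L (products g (- g))"
      "\<And>g x. x \<in> component g \<Longrightarrow> \<epsilon> g \<cdot> x = x"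
      by metis
    have "finite (edges G)"
      by (rule finite_edges[OF assms(2) \<epsilon>(1)[of 1] \<epsilon>(2)])
    moreover have "verts G \<in> gen_verts G"
      by (rule verts_gen_verts[OF assms(2) _ \<epsilon>(2)]) (use \<epsilon>(1)[of 0] in simp)
    ultimately show ?thesis by (rule conjI)
  qed
  moreover have "epsilon_strongly_graded L component"
    if "finite (edges G) \<and> verts G \<in> gen_verts G \<and>
      (\<forall>e1\<in>edges G. \<exists>e2\<in>edges G. src G e1 \<in> rng G e2)"
    using that by (intro epsilon_strongly_graded_leavitt) auto
  ultimately show ?thesis
    unfolding eq by blast
qed

end
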